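(* Let $\frac32<\alpha<2$ and $C>0$ be constants and $\rho(m)=\frac{C}{m^\alpha}$. For a random group $\Gamma=\langle S\mid R\rangle\in\mathcal{M}^+(m,\rho)$, let $L$ be the link graph of $\Gamma$ defined below. Then, as $m\to\infty$, the probability that $L$ is connected and the second largest eigenvalue of the random walk on $L$ is less than $\frac{10}{\sqrt C\,m^{1-\frac\alpha2}}$ tends to $1$.
   Context: Positive triangular model $\mathcal{M}^+(m,\rho)$: $\Gamma=\langle S\mid R\rangle$ with $S=\{s_1,\dots,s_m\}$, where $R$ is a random subset of the $m^3$ positive words $s_is_js_k$ ($1\le i,j,k\le m$), each chosen independently with probability $\rho(m)$. The link graph $L$ (the link of a vertex in the Cayley complex of $\Gamma$) is the bipartite multigraph with vertex set $S\sqcup S^{-1}$ in which each relator $s_is_js_k\in R$ contributes the three edges $\{s_j,s_i^{-1}\}$, $\{s_k,s_j^{-1}\}$, $\{s_i,s_k^{-1}\}$, counted with multiplicity. The random walk on a (multi)graph is the operator $(A\phi)(v)=\frac{1}{m(v)}\sum_{u}(\text{number of edges }\{u,v\})\,\phi(u)$, where $m(v)$ is the degree of $v$ counted with multiplicity; it is self-adjoint on $\ell^2$ with weights $m(v)$ and its eigenvalues lie in $[-1,1]$, the largest being $1$. *)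

theory Defs
  imports Complex_Main "HOL-Library.Multiset" "Jordan_Normal_Form.Char_Poly"
begin

text \<open>Generators s_0,...,s_(m-1) are indexed by 0..m-1.  A positive triangular word
 s_i s_j s_k is the triple (i,j,k).\<close>

definition tri_words :: "nat \<Rightarrow> (nat \<times> nat \<times> nat) set" where
  "tri_words m = {0..<m} \<times> {0..<m} \<times> {0..<m}"

text \<open>Probability of an event (a predicate on relator sets R) in the model M+(m,rho):
 each of the m^3 words is in R independently with probability rho.\<close>

definition pos_tri_prob :: "nat \<Rightarrow> real \<Rightarrow> ((nat \<times> nat \<times> nat) set \<Rightarrow> bool) \<Rightarrow> real" where
  "pos_tri_prob m \<rho> E =
     (\<Sum>R\<in>{R. R \<subseteq> tri_words m \<and> E R}.
        \<rho> ^ card R * (1 - \<rho>) ^ (card (tri_words m) - card R))"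

text \<open>Vertices of the link graph: index v < m stands for s_v, index m + v (v < m) for s_v^(-1).
 Edge multiplicity between s_a and s_b^(-1): each relator s_i s_j s_k contributes
 the edges {s_j, s_i^-1}, {s_k, s_j^-1}, {s_i, s_k^-1}.\<close>

definition link_mult_pm :: "(nat \<times> nat \<times> nat) set \<Rightarrow> nat \<Rightarrow> nat \<Rightarrow> nat" where
  "link_mult_pm R a b =
      card {(i,j,k) \<in> R. j = a \<and> i = b}
    + card {(i,j,k) \<in> R. k = a \<and> j = b}
    + card {(i,j,k) \<in> R. i = a \<and> k = b}"

text \<open>Number of edges between vertices u and v (indices < 2m); the graph is bipartite.\<close>

definition link_edges :: "nat \<Rightarrow> (nat \<times> nat \<times> nat) set \<Rightarrow> nat \<Rightarrow> nat \<Rightarrow> nat" where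
  "link_edges m R u v =
     (if u < m \<and> m \<le> v then link_mult_pm R u (v - m)
      else if v < m \<and> m \<le> u then link_mult_pm R v (u - m)
      else 0)"

definition link_degree :: "nat \<Rightarrow> (nat \<times> nat \<times> nat) set \<Rightarrow> nat \<Rightarrow> nat" where
  "link_degree m R v = (\<Sum>u<2*m. link_edges m R u v)"

definition link_connected :: "nat \<Rightarrow> (nat \<times> nat \<times> nat) set \<Rightarrow> bool" where
  "link_connected m R =
     (\<forall>u<2*m. \<forall>v<2*m. (u, v) \<in> {(x, y). x < 2*m \<and> y < 2*m \<and> link_edges m R x y > 0}\<^sup>*)"

text \<open>Matrix of the random walk operator (A phi)(v) = 1/m(v) sum_u (#edges u v) phi(u).\<close>

definition random_walk_mat :: "nat \<Rightarrow> (nat \<times> nat \<times> nat) set \<Rightarrow> real mat" where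
  "random_walk_mat m R =
     mat (2*m) (2*m) (\<lambda>(v, u). real (link_edges m R u v) / real (link_degree m R v))"

text \<open>Eigenvalues (real roots of the characteristic polynomial) counted with
 algebraic multiplicity, and the second largest one.\<close>

definition eigenvalue_mset :: "real mat \<Rightarrow> real multiset" where
  "eigenvalue_mset A =
     (\<Sum>x\<in>{x. poly (char_poly A) x = 0}. replicate_mset (order x (char_poly A)) x)"

definition second_largest_eigenvalue :: "real mat \<Rightarrow> real" where
  "second_largest_eigenvalue A = rev (sorted_list_of_multiset (eigenvalue_mset A)) ! 1"

end

theory Submission
  imports Defs "HOL-Analysis.L2_Norm" "HOL-Real_Asymp.Real_Asymp"
begin

text \<open>The bipartite adjacency matrix of the link is a sum of three \<open>m \<times> m\<close> matrices, each with independent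
  binomial entries of mean \<open>p = m \<rho>\<close>.  Write each of them as the 0/1 matrix of its support plus an
  excess; as \<open>\<alpha> > 3/2\<close>, the excess has small row and column sums.  The centred support matrix
  has norm at most \<open>9 sqrt (m p)\<close> by the trace method: closed walks in it are compared, kernel by kernel,
  with closed walks in an \<open>r \<times> r\<close> matrix, \<open>r\<close> about \<open>m p / 2\<close>, whose entries are 2 with probability 1/3
  and -1 otherwise.  This dense bounded matrix has all moments of order at least two bounded below by 2,
  and its norm is controlled by a net argument.  Chernoff bounds make all degrees nearly
  \<open>3 m p\<close>, so eigenfunctions orthogonal to the constants are nearly orthogonal to them
  in the unweighted sense too, and the mean part of the matrix contributes little.\<close>

section \<open>Expectations over random subsets\<close>

text \<open>Counting the closed walks of a sparse random matrix is the delicate part of the trace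
  method; the comparison replaces the count by a norm estimate. With q the density of the support, a
  walk with e distinct edges has expected weight at most (q/2)^e times its comparison weight. It has
  at most e + 1 vertices, so each vertex absorbs a factor q/2, which cuts its m choices to about q m
  / 2. This fixes \<open>r\<close>, at the cost of one factor 2/q.

  Put D = m p = C m^(2-\<alpha>); the claimed bound is 10 / sqrt D. The three matrices are
  dependent, so their norms are simply added: 27 sqrt D against degrees close to 3 D gives 9 / sqrt
  D, and the gap up to 10 pays for the excess and the mean part. The excess of a row is of order m
  p^2, which tends to 0 exactly when \<alpha> > 3/2.

  Eigenvalues count with algebraic multiplicity, so one factor X - 1 is split off the characteristic
  polynomial. Connectedness comes from the same estimate: a disconnected link has a further
  eigenfunction for 1.\<close>

definition bexp :: "'a set \<Rightarrow> real \<Rightarrow> ('a set \<Rightarrow> real) \<Rightarrow> real" where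
  "bexp U p F = (\<Sum>R\<in>Pow U. p ^ card R * (1 - p) ^ card (U - R) * F R)"

lemma bexp_cong:
  assumes "\<And>R. R \<subseteq> U \<Longrightarrow> F R = G R"
  shows "bexp U p F = bexp U p G"
  unfolding bexp_def using assms by (intro sum.cong) auto

lemma bexp_mono:
  assumes "0 \<le> p" "p \<le> 1" "\<And>R. R \<subseteq> U \<Longrightarrow> F R \<le> G R"
  shows "bexp U p F \<le> bexp U p G"
  unfolding bexp_def using assms by (intro sum_mono mult_left_mono) auto

lemma bexp_add: "bexp U p (\<lambda>R. F R + G R) = bexp U p F + bexp U p G"
  by (simp add: bexp_def sum.distrib distrib_left)

lemma bexp_diff: "bexp U p (\<lambda>R. F R - G R) = bexp U p F - bexp U p G"
  by (simp add: bexp_def sum_subtractf right_diff_distrib)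

lemma bexp_cmult: "bexp U p (\<lambda>R. c * F R) = c * bexp U p F"
  by (simp add: bexp_def sum_distrib_left mult_ac)

lemma bexp_sum: "bexp U p (\<lambda>R. \<Sum>i\<in>I. F i R) = (\<Sum>i\<in>I. bexp U p (F i))"
  unfolding bexp_def by (subst sum.swap) (simp add: sum_distrib_left)

lemma bexp_prod_if:
  assumes "finite U"
  shows "bexp U p (\<lambda>R. \<Prod>u\<in>U. if u \<in> R then f u else g u) = (\<Prod>u\<in>U. p * f u + (1 - p) * g u)"
proof -
  have "(\<Prod>u\<in>U. p * f u + (1 - p) * g u)
      = (\<Sum>R\<in>Pow U. (\<Prod>u\<in>R. p * f u) * (\<Prod>u\<in>U - R. (1 - p) * g u))"
    using assms by (rule prod_add)
  also have "\<dots> = bexp U p (\<lambda>R. \<Prod>u\<in>U. if u \<in> R then f u else g u)"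
    unfolding bexp_def
  proof (intro sum.cong refl)
    fix R assume "R \<in> Pow U"
    then have R: "R \<subseteq> U" by simp
    have "(\<Prod>u\<in>U. if u \<in> R then f u else g u) = (\<Prod>u\<in>R. f u) * (\<Prod>u\<in>U - R. g u)"
      using assms R by (subst prod.subset_diff[OF R]) (auto simp: mult.commute intro!: arg_cong2[where f = times] prod.cong)
    then show "(\<Prod>u\<in>R. p * f u) * (\<Prod>u\<in>U - R. (1 - p) * g u)
        = p ^ card R * (1 - p) ^ card (U - R) * (\<Prod>u\<in>U. if u \<in> R then f u else g u)"
      by (simp add: prod.distrib)
  qed
  finally show ?thesis by simp
qed

lemma bexp_const: "finite U \<Longrightarrow> bexp U p (\<lambda>R. c) = c"
  using bexp_prod_if[of U p "\<lambda>_. 1" "\<lambda>_. 1"] bexp_cmult[of U p c "\<lambda>_. 1"] by simp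

lemma bexp_empty [simp]: "bexp {} p F = F {}"
  by (simp add: bexp_def)

lemma bexp_Un:
  assumes "finite A" "finite B" "A \<inter> B = {}"
  shows "bexp (A \<union> B) p F = bexp A p (\<lambda>R. bexp B p (\<lambda>S. F (R \<union> S)))"
proof -
  have "bexp A p (\<lambda>R. bexp B p (\<lambda>S. F (R \<union> S)))
      = (\<Sum>(R, S)\<in>Pow A \<times> Pow B. (p ^ card R * (1 - p) ^ card (A - R))
          * (p ^ card S * (1 - p) ^ card (B - S)) * F (R \<union> S))"
    unfolding bexp_def by (simp add: sum.cartesian_product sum_distrib_left mult_ac)
  also have "\<dots> = bexp (A \<union> B) p F"
    unfolding bexp_def
  proof (rule sum.reindex_bij_witness[of _ "\<lambda>R. (R \<inter> A, R \<inter> B)" "\<lambda>(R, S). R \<union> S"], goal_cases)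
    case (5 RS)
    obtain R S where RS: "RS = (R, S)" "R \<subseteq> A" "S \<subseteq> B" using 5 by auto
    have "card (R \<union> S) = card R + card S"
      using RS assms by (intro card_Un_disjoint) (auto intro: finite_subset)
    moreover have "A \<union> B - (R \<union> S) = (A - R) \<union> (B - S)" using RS assms by auto
    moreover have "card ((A - R) \<union> (B - S)) = card (A - R) + card (B - S)"
      using assms by (intro card_Un_disjoint) auto
    ultimately show ?case using RS by (simp add: power_add mult_ac)
  qed (use assms in auto)
  finally show ?thesis by simp
qed

lemma bexp_restrict:
  assumes "finite U" "A \<subseteq> U"
  shows "bexp U p (\<lambda>R. F (R \<inter> A)) = bexp A p F"
proof -
  have "bexp U p (\<lambda>R. F (R \<inter> A)) = bexp (A \<union> (U - A)) p (\<lambda>R. F (R \<inter> A))"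
    using assms by (simp add: Un_absorb1)
  also have "\<dots> = bexp A p (\<lambda>R. bexp (U - A) p (\<lambda>S. F ((R \<union> S) \<inter> A)))"
    using assms by (intro bexp_Un) (auto intro: finite_subset)
  also have "\<dots> = bexp A p (\<lambda>R. bexp (U - A) p (\<lambda>S. F R))"
    by (intro bexp_cong) (auto intro!: arg_cong[where f = F])
  also have "\<dots> = bexp A p F"
    using assms by (simp add: bexp_const)
  finally show ?thesis .
qed

lemma bexp_indep:
  assumes "finite V" "\<And>v. v \<in> V \<Longrightarrow> finite (A v)" "disjoint_family_on A V"
  shows "bexp (\<Union>v\<in>V. A v) p (\<lambda>R. \<Prod>v\<in>V. f v (R \<inter> A v)) = (\<Prod>v\<in>V. bexp (A v) p (f v))"
  using assms
proof (induction V rule: finite_induct)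
  case empty
  then show ?case by simp
next
  case (insert w V)
  have disj: "A w \<inter> (\<Union>v\<in>V. A v) = {}"
    using insert by (auto simp: disjoint_family_on_def)
  have "bexp (\<Union>v\<in>insert w V. A v) p (\<lambda>R. \<Prod>v\<in>insert w V. f v (R \<inter> A v))
      = bexp (A w) p (\<lambda>R. bexp (\<Union>v\<in>V. A v) p (\<lambda>S. \<Prod>v\<in>insert w V. f v ((R \<union> S) \<inter> A v)))"
    unfolding UN_insert using insert disj by (intro bexp_Un) auto
  also have "\<dots> = bexp (A w) p (\<lambda>R. bexp (\<Union>v\<in>V. A v) p (\<lambda>S. f w R * (\<Prod>v\<in>V. f v (S \<inter> A v))))"
  proof (intro bexp_cong)
    fix R S assume RS: "R \<subseteq> A w" "S \<subseteq> (\<Union>v\<in>V. A v)"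
    have 1: "(R \<union> S) \<inter> A w = R" using RS disj by auto
    have 2: "(R \<union> S) \<inter> A v = S \<inter> A v" if "v \<in> V" for v
      using RS disj that by auto
    show "(\<Prod>v\<in>insert w V. f v ((R \<union> S) \<inter> A v)) = f w R * (\<Prod>v\<in>V. f v (S \<inter> A v))"
      using insert.hyps 1 2 by simp
  qed
  also have "\<dots> = bexp (A w) p (\<lambda>R. (\<Prod>v\<in>V. bexp (A v) p (f v)) * f w R)"
    using insert by (simp add: bexp_cmult disjoint_family_on_def mult.commute)
  also have "\<dots> = (\<Prod>v\<in>insert w V. bexp (A v) p (f v))"
    using insert.hyps by (simp add: bexp_cmult)
  finally show ?case .
qed

lemma bexp_is_empty:
  assumes "finite A"
  shows "bexp A p (\<lambda>R. if R = {} then b else a) = (1 - (1 - p) ^ card A) * a + (1 - p) ^ card A * b"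
proof -
  have "bexp A p (\<lambda>R. if R = {} then b else a)
      = bexp A p (\<lambda>R. a + (b - a) * (\<Prod>u\<in>A. if u \<in> R then 0 else 1))"
  proof (intro bexp_cong)
    fix R assume "R \<subseteq> A"
    then have "(\<Prod>u\<in>A. if u \<in> R then 0 else 1 :: real) = of_bool (R = {})"
      using assms by (auto simp: prod_zero_iff)
    then show "(if R = {} then b else a) = a + (b - a) * (\<Prod>u\<in>A. if u \<in> R then 0 else 1)"
      by simp
  qed
  also have "\<dots> = a + (b - a) * (1 - p) ^ card A"
    using assms by (simp add: bexp_add bexp_cmult bexp_const bexp_prod_if)
  finally show ?thesis by (simp add: algebra_simps)
qed

text \<open>Each fibre of \<open>g\<close> is hit independently with probability
  \<open>1 - (1 - p) ^ n\<close>, so the image of a random subset is again a random subset. Applied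
  to the map from relators to matrix positions, this gives the support matrix independent 0/1
  entries. \<open>F\<close> is generalised because the induction moves the image of the new fibre
  into it.\<close>

lemma bexp_image:
  assumes "finite V" "\<And>v. v \<in> V \<Longrightarrow> finite (A v) \<and> card (A v) = n \<and> (\<forall>u\<in>A v. g u = v)"
  shows "bexp (\<Union>v\<in>V. A v) p (\<lambda>R. F (g ` R)) = bexp V (1 - (1 - p) ^ n) F"
  using assms
proof (induction V arbitrary: F rule: finite_induct)
  case empty
  then show ?case by simp
next
  case (insert w V)
  define q where "q = 1 - (1 - p) ^ n"
  have disj: "A w \<inter> (\<Union>v\<in>V. A v) = {}"
  proof (rule ccontr)
    assume "\<not> ?thesis"
    then obtain x v where "x \<in> A w" "v \<in> V" "x \<in> A v" by auto
    then show False using insert.hyps(2) insert.prems[of w] insert.prems[of v] by auto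
  qed
  have "bexp (\<Union>v\<in>insert w V. A v) p (\<lambda>R. F (g ` R))
      = bexp (A w) p (\<lambda>R. bexp (\<Union>v\<in>V. A v) p (\<lambda>S. F (g ` R \<union> g ` S)))"
    unfolding UN_insert image_Un[symmetric] using insert disj by (intro bexp_Un) auto
  also have "\<dots> = bexp (A w) p (\<lambda>R. bexp V q (\<lambda>S. F (g ` R \<union> S)))"
    unfolding q_def using insert.prems by (intro bexp_cong insert.IH) auto
  also have "\<dots> = bexp (A w) p (\<lambda>R. if R = {} then bexp V q F else bexp V q (\<lambda>S. F (insert w S)))"
  proof (intro bexp_cong)
    fix R assume "R \<subseteq> A w"
    then have "\<forall>u\<in>R. g u = w" using insert.prems[of w] by blast
    then have "R = {} \<or> g ` R = {w}" by (metis image_constant_conv image_cong)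
    then show "bexp V q (\<lambda>S. F (g ` R \<union> S))
        = (if R = {} then bexp V q F else bexp V q (\<lambda>S. F (insert w S)))" by auto
  qed
  also have "\<dots> = q * bexp V q (\<lambda>S. F (insert w S)) + (1 - q) * bexp V q F"
    using insert.prems[of w] by (simp add: bexp_is_empty q_def)
  also have "\<dots> = bexp {w} q (\<lambda>R. bexp V q (\<lambda>S. F (R \<union> S)))"
    by (simp add: bexp_def Pow_insert)
  also have "\<dots> = bexp (insert w V) q F"
    using insert.hyps bexp_Un[of "{w}" V q F] by simp
  finally show ?case by (simp add: q_def)
qed

lemma bexp_markov:
  assumes "0 \<le> p" "p \<le> 1" "\<And>R. R \<subseteq> U \<Longrightarrow> 0 \<le> F R" "\<And>R. R \<subseteq> U \<Longrightarrow> P R \<Longrightarrow> c \<le> F R" "0 < c"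
  shows "bexp U p (\<lambda>R. of_bool (P R)) \<le> bexp U p F / c"
proof -
  have "bexp U p (\<lambda>R. of_bool (P R)) \<le> bexp U p (\<lambda>R. (1 / c) * F R)"
  proof (rule bexp_mono[OF assms(1,2)])
    fix R assume R: "R \<subseteq> U"
    show "of_bool (P R) \<le> 1 / c * F R"
      using assms(3,4)[OF R] assms(5) by (cases "P R") (auto simp: field_simps)
  qed
  then show ?thesis using bexp_cmult[of U p "1 / c" F] by simp
qed

text \<open>The entries along a walk repeat. Grouping the indices by their position
  \<open>e s\<close> turns the product into powers of independent entries, hence into moments.
  Positions never visited have exponent 0 and contribute the factor 1.\<close>

lemma bexp_moment:
  assumes "finite V" "finite I" "e ` I \<subseteq> V"
  shows "bexp V \<theta> (\<lambda>R. \<Prod>s\<in>I. if e s \<in> R then y else z)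
    = (\<Prod>v\<in>e ` I. \<theta> * y ^ card {s\<in>I. e s = v} + (1 - \<theta>) * z ^ card {s\<in>I. e s = v})"
proof -
  let ?n = "\<lambda>v. card {s\<in>I. e s = v}"
  have "bexp V \<theta> (\<lambda>R. \<Prod>s\<in>I. if e s \<in> R then y else z)
      = bexp V \<theta> (\<lambda>R. \<Prod>v\<in>V. if v \<in> R then y ^ ?n v else z ^ ?n v)"
  proof (intro bexp_cong)
    fix R assume "R \<subseteq> V"
    have "(\<Prod>s\<in>I. if e s \<in> R then y else z)
        = (\<Prod>v\<in>V. \<Prod>s | s \<in> I \<and> e s = v. if e s \<in> R then y else z)"
      using assms by (intro prod.group[symmetric]) auto
    also have "\<dots> = (\<Prod>v\<in>V. if v \<in> R then y ^ ?n v else z ^ ?n v)"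
      by (intro prod.cong refl) simp
    finally show "(\<Prod>s\<in>I. if e s \<in> R then y else z)
        = (\<Prod>v\<in>V. if v \<in> R then y ^ ?n v else z ^ ?n v)" .
  qed
  also have "\<dots> = (\<Prod>v\<in>V. \<theta> * y ^ ?n v + (1 - \<theta>) * z ^ ?n v)"
    using assms by (intro bexp_prod_if)
  also have "\<dots> = (\<Prod>v\<in>e ` I. \<theta> * y ^ ?n v + (1 - \<theta>) * z ^ ?n v)"
  proof (rule prod.mono_neutral_right)
    show "\<forall>v\<in>V - e ` I. \<theta> * y ^ ?n v + (1 - \<theta>) * z ^ ?n v = 1"
    proof
      fix v assume "v \<in> V - e ` I"
      then have "{s \<in> I. e s = v} = {}" by auto
      then show "\<theta> * y ^ ?n v + (1 - \<theta>) * z ^ ?n v = 1" by (simp del: Collect_empty_eq)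
    qed
  qed (use assms in auto)
  finally show ?thesis .
qed

section \<open>Comparison of closed walk sums\<close>

text \<open>This is the trace of (Y Y^T)^k written out: a closed walk of length 2k alternates
  between rows \<open>u t\<close> and columns \<open>v t\<close>, and \<open>Suc t mod k\<close>
  closes it.\<close>

definition walk_sum :: "(nat \<Rightarrow> nat \<Rightarrow> real) \<Rightarrow> nat \<Rightarrow> nat \<Rightarrow> real" where
  "walk_sum Y n k = (\<Sum>u\<in>{..<k} \<rightarrow>\<^sub>E {..<n}. \<Sum>v\<in>{..<k} \<rightarrow>\<^sub>E {..<n}.
     \<Prod>t<k. Y (u t) (v t) * Y (u (Suc t mod k)) (v t))"

text \<open>The 2k steps are indexed by \<open>{..<k} \<times> UNIV\<close>:
  \<open>(t, False)\<close> joins \<open>u t\<close> to \<open>v t\<close>, and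
  \<open>(t, True)\<close> joins \<open>v t\<close> to the next row. Both are recorded as matrix
  positions, row first.\<close>

definition walk_edge :: "nat \<Rightarrow> (nat \<Rightarrow> nat) \<Rightarrow> (nat \<Rightarrow> nat) \<Rightarrow> nat \<times> bool \<Rightarrow> nat \<times> nat" where
  "walk_edge k u v = (\<lambda>(t, b). (if b then u (Suc t mod k) else u t, v t))"

lemma prod_walk_edge:
  "(\<Prod>t<k. Y (u t) (v t) * Y (u (Suc t mod k)) (v t))
    = (\<Prod>s\<in>{..<k} \<times> UNIV. case_prod Y (walk_edge k u v s))"
proof -
  have "(\<Prod>s\<in>{..<k} \<times> UNIV. case_prod Y (walk_edge k u v s))
      = (\<Prod>t<k. \<Prod>b\<in>UNIV. case_prod Y (walk_edge k u v (t, b)))"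
    by (simp add: prod.cartesian_product)
  also have "\<dots> = (\<Prod>t<k. Y (u t) (v t) * Y (u (Suc t mod k)) (v t))"
    by (intro prod.cong refl) (simp add: UNIV_bool walk_edge_def)
  finally show ?thesis by simp
qed

text \<open>The right side depends on \<open>f\<close> only through which arguments have equal
  values, so functions with the same kernel give the same product.\<close>

lemma prod_fibre_card:
  "(\<Prod>x\<in>f ` I. h (card {s\<in>I. f s = x})) = (\<Prod>c\<in>(\<lambda>s. {t\<in>I. f t = f s}) ` I. h (card c))"
proof -
  have "(\<lambda>s. {t\<in>I. f t = f s}) ` I = (\<lambda>x. {s\<in>I. f s = x}) ` (f ` I)"
    by (simp add: image_image)
  moreover have "inj_on (\<lambda>x. {s\<in>I. f s = x}) (f ` I)"
    by (rule inj_onI) blast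
  ultimately show ?thesis
    by (simp add: prod.reindex)
qed

lemma prod_fibre_card_cong:
  assumes "\<And>s t. s \<in> I \<Longrightarrow> t \<in> I \<Longrightarrow> e s = e t \<longleftrightarrow> e' s = e' t"
  shows "(\<Prod>x\<in>e ` I. h (card {s\<in>I. e s = x})) = (\<Prod>x\<in>e' ` I. h (card {s\<in>I. e' s = x}))"
proof -
  have "(\<lambda>s. {t\<in>I. e t = e s}) ` I = (\<lambda>s. {t\<in>I. e' t = e' s}) ` I"
    using assms by (intro image_cong refl Collect_cong) auto
  then show ?thesis by (simp only: prod_fibre_card)
qed

text \<open>The functions with the same kernel as \<open>u\<close> are the injective relabellings of its values.\<close>

lemma card_same_kernel:
  fixes u :: "nat \<Rightarrow> nat"
  shows "card {w \<in> {..<k} \<rightarrow>\<^sub>E {..<n}. \<forall>s<k. \<forall>t<k. w s = w t \<longleftrightarrow> u s = u t}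
    = (\<Prod>i<card (u ` {..<k}). n - i)"
proof -
  let ?J = "u ` {..<k}"
  let ?S = "{w \<in> {..<k} \<rightarrow>\<^sub>E {..<n}. \<forall>s<k. \<forall>t<k. w s = w t \<longleftrightarrow> u s = u t}"
  let ?F = "{f \<in> ?J \<rightarrow>\<^sub>E {..<n}. inj_on f ?J}"
  have "bij_betw (\<lambda>f. restrict (f \<circ> u) {..<k}) ?F ?S"
  \<comment> \<open>A relabelling is composed with \<open>u\<close>; conversely \<open>SOME\<close>
    picks an index for each value of \<open>u\<close>, and \<open>w\<close> is read off
    there.\<close>
  proof (rule bij_betw_byWitness[where f' = "\<lambda>w. restrict (\<lambda>x. w (SOME s. s < k \<and> u s = x)) ?J"])
    have some: "(SOME s. s < k \<and> u s = u t) < k \<and> u (SOME s. s < k \<and> u s = u t) = u t"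
      if "t < k" for t
      by (rule someI[of _ t]) (use that in auto)
    show "\<forall>f\<in>?F. restrict (\<lambda>x. restrict (f \<circ> u) {..<k} (SOME s. s < k \<and> u s = x)) ?J = f"
    proof
      fix f assume f: "f \<in> ?F"
      show "restrict (\<lambda>x. restrict (f \<circ> u) {..<k} (SOME s. s < k \<and> u s = x)) ?J = f"
      proof (rule ext)
        fix x
        show "restrict (\<lambda>x. restrict (f \<circ> u) {..<k} (SOME s. s < k \<and> u s = x)) ?J x = f x"
        proof (cases "x \<in> ?J")
          case True
          then obtain t where "t < k" "x = u t" by auto
          then show ?thesis using some[of t] by auto
        next
          case False
          then show ?thesis using f by (auto simp: PiE_def extensional_def)
        qed
      qed
    qed
    show "\<forall>w\<in>?S. restrict ((restrict (\<lambda>x. w (SOME s. s < k \<and> u s = x)) ?J) \<circ> u) {..<k} = w"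
    proof
      fix w assume w: "w \<in> ?S"
      show "restrict ((restrict (\<lambda>x. w (SOME s. s < k \<and> u s = x)) ?J) \<circ> u) {..<k} = w"
      proof (rule ext)
        fix t
        show "restrict ((restrict (\<lambda>x. w (SOME s. s < k \<and> u s = x)) ?J) \<circ> u) {..<k} t = w t"
        proof (cases "t < k")
          case True
          then show ?thesis using some[of t] w by auto
        next
          case False
          then show ?thesis using w by (auto simp: PiE_def extensional_def)
        qed
      qed
    qed
    show "(\<lambda>f. restrict (f \<circ> u) {..<k}) ` ?F \<subseteq> ?S"
      by (auto simp: inj_on_eq_iff split: if_splits)
    show "(\<lambda>w. restrict (\<lambda>x. w (SOME s. s < k \<and> u s = x)) ?J) ` ?S \<subseteq> ?F"
    proof (intro image_subsetI CollectI conjI)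
      fix w assume w: "w \<in> ?S"
      show "restrict (\<lambda>x. w (SOME s. s < k \<and> u s = x)) ?J \<in> ?J \<rightarrow>\<^sub>E {..<n}"
        using w some by (auto simp: PiE_def Pi_def)
      show "inj_on (restrict (\<lambda>x. w (SOME s. s < k \<and> u s = x)) ?J) ?J"
        using w some by (auto intro!: inj_onI)
    qed
  qed
  then have "card ?S = card ?F" by (rule bij_betw_same_card[symmetric])
  also have "\<dots> = (\<Prod>i<card ?J. n - i)"
    using card_inj_on_subset_funcset[of ?J "{..<n}" ?J] by (simp add: atLeast0LessThan)
  finally show ?thesis .
qed

text \<open>Tuples are grouped by kernel. On a kernel with b blocks \<open>\<gamma>\<close> is
  constant and there are m (m-1) ... (m-b+1) tuples, so it suffices that x (m - i) <= r - i for i <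
  b. Since b <= k, the summand \<open>k\<close> in the hypothesis covers what the falling factorial
  of \<open>r\<close> loses.\<close>

lemma kernel_comparison:
  fixes \<gamma> :: "(nat \<Rightarrow> nat) \<Rightarrow> real"
  assumes inv: "\<And>u w. (\<And>s t. s < k \<Longrightarrow> t < k \<Longrightarrow> u s = u t \<longleftrightarrow> w s = w t) \<Longrightarrow> \<gamma> u = \<gamma> w"
    and nonneg: "\<And>u. 0 \<le> \<gamma> u"
    and x: "0 \<le> x" "x * real m + real k \<le> real r"
  shows "(\<Sum>u\<in>{..<k} \<rightarrow>\<^sub>E {..<m}. x ^ card (u ` {..<k}) * \<gamma> u) \<le> (\<Sum>u\<in>{..<k} \<rightarrow>\<^sub>E {..<r}. \<gamma> u)"
proof -
  define ker where "ker u = {(s, t). s < k \<and> t < k \<and> u s = u t}" for u :: "nat \<Rightarrow> nat"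
  have ker_sub: "ker u \<subseteq> {..<k} \<times> {..<k}" for u by (auto simp: ker_def)
  have fin: "finite (Pow ({..<k} \<times> {..<k}))" by simp
  have finP: "finite ({..<k} \<rightarrow>\<^sub>E {..<n})" for n :: nat by (intro finite_PiE) auto
  have group: "(\<Sum>u\<in>{..<k} \<rightarrow>\<^sub>E {..<n}. g u)
      = (\<Sum>\<pi>\<in>Pow ({..<k} \<times> {..<k}). \<Sum>u | u \<in> {..<k} \<rightarrow>\<^sub>E {..<n} \<and> ker u = \<pi>. g u)"
    for g :: "(nat \<Rightarrow> nat) \<Rightarrow> real" and n
    using ker_sub by (intro sum.group[symmetric] finP) auto
  have ker_eq: "ker w = ker u \<longleftrightarrow> (\<forall>s<k. \<forall>t<k. w s = w t \<longleftrightarrow> u s = u t)" for w u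
    unfolding ker_def set_eq_iff by auto
  show ?thesis
    unfolding group
  proof (rule sum_mono)
    fix \<pi> assume "\<pi> \<in> Pow ({..<k} \<times> {..<k})"
    let ?S = "\<lambda>n. {u. u \<in> {..<k} \<rightarrow>\<^sub>E {..<n} \<and> ker u = \<pi>}"
    show "(\<Sum>u\<in>?S m. x ^ card (u ` {..<k}) * \<gamma> u) \<le> (\<Sum>u\<in>?S r. \<gamma> u)"
    proof (cases "?S m = {}")
      case True
      then show ?thesis using nonneg by (simp add: sum_nonneg del: Collect_empty_eq)
    next
      case False
      then obtain u0 where u0: "ker u0 = \<pi>" by auto
      define b where "b = card (u0 ` {..<k})"
      have bk: "b \<le> k" unfolding b_def by (metis card_image_le card_lessThan finite_lessThan)
      have kr: "k \<le> r" using x by (smt (verit) of_nat_0_le_iff of_nat_le_iff mult_nonneg_nonneg)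
      have S: "?S n = {w \<in> {..<k} \<rightarrow>\<^sub>E {..<n}. \<forall>s<k. \<forall>t<k. w s = w t \<longleftrightarrow> u0 s = u0 t}" for n
        using u0 ker_eq by blast
      have cardS: "card (?S n) = (\<Prod>i<b. n - i)" for n
        unfolding S b_def by (rule card_same_kernel)
      have \<gamma>eq: "\<gamma> u = \<gamma> u0" if "ker u = \<pi>" for u
        using that u0 ker_eq by (intro inv) blast
      have ceq: "card (u ` {..<k}) = b" if "ker u = \<pi>" for u
        unfolding b_def
      proof (rule bij_betw_same_card)
        have k: "\<And>s t. s < k \<Longrightarrow> t < k \<Longrightarrow> u s = u t \<longleftrightarrow> u0 s = u0 t"
          using that u0 ker_eq by blast
        show "bij_betw (\<lambda>y. u0 (SOME s. s < k \<and> u s = y)) (u ` {..<k}) (u0 ` {..<k})"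
        proof -
          have some: "(SOME s. s < k \<and> u s = u t) < k \<and> u (SOME s. s < k \<and> u s = u t) = u t"
            if "t < k" for t
            by (rule someI[of _ t]) (use that in auto)
          have val: "u0 (SOME s. s < k \<and> u s = u t) = u0 t" if "t < k" for t
            using some[OF that] k that by blast
          show ?thesis
            unfolding bij_betw_def
          proof
            show "inj_on (\<lambda>y. u0 (SOME s. s < k \<and> u s = y)) (u ` {..<k})"
              by (auto intro!: inj_onI simp: val k)
            show "(\<lambda>y. u0 (SOME s. s < k \<and> u s = y)) ` u ` {..<k} = u0 ` {..<k}"
              by (simp add: image_image val cong: image_cong_simp)
          qed
        qed
      qed
      have "real (card (?S m)) * x ^ b \<le> real (card (?S r))"
      proof -
        have "real (card (?S m)) * x ^ b = (\<Prod>i<b. x * real (m - i))"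
          by (simp add: cardS prod.distrib)
        also have "\<dots> \<le> (\<Prod>i<b. real (r - i))"
        proof (rule prod_mono)
          fix i assume i: "i \<in> {..<b}"
          have "x * real (m - i) \<le> x * real m" using x by (intro mult_left_mono) auto
          also have "\<dots> \<le> real (r - i)" using x i bk kr by (simp add: of_nat_diff)
          finally show "0 \<le> x * real (m - i) \<and> x * real (m - i) \<le> real (r - i)"
            using x by simp
        qed
        finally show ?thesis by (simp add: cardS)
      qed
      then have "real (card (?S m)) * x ^ b * \<gamma> u0 \<le> real (card (?S r)) * \<gamma> u0"
        using nonneg by (intro mult_right_mono)
      moreover have "(\<Sum>u\<in>?S m. x ^ card (u ` {..<k}) * \<gamma> u) = (\<Sum>u\<in>?S m. x ^ b * \<gamma> u0)"
        by (intro sum.cong refl) (simp add: ceq \<gamma>eq)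
      moreover have "(\<Sum>u\<in>?S r. \<gamma> u) = (\<Sum>u\<in>?S r. \<gamma> u0)"
        by (intro sum.cong refl) (simp add: \<gamma>eq)
      ultimately show ?thesis by (simp add: mult.assoc)
    qed
  qed
qed

text \<open>A closed walk is connected, so every vertex after the first is reached by an edge of its own.\<close>

lemma walk_vertices_le_edges:
  assumes "0 < k"
  shows "card (u ` {..<k}) + card (v ` {..<k}) \<le> card (walk_edge k u v ` ({..<k} \<times> UNIV)) + 1"
proof -
  \<comment> \<open>\<open>u'\<close> continues \<open>u\<close> cyclically, so the first n double
    steps visit the rows u' 0, ..., u' n, and the return to \<open>u 0\<close> is no special case.
    The inequality is proved for all such prefixes: a column or row not met before makes the edge
    leading to it new.\<close>
  define u' where "u' t = u (t mod k)" for t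
  define E where "E n = (\<Union>t<n. {(u' t, v t), (u' (Suc t), v t)})" for n
  have finE: "finite (E n)" for n by (simp add: E_def)
  have step: "card (u' ` {..n}) + card (v ` {..<n}) \<le> card (E n) + 1" for n
  proof (induction n)
    case 0
    then show ?case by simp
  next
    case (Suc n)
    define F where "F = insert (u' n, v n) (E n)"
    have EF: "E (Suc n) = insert (u' (Suc n), v n) F"
      by (auto simp: E_def F_def lessThan_Suc)
    have 1: "card (v ` {..<Suc n}) + card (E n) \<le> card (v ` {..<n}) + card F"
    proof (cases "v n \<in> v ` {..<n}")
      case True
      then have "v ` {..<Suc n} = v ` {..<n}" by (auto simp: lessThan_Suc)
      then show ?thesis using finE card_mono[of F "E n"] by (auto simp: F_def)
    next
      case False
      then have "(u' n, v n) \<notin> E n" by (auto simp: E_def)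
      then show ?thesis using finE False by (simp add: F_def lessThan_Suc)
    qed
    have 2: "card (u' ` {..Suc n}) + card F \<le> card (u' ` {..n}) + card (E (Suc n))"
    proof (cases "u' (Suc n) \<in> u' ` {..n}")
      case True
      then have "u' ` {..Suc n} = u' ` {..n}" by (auto simp: atMost_Suc)
      then show ?thesis using finE[of n] by (simp add: EF F_def card_insert_le)
    next
      case False
      then have "(u' (Suc n), v n) \<notin> F"
        unfolding F_def E_def by (auto simp: image_iff Ball_def)
      then show ?thesis using finE False by (simp add: EF F_def atMost_Suc)
    qed
    show ?case using 1 2 Suc.IH by linarith
  qed
  have u'_eq: "u' t = u t" if "t < k" for t using that by (simp add: u'_def)
  have "walk_edge k u v ` ({..<k} \<times> UNIV) = (\<Union>t<k. walk_edge k u v ` {(t, False), (t, True)})"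
    by (auto simp: UNIV_bool)
  also have "\<dots> = E k"
    unfolding E_def
  proof (intro SUP_cong refl)
    fix t assume "t \<in> {..<k}"
    then show "walk_edge k u v ` {(t, False), (t, True)} = {(u' t, v t), (u' (Suc t), v t)}"
      by (simp add: walk_edge_def u'_eq) (simp add: u'_def)
  qed
  finally have "E k = walk_edge k u v ` ({..<k} \<times> UNIV)" by simp
  moreover have "u ` {..<k} \<subseteq> u' ` {..k}"
  proof (rule image_subsetI)
    fix t assume "t \<in> {..<k}"
    then show "u t \<in> u' ` {..k}" using u'_eq[of t] by (intro image_eqI[of _ _ t]) auto
  qed
  then have "card (u ` {..<k}) \<le> card (u' ` {..k})"
    by (intro card_mono) auto
  ultimately show ?thesis using step[of k] by simp
qed

text \<open>Moments of the comparison entry. A centred law on {a, -b} has second moment ab and third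
  moment ab (a - b); a = 2, b = 1 makes both equal to 2, and the higher moments are no smaller.
  Symmetric signs would not do, as their odd moments vanish.\<close>

definition biased_moment :: "nat \<Rightarrow> real" where
  "biased_moment n = 1/3 * 2 ^ n + (1 - 1/3) * (-1) ^ n"

lemma biased_moment_ge:
  assumes "2 \<le> n"
  shows "2 \<le> biased_moment n"
proof (cases "n = 2")
  case False
  then have "(2::real) ^ 3 \<le> 2 ^ n" using assms by (intro power_increasing) auto
  moreover have "(-1 :: real) \<le> (-1) ^ n" by (cases "even n") auto
  ultimately show ?thesis by (simp add: biased_moment_def)
qed (simp add: biased_moment_def)

lemma biased_moment_nonneg: "0 < n \<Longrightarrow> 0 \<le> biased_moment n"
  using biased_moment_ge[of n] by (cases "n = 1") (auto simp: biased_moment_def)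

text \<open>For n = 1 both sides vanish. For n >= 2 a centred 0/1 variable of mean \<open>q\<close>
  has moments of absolute value at most \<open>q\<close>, while the comparison moment is at least 2;
  hence the factor \<open>q / 2\<close>.\<close>

lemma centred_moment_le:
  fixes q :: real
  assumes q: "0 \<le> q" "q \<le> 1" and n: "0 < n"
  shows "\<bar>q * (1 - q) ^ n + (1 - q) * (- q) ^ n\<bar> \<le> q / 2 * biased_moment n"
proof (cases "n = 1")
  case True
  then show ?thesis by (simp add: biased_moment_def algebra_simps)
next
  case False
  then have n2: "2 \<le> n" using n by simp
  have "\<bar>q * (1 - q) ^ n + (1 - q) * (- q) ^ n\<bar> \<le> \<bar>q * (1 - q) ^ n\<bar> + \<bar>(1 - q) * (- q) ^ n\<bar>"
    by (rule abs_triangle_ineq)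
  also have "\<dots> = q * (1 - q) ^ n + (1 - q) * q ^ n"
    using q by (simp add: abs_mult power_abs)
  also have "\<dots> \<le> q * (1 - q) + (1 - q) * q ^ 2"
    using q n2 power_decreasing[of 1 n "1 - q"] power_decreasing[of 2 n q]
    by (intro add_mono mult_left_mono) auto
  also have "\<dots> = q - q * (q * q)" by (simp add: algebra_simps power2_eq_square)
  also have "\<dots> \<le> q" using q by simp
  also have "\<dots> \<le> q / 2 * biased_moment n"
    using mult_left_mono[OF biased_moment_ge[OF n2], of "q / 2"] q by simp
  finally show ?thesis .
qed

text \<open>Both expectations expand into sums over pairs of products of moments, one for each
  distinct edge. These products depend only on the kernels of \<open>u\<close> and \<open>v\<close>.
  The factors q/2 are redistributed from edges to vertices, so that the kernel comparison
  applies.\<close>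

lemma walk_sum_comparison:
  assumes q: "0 < q" "q \<le> 1" and k: "0 < k" and r: "q / 2 * real m + real k \<le> real r"
  shows "bexp ({..<m} \<times> {..<m}) q (\<lambda>R. walk_sum (\<lambda>a b. if (a, b) \<in> R then 1 - q else - q) m k)
    \<le> 2 / q * bexp ({..<r} \<times> {..<r}) (1/3) (\<lambda>R. walk_sum (\<lambda>a b. if (a, b) \<in> R then 2 else - 1) r k)"
proof -
  let ?I = "{..<k} \<times> (UNIV :: bool set)"
  let ?w = "\<lambda>n. {..<k} \<rightarrow>\<^sub>E {..<n::nat}"
  define \<gamma> where "\<gamma> u v = (\<Prod>x\<in>walk_edge k u v ` ?I. biased_moment (card {s\<in>?I. walk_edge k u v s = x}))" for u v
  have card_pos: "0 < card {s\<in>?I. walk_edge k u v s = x}" if "x \<in> walk_edge k u v ` ?I" for u v x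
    using that by (subst card_gt_0_iff) auto
  have \<gamma>_nonneg: "0 \<le> \<gamma> u v" for u v
    unfolding \<gamma>_def using card_pos by (intro prod_nonneg biased_moment_nonneg) auto
  have expand: "bexp ({..<n} \<times> {..<n}) \<theta> (\<lambda>R. walk_sum (\<lambda>a b. if (a, b) \<in> R then y else z) n k)
      = (\<Sum>u\<in>?w n. \<Sum>v\<in>?w n. \<Prod>x\<in>walk_edge k u v ` ?I.
          \<theta> * y ^ card {s\<in>?I. walk_edge k u v s = x} + (1 - \<theta>) * z ^ card {s\<in>?I. walk_edge k u v s = x})"
    for n \<theta> y z
  proof -
    have "bexp ({..<n} \<times> {..<n}) \<theta> (\<lambda>R. walk_sum (\<lambda>a b. if (a, b) \<in> R then y else z) n k)
      = (\<Sum>u\<in>?w n. \<Sum>v\<in>?w n. bexp ({..<n} \<times> {..<n}) \<theta>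
          (\<lambda>R. \<Prod>s\<in>?I. if walk_edge k u v s \<in> R then y else z))"
      unfolding walk_sum_def bexp_sum
      using prod_walk_edge[of "\<lambda>a b. if (a, b) \<in> _ then y else z", where k = k]
      by (simp add: case_prod_unfold)
    also have "\<dots> = (\<Sum>u\<in>?w n. \<Sum>v\<in>?w n. \<Prod>x\<in>walk_edge k u v ` ?I.
          \<theta> * y ^ card {s\<in>?I. walk_edge k u v s = x} + (1 - \<theta>) * z ^ card {s\<in>?I. walk_edge k u v s = x})"
    proof (intro sum.cong refl bexp_moment)
      fix u v assume "u \<in> ?w n" "v \<in> ?w n"
      then show "walk_edge k u v ` ?I \<subseteq> {..<n} \<times> {..<n}"
        using k by (auto simp: walk_edge_def PiE_def Pi_def)
    qed auto
    finally show ?thesis .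
  qed
  have inv: "\<gamma> u v = \<gamma> u' v'"
    if u: "\<And>s t. s < k \<Longrightarrow> t < k \<Longrightarrow> u s = u t \<longleftrightarrow> u' s = u' t"
      and v: "\<And>s t. s < k \<Longrightarrow> t < k \<Longrightarrow> v s = v t \<longleftrightarrow> v' s = v' t" for u v u' v'
    unfolding \<gamma>_def
  proof (rule prod_fibre_card_cong)
    fix s t assume "s \<in> ?I" "t \<in> ?I"
    then show "walk_edge k u v s = walk_edge k u v t \<longleftrightarrow> walk_edge k u' v' s = walk_edge k u' v' t"
      using k by (cases s; cases t) (auto simp: walk_edge_def u v)
  qed
  let ?c = "\<lambda>u :: nat \<Rightarrow> nat. card (u ` {..<k})"
  have walk_term: "(\<Prod>x\<in>walk_edge k u v ` ?I. q * (1 - q) ^ card {s\<in>?I. walk_edge k u v s = x}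
          + (1 - q) * (- q) ^ card {s\<in>?I. walk_edge k u v s = x})
      \<le> 2 / q * ((q / 2) ^ ?c u * ((q / 2) ^ ?c v * \<gamma> u v))" for u v
  proof -
    let ?E = "walk_edge k u v ` ?I"
    have "(\<Prod>x\<in>?E. q * (1 - q) ^ card {s\<in>?I. walk_edge k u v s = x}
          + (1 - q) * (- q) ^ card {s\<in>?I. walk_edge k u v s = x})
        \<le> (\<Prod>x\<in>?E. \<bar>q * (1 - q) ^ card {s\<in>?I. walk_edge k u v s = x}
          + (1 - q) * (- q) ^ card {s\<in>?I. walk_edge k u v s = x}\<bar>)"
      by (subst abs_prod[symmetric]) (rule abs_ge_self)
    also have "\<dots> \<le> (\<Prod>x\<in>?E. q / 2 * biased_moment (card {s\<in>?I. walk_edge k u v s = x}))"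
      using q card_pos by (intro prod_mono conjI abs_ge_zero centred_moment_le) auto
    also have "\<dots> = (q / 2) ^ card ?E * \<gamma> u v"
      unfolding prod.distrib \<gamma>_def by simp
    also have "\<dots> \<le> (2 / q * (q / 2) ^ (?c u + ?c v)) * \<gamma> u v"
    proof (rule mult_right_mono[OF _ \<gamma>_nonneg])
      \<comment> \<open>As \<open>q / 2 \<le> 1\<close>, the power grows when the exponent drops to
        the number of vertices; the added 1 in the exponent costs the factor
        \<open>2 / q\<close>.\<close>
      have "(q / 2) ^ (card ?E + 1) \<le> (q / 2) ^ (?c u + ?c v)"
        using q walk_vertices_le_edges[OF k, of u v] by (intro power_decreasing) auto
      then show "(q / 2) ^ card ?E \<le> 2 / q * (q / 2) ^ (?c u + ?c v)"
        using q by (simp add: field_simps)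
    qed
    finally show ?thesis by (simp add: power_add mult_ac)
  qed
  have "bexp ({..<m} \<times> {..<m}) q (\<lambda>R. walk_sum (\<lambda>a b. if (a, b) \<in> R then 1 - q else - q) m k)
      \<le> (\<Sum>u\<in>?w m. \<Sum>v\<in>?w m. 2 / q * ((q / 2) ^ ?c u * ((q / 2) ^ ?c v * \<gamma> u v)))"
    unfolding expand by (intro sum_mono walk_term)
  also have "\<dots> = 2 / q * (\<Sum>u\<in>?w m. (q / 2) ^ ?c u * (\<Sum>v\<in>?w m. (q / 2) ^ ?c v * \<gamma> u v))"
    by (simp add: sum_distrib_left)
  \<comment> \<open>The comparison acts on the columns for each fixed \<open>u\<close>, and below on
    the rows with the sum over the columns as weight.\<close>
  also have "\<dots> \<le> 2 / q * (\<Sum>u\<in>?w m. (q / 2) ^ ?c u * (\<Sum>v\<in>?w r. \<gamma> u v))"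
  proof (intro mult_left_mono sum_mono kernel_comparison)
    fix u v v' :: "nat \<Rightarrow> nat"
    assume "\<And>s t. s < k \<Longrightarrow> t < k \<Longrightarrow> v s = v t \<longleftrightarrow> v' s = v' t"
    then show "\<gamma> u v = \<gamma> u v'" by (intro inv refl)
  qed (use q r \<gamma>_nonneg in simp_all)
  also have "\<dots> \<le> 2 / q * (\<Sum>u\<in>?w r. \<Sum>v\<in>?w r. \<gamma> u v)"
  proof (intro mult_left_mono kernel_comparison)
    fix u u' :: "nat \<Rightarrow> nat"
    assume "\<And>s t. s < k \<Longrightarrow> t < k \<Longrightarrow> u s = u t \<longleftrightarrow> u' s = u' t"
    then show "(\<Sum>v\<in>?w r. \<gamma> u v) = (\<Sum>v\<in>?w r. \<gamma> u' v)" by (intro sum.cong inv refl)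
  qed (use q r \<gamma>_nonneg in \<open>simp_all add: sum_nonneg\<close>)
  also have "\<dots> = 2 / q * bexp ({..<r} \<times> {..<r}) (1/3) (\<lambda>R. walk_sum (\<lambda>a b. if (a, b) \<in> R then 2 else - 1) r k)"
    unfolding expand \<gamma>_def biased_moment_def ..
  finally show ?thesis .
qed

section \<open>Norms and traces\<close>

definition bil :: "nat \<Rightarrow> (nat \<Rightarrow> nat \<Rightarrow> real) \<Rightarrow> (nat \<Rightarrow> real) \<Rightarrow> (nat \<Rightarrow> real) \<Rightarrow> real" where
  "bil n Y x y = (\<Sum>a<n. \<Sum>b<n. x a * Y a b * y b)"

abbreviation vnorm :: "nat \<Rightarrow> (nat \<Rightarrow> real) \<Rightarrow> real" where
  "vnorm n x \<equiv> L2_set x {..<n}"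

text \<open>Operator norm at most \<open>T\<close>, phrased for all pairs of vectors so that no
  supremum has to be handled.\<close>

definition op_bound :: "nat \<Rightarrow> (nat \<Rightarrow> nat \<Rightarrow> real) \<Rightarrow> real \<Rightarrow> bool" where
  "op_bound n Y T \<longleftrightarrow> (\<forall>x y. \<bar>bil n Y x y\<bar> \<le> T * vnorm n x * vnorm n y)"

lemma vnorm_power2: "(vnorm n x)\<^sup>2 = (\<Sum>a<n. (x a)\<^sup>2)"
  by (simp add: L2_set_def sum_nonneg)

lemma inner_le_vnorm: "\<bar>\<Sum>a<n. x a * y a\<bar> \<le> vnorm n x * vnorm n y"
proof -
  have "\<bar>\<Sum>a<n. x a * y a\<bar> \<le> (\<Sum>a<n. \<bar>x a\<bar> * \<bar>y a\<bar>)"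
    unfolding abs_mult[symmetric] by (rule sum_abs)
  also have "\<dots> \<le> vnorm n x * vnorm n y" by (rule L2_set_mult_ineq)
  finally show ?thesis .
qed

lemma sum_abs_le_vnorm: "(\<Sum>a<n. \<bar>x a\<bar>) \<le> sqrt n * vnorm n x"
proof -
  have "(\<Sum>a<n. \<bar>x a\<bar> * \<bar>1\<bar>) \<le> vnorm n x * vnorm n (\<lambda>_. 1)" by (rule L2_set_mult_ineq)
  then show ?thesis by (simp add: L2_set_constant mult.commute)
qed

lemma op_boundD: "op_bound n Y T \<Longrightarrow> \<bar>bil n Y x y\<bar> \<le> T * vnorm n x * vnorm n y"
  by (simp add: op_bound_def)

lemma bil_transpose: "bil n (\<lambda>a b. Y b a) x y = bil n Y y x"
  unfolding bil_def by (subst sum.swap) (intro sum.cong refl, simp)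

lemma op_bound_transpose:
  assumes "op_bound n Y T"
  shows "op_bound n (\<lambda>a b. Y b a) T"
  unfolding op_bound_def
proof (intro allI)
  fix x y
  show "\<bar>bil n (\<lambda>a b. Y b a) x y\<bar> \<le> T * vnorm n x * vnorm n y"
    using op_boundD[OF assms, where x = y and y = x] by (subst bil_transpose) (simp only: mult.assoc mult.commute[of "vnorm n y" "vnorm n x"])
qed

lemma bil_eq_inner: "bil n Y x y = (\<Sum>b<n. (\<Sum>a<n. x a * Y a b) * y b)"
  unfolding bil_def by (subst sum.swap) (simp add: sum_distrib_right)

lemma op_bound_entries:
  assumes "\<And>a b. a < n \<Longrightarrow> b < n \<Longrightarrow> \<bar>Y a b\<bar> \<le> c"
  shows "op_bound n Y (c * real n)"
  unfolding op_bound_def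
proof (intro allI)
  fix x y
  have "\<bar>bil n Y x y\<bar> \<le> (\<Sum>a<n. \<Sum>b<n. \<bar>x a * Y a b * y b\<bar>)"
    unfolding bil_def by (intro order_trans[OF sum_abs] sum_mono sum_abs)
  also have "\<dots> \<le> (\<Sum>a<n. \<Sum>b<n. \<bar>x a\<bar> * c * \<bar>y b\<bar>)"
    using assms by (intro sum_mono) (auto simp: abs_mult intro!: mult_right_mono mult_left_mono)
  also have "\<dots> = c * ((\<Sum>a<n. \<bar>x a\<bar>) * (\<Sum>b<n. \<bar>y b\<bar>))"
    by (simp add: sum_distrib_left[symmetric] sum_distrib_right[symmetric])
  also have "\<dots> \<le> c * ((sqrt n * vnorm n x) * (sqrt n * vnorm n y))"
  proof (cases "n = 0")
    case False
    then have "0 \<le> c" using assms[of 0 0] by simp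
    then show ?thesis
      by (intro mult_left_mono mult_mono sum_abs_le_vnorm sum_nonneg mult_nonneg_nonneg) auto
  qed simp
  also have "\<dots> = c * real n * vnorm n x * vnorm n y"
    by (simp add: mult_ac)
  finally show "\<bar>bil n Y x y\<bar> \<le> c * real n * vnorm n x * vnorm n y" .
qed

text \<open>Testing the form against the image w of \<open>x\<close> gives |w|^2 <= T |x| |w|, and
  one factor |w| cancels.\<close>

lemma op_bound_apply:
  assumes "op_bound n Y T" "0 \<le> T"
  shows "vnorm n (\<lambda>b. \<Sum>a<n. x a * Y a b) \<le> T * vnorm n x"
proof -
  let ?w = "\<lambda>b. \<Sum>a<n. x a * Y a b"
  have "(vnorm n ?w)\<^sup>2 = bil n Y x ?w"
    unfolding vnorm_power2 bil_eq_inner by (simp add: power2_eq_square)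
  also have "\<dots> \<le> T * vnorm n x * vnorm n ?w"
    using op_boundD[OF assms(1), where x = x and y = ?w] by simp
  finally have "vnorm n ?w * vnorm n ?w \<le> (T * vnorm n x) * vnorm n ?w"
    by (simp add: power2_eq_square)
  then show ?thesis
    using assms(2) by (cases "vnorm n ?w = 0") (auto simp: mult_le_cancel_right less_le L2_set_nonneg)
qed

section \<open>Powers of the Gram matrix and traces\<close>

primrec mpow :: "nat \<Rightarrow> (nat \<Rightarrow> nat \<Rightarrow> real) \<Rightarrow> nat \<Rightarrow> nat \<Rightarrow> nat \<Rightarrow> real" where
  "mpow n H 0 a c = of_bool (a = c)"
| "mpow n H (Suc k) a c = (\<Sum>b<n. mpow n H k a b * H b c)"

definition gram :: "nat \<Rightarrow> (nat \<Rightarrow> nat \<Rightarrow> real) \<Rightarrow> nat \<Rightarrow> nat \<Rightarrow> real" where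
  "gram n Y a c = (\<Sum>b<n. Y a b * Y c b)"

lemma sum_PiE_Suc:
  "(\<Sum>u\<in>{..<Suc j} \<rightarrow>\<^sub>E S. g u) = (\<Sum>c\<in>S. \<Sum>u\<in>{..<j} \<rightarrow>\<^sub>E S. g (u(j := c)))"
proof -
  have "{..<Suc j} \<rightarrow>\<^sub>E S = (\<lambda>(y, g). g(j := y)) ` (S \<times> ({..<j} \<rightarrow>\<^sub>E S))"
    by (simp add: lessThan_Suc PiE_insert_eq)
  moreover have "inj_on (\<lambda>(y, g). g(j := y)) (S \<times> ({..<j} \<rightarrow>\<^sub>E S))"
    by (rule inj_combinator) simp
  ultimately show ?thesis
    by (simp add: sum.reindex sum.cartesian_product case_prod_unfold)
qed

text \<open>The weight \<open>\<psi>\<close> on the endpoints is general so that the induction can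
  absorb the last step into it; \<open>\<psi> a c = H c a\<close> closes the path to a
  cycle.\<close>

lemma sum_paths:
  "(\<Sum>u\<in>{..<Suc j} \<rightarrow>\<^sub>E {..<n}. (\<Prod>t<j. H (u t) (u (Suc t))) * \<psi> (u 0) (u j))
    = (\<Sum>a<n. \<Sum>c<n. mpow n H j a c * \<psi> a c)"
proof (induction j arbitrary: \<psi>)
  case 0
  have "(\<Sum>c<n. of_bool (a = c) * \<psi> a c) = \<psi> a a" if "a < n" for a
    using that by (simp add: of_bool_def if_distrib[where f = "\<lambda>x. x * _"] cong: if_cong)
  then show ?case by (simp add: sum_PiE_Suc)
next
  case (Suc j)
  have "(\<Sum>u\<in>{..<Suc (Suc j)} \<rightarrow>\<^sub>E {..<n}. (\<Prod>t<Suc j. H (u t) (u (Suc t))) * \<psi> (u 0) (u (Suc j)))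
      = (\<Sum>b<n. \<Sum>u\<in>{..<Suc j} \<rightarrow>\<^sub>E {..<n}. (\<Prod>t<j. H (u t) (u (Suc t))) * (H (u j) b * \<psi> (u 0) b))"
    unfolding sum_PiE_Suc[where j = "Suc j"] by (intro sum.cong refl) (simp add: mult.assoc)
  also have "\<dots> = (\<Sum>b<n. \<Sum>a<n. \<Sum>c<n. mpow n H j a c * (H c b * \<psi> a b))"
    using Suc.IH[of "\<lambda>a c. H c _ * \<psi> a _"] by simp
  also have "\<dots> = (\<Sum>a<n. \<Sum>b<n. \<Sum>c<n. mpow n H j a c * (H c b * \<psi> a b))"
    by (rule sum.swap)
  also have "\<dots> = (\<Sum>a<n. \<Sum>c<n. mpow n H (Suc j) a c * \<psi> a c)"
    by (simp add: sum_distrib_right mult.assoc)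
  finally show ?case .
qed

lemma walk_sum_eq_trace:
  assumes "0 < k"
  shows "walk_sum Y n k = (\<Sum>a<n. mpow n (gram n Y) k a a)"
proof -
  obtain j where k: "k = Suc j" using assms gr0_implies_Suc by blast
  let ?H = "gram n Y"
  \<comment> \<open>Each column \<open>v t\<close> occurs in two factors only, so summing the
    columns out leaves one Gram entry for each pair of consecutive rows.\<close>
  have "walk_sum Y n k = (\<Sum>u\<in>{..<k} \<rightarrow>\<^sub>E {..<n}. \<Prod>t<k. ?H (u t) (u (Suc t mod k)))"
    unfolding walk_sum_def gram_def by (simp add: prod_sum_PiE)
  also have "\<dots> = (\<Sum>u\<in>{..<Suc j} \<rightarrow>\<^sub>E {..<n}. (\<Prod>t<j. ?H (u t) (u (Suc t))) * ?H (u j) (u 0))"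
    unfolding k by (intro sum.cong refl) simp
  also have "\<dots> = (\<Sum>a<n. \<Sum>c<n. mpow n ?H j a c * ?H c a)"
    using sum_paths[where j = j and n = n and H = ?H and \<psi> = "\<lambda>a c. ?H c a"] by simp
  finally show ?thesis by (simp add: k)
qed

lemma mpow_add:
  "c < n \<Longrightarrow> mpow n H (i + j) a c = (\<Sum>b<n. mpow n H i a b * mpow n H j b c)"
proof (induction j arbitrary: c)
  case 0
  then show ?case
    by (simp add: of_bool_def if_distrib[where f = "\<lambda>x. _ * x"] cong: if_cong)
next
  case (Suc j)
  have "mpow n H (i + Suc j) a c = (\<Sum>b<n. (\<Sum>d<n. mpow n H i a d * mpow n H j d b) * H b c)"
    using Suc by simp
  also have "\<dots> = (\<Sum>d<n. mpow n H i a d * (\<Sum>b<n. mpow n H j d b * H b c))"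
    unfolding sum_distrib_right sum_distrib_left by (subst sum.swap) (simp add: mult.assoc)
  finally show ?case by simp
qed

lemma mpow_one: "a < n \<Longrightarrow> mpow n H (Suc 0) a c = H a c"
  by (simp add: of_bool_def if_distrib[where f = "\<lambda>x. x * H _ c"] cong: if_cong)

lemma mpow_sym:
  assumes "\<And>a c. H a c = H c a"
  shows "a < n \<Longrightarrow> c < n \<Longrightarrow> mpow n H k a c = mpow n H k c a"
proof (induction k arbitrary: a c)
  case (Suc k)
  have "mpow n H (Suc k) a c = (\<Sum>b<n. H c b * mpow n H k b a)"
    using Suc assms by (simp add: mult.commute)
  also have "\<dots> = (\<Sum>b<n. mpow n H (Suc 0) c b * mpow n H k b a)"
    using Suc.prems by (simp only: mpow_one)
  also have "\<dots> = mpow n H (Suc 0 + k) c a"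
    using Suc.prems by (simp only: mpow_add)
  finally show ?case by simp
qed (simp add: eq_commute)

lemma gram_sym: "gram n Y a c = gram n Y c a"
  by (simp add: gram_def mult.commute)

lemma gram_quadratic:
  "(\<Sum>a<n. \<Sum>c<n. x a * gram n Y a c * x c) = (vnorm n (\<lambda>b. \<Sum>a<n. x a * Y a b))\<^sup>2"
proof -
  have "(\<Sum>a<n. \<Sum>c<n. x a * gram n Y a c * x c)
      = (\<Sum>a<n. \<Sum>c<n. \<Sum>b<n. (x a * Y a b) * (x c * Y c b))"
    unfolding gram_def sum_distrib_left sum_distrib_right by (simp add: mult_ac)
  also have "\<dots> = (\<Sum>a<n. \<Sum>b<n. \<Sum>c<n. (x a * Y a b) * (x c * Y c b))"
    by (intro sum.cong refl sum.swap)
  also have "\<dots> = (\<Sum>b<n. \<Sum>a<n. \<Sum>c<n. (x a * Y a b) * (x c * Y c b))"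
    by (rule sum.swap)
  also have "\<dots> = (\<Sum>b<n. (\<Sum>a<n. x a * Y a b)\<^sup>2)"
    unfolding power2_eq_square sum_product ..
  finally show ?thesis by (simp add: vnorm_power2)
qed

text \<open>For even exponents the trace is a squared Frobenius norm, hence nonnegative, as Markov's
  inequality requires.\<close>

lemma walk_sum_even:
  assumes "0 < k"
  shows "walk_sum Y n (2 * k) = (\<Sum>a<n. \<Sum>b<n. (mpow n (gram n Y) k a b)\<^sup>2)"
proof -
  have "mpow n (gram n Y) (2 * k) a a = (\<Sum>b<n. (mpow n (gram n Y) k a b)\<^sup>2)" if "a < n" for a
  proof -
    have "mpow n (gram n Y) (k + k) a a = (\<Sum>b<n. mpow n (gram n Y) k a b * mpow n (gram n Y) k b a)"
      using that by (rule mpow_add)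
    also have "\<dots> = (\<Sum>b<n. (mpow n (gram n Y) k a b)\<^sup>2)"
      using that by (intro sum.cong refl) (simp add: power2_eq_square mpow_sym[OF gram_sym, where a = a])
    finally show ?thesis by (simp add: mult_2)
  qed
  then show ?thesis using assms by (simp add: walk_sum_eq_trace)
qed

text \<open>The quadratic forms \<open>s k\<close> of the powers of the Gram matrix satisfy \<open>(s k)\<^sup>2 \<le> N * s (2 k)\<close>,
  so repeated squaring bounds the norm by a trace without the spectral theorem.\<close>

lemma norm_power_le_walk_sum:
  assumes "0 < j" and k: "k = 2 ^ j"
  shows "(\<Sum>a<n. \<Sum>c<n. x a * gram n Y a c * x c) ^ k \<le> ((vnorm n x)\<^sup>2) ^ k * walk_sum Y n k"
proof -
  define H where "H = gram n Y"
  define N where "N = (vnorm n x)\<^sup>2"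
  define y where "y i b = (\<Sum>a<n. x a * mpow n H i a b)" for i b
  define s where "s i = (\<Sum>b<n. y i b * x b)" for i
  have N: "0 \<le> N" by (simp add: N_def)
  have s_double: "s (i + i) = (vnorm n (y i))\<^sup>2" for i
  proof -
    have "y (i + i) c = (\<Sum>b<n. y i b * mpow n H i c b)" if "c < n" for c
    proof -
      have "y (i + i) c = (\<Sum>a<n. \<Sum>b<n. x a * mpow n H i a b * mpow n H i b c)"
        unfolding y_def using that by (simp add: mpow_add sum_distrib_left mult.assoc)
      also have "\<dots> = (\<Sum>b<n. y i b * mpow n H i b c)"
        unfolding y_def sum_distrib_right by (rule sum.swap)
      also have "\<dots> = (\<Sum>b<n. y i b * mpow n H i c b)"
        using that by (intro sum.cong refl) (simp add: H_def mpow_sym[OF gram_sym, where c = c])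
      finally show ?thesis .
    qed
    then have "s (i + i) = (\<Sum>c<n. \<Sum>b<n. y i b * (x c * mpow n H i c b))"
      unfolding s_def by (simp add: sum_distrib_left mult_ac)
    also have "\<dots> = (\<Sum>b<n. \<Sum>c<n. y i b * (x c * mpow n H i c b))"
      by (rule sum.swap)
    also have "\<dots> = (\<Sum>b<n. y i b * y i b)"
      by (simp add: sum_distrib_left[symmetric] y_def)
    finally show ?thesis unfolding vnorm_power2 by (simp add: power2_eq_square)
  qed
  have s_sq: "(s i)\<^sup>2 \<le> N * s (i + i)" for i
  proof -
    have "\<bar>s i\<bar> \<le> vnorm n (y i) * vnorm n x" unfolding s_def by (rule inner_le_vnorm)
    then have "\<bar>s i\<bar>\<^sup>2 \<le> (vnorm n (y i) * vnorm n x)\<^sup>2" by (rule power_mono) simp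
    then show ?thesis by (simp add: N_def s_double power_mult_distrib mult.commute)
  qed
  have s1_eq: "s 1 = (\<Sum>a<n. \<Sum>c<n. x a * gram n Y a c * x c)"
    unfolding s_def y_def One_nat_def H_def sum_distrib_right
    by (subst sum.swap) (simp add: mpow_one del: mpow.simps)
  then have s1: "0 \<le> s 1" by (simp add: gram_quadratic)
  \<comment> \<open>The extra factor \<open>N\<close> on the left avoids the exponent
    \<open>2 ^ i - 1\<close>; it is cancelled at the end.\<close>
  have iter: "N * s 1 ^ (2 ^ i) \<le> N ^ (2 ^ i) * s (2 ^ i)" for i :: nat
  proof (induction i)
    case (Suc i)
    show ?case
    proof (cases "N = 0")
      case False
      then have Np: "0 < N" using N by simp
      have "(N * s 1 ^ (2 ^ i))\<^sup>2 \<le> (N ^ (2 ^ i) * s (2 ^ i))\<^sup>2"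
        using Suc N s1 by (intro power_mono) auto
      also have "\<dots> \<le> (N ^ (2 ^ i))\<^sup>2 * (N * s (2 ^ i + 2 ^ i))"
        unfolding power_mult_distrib using s_sq by (intro mult_left_mono) auto
      finally have "N * (N * s 1 ^ (2 ^ Suc i)) \<le> N * (N ^ (2 ^ Suc i) * s (2 ^ Suc i))"
        by (simp add: power_mult_distrib power2_eq_square power_add[symmetric] mult_2 mult_ac)
      then show ?thesis using Np by simp
    qed (simp add: power_0_left)
  qed simp
  obtain i where j: "j = Suc i" using assms(1) gr0_implies_Suc by blast
  let ?h = "(2 :: nat) ^ i"
  have kh: "k = ?h + ?h" "k = 2 * ?h" using k j by auto
  \<comment> \<open>The last doubling is used differently: \<open>s k\<close> is the squared norm of
    \<open>y ?h\<close>, and Cauchy-Schwarz in each coordinate bounds it by \<open>N\<close> times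
    the squared Frobenius norm of the power \<open>?h\<close>, which is the trace. This is why
    \<open>0 < j\<close>.\<close>
  have "s k \<le> N * walk_sum Y n k"
  proof -
    have "s k = (\<Sum>b<n. (\<Sum>a<n. x a * mpow n H ?h a b)\<^sup>2)"
      unfolding kh(1) s_double vnorm_power2 y_def ..
    also have "\<dots> \<le> (\<Sum>b<n. N * (\<Sum>a<n. (mpow n H ?h a b)\<^sup>2))"
    proof (rule sum_mono)
      fix b
      have "\<bar>\<Sum>a<n. x a * mpow n H ?h a b\<bar>\<^sup>2 \<le> (vnorm n x * vnorm n (\<lambda>a. mpow n H ?h a b))\<^sup>2"
        by (intro power_mono inner_le_vnorm) simp
      then show "(\<Sum>a<n. x a * mpow n H ?h a b)\<^sup>2 \<le> N * (\<Sum>a<n. (mpow n H ?h a b)\<^sup>2)"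
        by (simp add: N_def power_mult_distrib vnorm_power2)
    qed
    also have "\<dots> = N * (\<Sum>a<n. \<Sum>b<n. (mpow n H ?h a b)\<^sup>2)"
      unfolding sum_distrib_left by (rule sum.swap)
    also have "\<dots> = N * walk_sum Y n k"
      unfolding kh(2) H_def by (subst walk_sum_even) auto
    finally show ?thesis .
  qed
  then have "N ^ k * s k \<le> N ^ k * (N * walk_sum Y n k)"
    using N by (intro mult_left_mono) auto
  then have *: "N * s 1 ^ k \<le> N * (N ^ k * walk_sum Y n k)"
    using iter[of j] k by (simp add: mult_ac)
  show ?thesis
  proof (cases "N = 0")
    case True
    then have "\<forall>a<n. x a = 0" by (simp add: N_def L2_set_eq_0_iff)
    then have "s 1 = 0" unfolding s1_eq by simp
    then show ?thesis using True k unfolding s1_eq[symmetric] N_def[symmetric] by (simp add: power_0_left)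
  next
    case False
    then have "s 1 ^ k \<le> N ^ k * walk_sum Y n k" using * N by (simp add: mult_le_cancel_left)
    then show ?thesis unfolding s1_eq N_def .
  qed
qed

lemma walk_sum_nonneg:
  assumes "0 < j"
  shows "0 \<le> walk_sum Y n (2 ^ j)"
proof -
  obtain i where "j = Suc i" using assms gr0_implies_Suc by blast
  then show ?thesis using walk_sum_even[of "2 ^ i" Y n] by (simp add: sum_nonneg)
qed

text \<open>A violating pair yields a vector with |x Y| > T |x|, so its Gram form exceeds T^2 |x|^2,
  and the power \<open>2 ^ j\<close> of that form is controlled by the trace. Through Markov's
  inequality this turns trace moments into norm bounds.\<close>

lemma walk_sum_ge_if_not_op_bound:
  assumes "\<not> op_bound n Y T" "0 \<le> T" "0 < j"
  shows "T ^ (2 * 2 ^ j) \<le> walk_sum Y n (2 ^ j)"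
proof -
  from assms(1) obtain x y where xy: "T * vnorm n x * vnorm n y < \<bar>bil n Y x y\<bar>"
    by (auto simp: op_bound_def not_le)
  let ?w = "\<lambda>b. \<Sum>a<n. x a * Y a b"
  have "\<bar>bil n Y x y\<bar> \<le> vnorm n ?w * vnorm n y"
    unfolding bil_eq_inner by (rule inner_le_vnorm)
  with xy have "T * vnorm n x * vnorm n y < vnorm n ?w * vnorm n y" by simp
  then have w: "T * vnorm n x < vnorm n ?w"
    by (simp add: mult_less_cancel_right L2_set_nonneg)
  have xpos: "0 < vnorm n x"
  proof (rule ccontr)
    assume "\<not> 0 < vnorm n x"
    then have "vnorm n x = 0" using L2_set_nonneg[of x "{..<n}"] by linarith
    then have "\<forall>a<n. x a = 0" by (simp add: L2_set_eq_0_iff)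
    then have "vnorm n ?w = 0" by (simp add: L2_set_eq_0_iff)
    then show False using w \<open>vnorm n x = 0\<close> by simp
  qed
  have eq: "(vnorm n ?w)\<^sup>2 = (\<Sum>a<n. \<Sum>c<n. x a * gram n Y a c * x c)"
    by (simp add: gram_quadratic)
  have "(T * vnorm n x) ^ (2 * 2 ^ j) \<le> vnorm n ?w ^ (2 * 2 ^ j)"
    using w assms(2) xpos by (intro power_mono) auto
  also have "\<dots> \<le> ((vnorm n x)\<^sup>2) ^ (2 ^ j) * walk_sum Y n (2 ^ j)"
    using norm_power_le_walk_sum[OF assms(3) refl, where n = n and x = x and Y = Y] eq by (simp add: power_mult)
  finally have "T ^ (2 * 2 ^ j) * vnorm n x ^ (2 * 2 ^ j) \<le> walk_sum Y n (2 ^ j) * vnorm n x ^ (2 * 2 ^ j)"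
    by (simp add: power_mult_distrib power_mult[symmetric] mult.commute)
  then show ?thesis using xpos by simp
qed

text \<open>A diagonal entry of a power of the Gram matrix is at most the norm of its row, and every
  further factor multiplies that norm by at most T^2.\<close>

lemma walk_sum_le_if_op_bound:
  assumes "op_bound n Y T" "0 \<le> T" "0 < k"
  shows "walk_sum Y n k \<le> real n * T ^ (2 * k)"
proof -
  have row: "vnorm n (mpow n (gram n Y) i a) \<le> T ^ (2 * i)" if "a < n" for i a
  proof (induction i)
    case 0
    have "(vnorm n (mpow n (gram n Y) 0 a))\<^sup>2 = 1"
      using that unfolding vnorm_power2 by (simp add: of_bool_def if_distrib[where f = "\<lambda>x. x\<^sup>2"] cong: if_cong)
    then show ?case
      using power2_le_imp_le[of "vnorm n (mpow n (gram n Y) 0 a)" 1] by (simp del: mpow.simps)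
  next
    case (Suc i)
    let ?z = "mpow n (gram n Y) i a"
    let ?w = "\<lambda>d. \<Sum>b<n. ?z b * Y b d"
    have "mpow n (gram n Y) (Suc i) a c = (\<Sum>d<n. ?w d * Y c d)" for c
      unfolding mpow.simps gram_def sum_distrib_left sum_distrib_right
      by (subst sum.swap) (simp add: mult.assoc)
    then have "vnorm n (mpow n (gram n Y) (Suc i) a) \<le> T * vnorm n ?w"
      using op_bound_apply[OF op_bound_transpose[OF assms(1)] assms(2), where x = ?w] by presburger
    also have "\<dots> \<le> T * (T * vnorm n ?z)"
      by (intro mult_left_mono op_bound_apply assms)
    also have "\<dots> \<le> T * (T * T ^ (2 * i))"
      by (intro mult_left_mono Suc assms)
    finally show ?case by (simp del: mpow.simps)
  qed
  have "walk_sum Y n k \<le> (\<Sum>a<n. T ^ (2 * k))"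
    unfolding walk_sum_eq_trace[OF assms(3)]
  proof (rule sum_mono)
    fix a assume "a \<in> {..<n}"
    then show "mpow n (gram n Y) k a a \<le> T ^ (2 * k)"
      using member_le_L2_set[of "{..<n}" a "mpow n (gram n Y) k a"] row[of a k] by simp
  qed
  then show ?thesis by simp
qed

section \<open>The comparison matrix\<close>

text \<open>\<open>net_vec r z\<close> runs through the points of the unit ball in a lattice of mesh \<open>1/(10 sqrt r)\<close>.  The
  condition on \<open>\<bar>z a\<bar>\<close> follows from the one on squares by Cauchy-Schwarz; the counting uses only it.\<close>

definition net :: "nat \<Rightarrow> (nat \<Rightarrow> int) set" where
  "net r = {z \<in> {..<r} \<rightarrow>\<^sub>E {- 10 * int r..10 * int r}. (\<Sum>a<r. (z a)\<^sup>2) \<le> 100 * int r \<and> (\<Sum>a<r. \<bar>z a\<bar>) \<le> 10 * int r}"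

definition net_vec :: "nat \<Rightarrow> (nat \<Rightarrow> int) \<Rightarrow> nat \<Rightarrow> real" where
  "net_vec r z a = real_of_int (z a) / (10 * sqrt r)"

lemma finite_net: "finite (net r)"
  unfolding net_def by (rule finite_subset[of _ "{..<r} \<rightarrow>\<^sub>E {- 10 * int r..10 * int r}"]) (auto intro: finite_PiE)

lemma sum_geometric_abs:
  "(\<Sum>i\<in>{- int B..int B}. (9/10 :: real) ^ nat \<bar>i\<bar>) \<le> 19"
proof -
  have S: "(\<Sum>i\<in>{- int n..int n}. (9/10 :: real) ^ nat \<bar>i\<bar>) = 19 - 18 * (9/10) ^ n" for n
  proof (induction n)
    case (Suc n)
    have "{- int (Suc n)..int (Suc n)} = insert (int (Suc n)) (insert (- int (Suc n)) {- int n..int n})"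
      by auto
    then show ?case using Suc by (simp add: nat_add_distrib)
  qed simp
  show ?thesis unfolding S by simp
qed

text \<open>An exponential weight replaces a volume argument. A net point has l^1 norm at most 10 r,
  so its product of weights (9/10)^|z a| is at least (9/10)^(10 r), while all integer points
  together weigh at most 19^r, as 1 + 2 (9/10 + (9/10)^2 + ...) = 19. With 19 <= e^3 and (10/9)^10
  <= e^(10/9) the quotient is at most e^(37/9 r).\<close>

lemma card_net: "real (card (net r)) \<le> exp (17/4 * real r)"
proof -
  have "real (card (net r)) * (9/10) ^ (10 * r) = (\<Sum>z\<in>net r. (9/10) ^ (10 * r))"
    by simp
  also have "\<dots> \<le> (\<Sum>z\<in>net r. \<Prod>a<r. (9/10 :: real) ^ nat \<bar>z a\<bar>)"
  proof (rule sum_mono)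
    fix z assume "z \<in> net r"
    then have "(\<Sum>a<r. \<bar>z a\<bar>) \<le> 10 * int r" by (simp add: net_def)
    moreover have "int (\<Sum>a<r. nat \<bar>z a\<bar>) = (\<Sum>a<r. \<bar>z a\<bar>)" by simp
    ultimately have "(\<Sum>a<r. nat \<bar>z a\<bar>) \<le> 10 * r" by linarith
    then have "(9/10 :: real) ^ (10 * r) \<le> (9/10) ^ (\<Sum>a<r. nat \<bar>z a\<bar>)"
      by (intro power_decreasing) auto
    then show "(9/10 :: real) ^ (10 * r) \<le> (\<Prod>a<r. (9/10) ^ nat \<bar>z a\<bar>)"
      by (simp add: power_sum)
  qed
  also have "\<dots> \<le> (\<Sum>z\<in>{..<r} \<rightarrow>\<^sub>E {- 10 * int r..10 * int r}. \<Prod>a<r. (9/10 :: real) ^ nat \<bar>z a\<bar>)"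
    by (intro sum_mono2 finite_PiE prod_nonneg) (auto simp: net_def)
  also have "\<dots> = (\<Prod>a<r. \<Sum>i\<in>{- 10 * int r..10 * int r}. (9/10 :: real) ^ nat \<bar>i\<bar>)"
    by (rule prod_sum_PiE[symmetric]) auto
  also have "\<dots> \<le> 19 ^ r"
    using sum_geometric_abs[of "10 * r"] by (auto intro!: power_mono sum_nonneg)
  finally have *: "real (card (net r)) * (9/10) ^ (10 * r) \<le> 19 ^ r" .
  have e1: "(10/9 :: real) \<le> exp (1/9)"
    using exp_ge_add_one_self[of "1/9 :: real"] by simp
  have "(10/9 :: real) ^ 10 \<le> exp (1/9) ^ 10"
    using e1 by (intro power_mono) auto
  then have e2: "(10/9 :: real) ^ 10 \<le> exp (10/9)"
    by (simp add: exp_of_nat_mult[symmetric])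
  \<comment> \<open>\<open>145/128\<close> is the quadratic Taylor value of exp at 1/8; its 24th
    power exceeds 19.\<close>
  have "(145/128 :: real) ^ 24 \<le> exp (1/8) ^ 24"
    using exp_lower_Taylor_quadratic[of "1/8 :: real"] by (intro power_mono) (auto simp: power2_eq_square)
  also have "\<dots> = exp (3 :: real)" by (simp add: exp_of_nat_mult[symmetric])
  finally have e3: "(19 :: real) \<le> exp 3" by (simp add: power_divide)
  have "real (card (net r)) = real (card (net r)) * (9/10) ^ (10 * r) * (10/9) ^ (10 * r)"
    by (simp add: power_mult_distrib[symmetric] mult.assoc)
  also have "\<dots> \<le> 19 ^ r * (10/9) ^ (10 * r)"
    using * by (intro mult_right_mono) auto
  also have "\<dots> = (19 * (10/9) ^ 10) ^ r"
    by (simp add: power_mult power_mult_distrib)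
  also have "\<dots> \<le> (exp 3 * exp (10/9)) ^ r"
    using e2 e3 by (intro power_mono mult_mono) auto
  also have "\<dots> = exp (37/9 * real r)"
    by (simp add: exp_add[symmetric] exp_of_nat_mult[symmetric] mult.commute)
  also have "\<dots> \<le> exp (17/4 * real r)" by simp
  finally show ?thesis .
qed

lemma vnorm_net_vec:
  assumes "z \<in> net r"
  shows "vnorm r (net_vec r z) \<le> 1"
proof (cases "r = 0")
  case False
  have "real_of_int (\<Sum>a<r. (z a)\<^sup>2) \<le> real_of_int (100 * int r)"
    using assms unfolding net_def by (subst of_int_le_iff) simp
  then have "(vnorm r (net_vec r z))\<^sup>2 \<le> 1\<^sup>2"
    using False unfolding vnorm_power2 net_vec_def
    by (simp add: power_divide power_mult_distrib sum_divide_distrib[symmetric] divide_le_eq)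
  then show ?thesis by (rule power2_le_imp_le) simp
qed simp

text \<open>The coordinates of \<open>10 * sqrt r * x\<close> are rounded towards zero. No
  coordinate grows in absolute value, so the point lies in the net; the error per coordinate is at
  most \<open>1 / (10 * sqrt r)\<close>, in total norm at most 1/10.\<close>

lemma net_approx:
  assumes x: "vnorm r x \<le> 1"
  obtains z where "z \<in> net r" "vnorm r (\<lambda>a. x a - net_vec r z a) \<le> 1/10"
proof (cases "r = 0")
  case True
  then have "(\<lambda>a\<in>{..<r}. 0) \<in> net r" by (simp add: net_def)
  then show ?thesis using that True by simp
next
  case False
  define s where "s = 10 * sqrt r"
  have s: "0 < s" using False by (simp add: s_def)
  define tr where "tr y = (if 0 \<le> y then \<lfloor>y\<rfloor> else \<lceil>y\<rceil>)" for y :: real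
  have tr: "\<bar>real_of_int (tr y)\<bar> \<le> \<bar>y\<bar> \<and> \<bar>y - real_of_int (tr y)\<bar> \<le> 1" for y
  proof (cases "0 \<le> y")
    case True
    then have t: "tr y = \<lfloor>y\<rfloor>" and "0 \<le> real_of_int \<lfloor>y\<rfloor>" by (simp_all add: tr_def)
    then show ?thesis
      unfolding t using True of_int_floor_le[of y] real_of_int_floor_add_one_gt[of y] by (intro conjI) linarith+
  next
    case False
    then have t: "tr y = \<lceil>y\<rceil>" and "real_of_int \<lceil>y\<rceil> \<le> 0" by (simp_all add: tr_def)
    then show ?thesis
      unfolding t using False le_of_int_ceiling[of y] ceiling_correct[of y] by (intro conjI) linarith+
  qed
  then have tr1: "\<bar>real_of_int (tr y)\<bar> \<le> \<bar>y\<bar>" and tr2: "\<bar>y - real_of_int (tr y)\<bar> \<le> 1" for y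
    by blast+
  define z where "z = restrict (\<lambda>a. tr (s * x a)) {..<r}"
  have za: "\<bar>real_of_int (z a)\<bar> \<le> s * \<bar>x a\<bar>" if "a < r" for a
    using tr1[of "s * x a"] s that by (simp add: z_def abs_mult)
  have sq: "(\<Sum>a<r. (x a)\<^sup>2) \<le> 1"
    using power_mono[OF x, of 2] by (simp add: vnorm_power2)
  have "(\<Sum>a<r. (real_of_int (z a))\<^sup>2) \<le> (\<Sum>a<r. s\<^sup>2 * (x a)\<^sup>2)"
  proof (rule sum_mono)
    fix a assume "a \<in> {..<r}"
    then show "(real_of_int (z a))\<^sup>2 \<le> s\<^sup>2 * (x a)\<^sup>2"
      using power_mono[OF za, of a 2] by (simp add: power_mult_distrib)
  qed
  also have "\<dots> = s\<^sup>2 * (\<Sum>a<r. (x a)\<^sup>2)" by (simp add: sum_distrib_left)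
  also have "\<dots> \<le> s\<^sup>2 * 1" using sq by (intro mult_left_mono) auto
  finally have "real_of_int (\<Sum>a<r. (z a)\<^sup>2) \<le> real_of_int (100 * int r)"
    by (simp add: s_def power_mult_distrib)
  then have 1: "(\<Sum>a<r. (z a)\<^sup>2) \<le> 100 * int r" by (simp only: of_int_le_iff)
  have "(\<Sum>a<r. \<bar>real_of_int (z a)\<bar>) \<le> (\<Sum>a<r. s * \<bar>x a\<bar>)"
    using za by (intro sum_mono) auto
  also have "\<dots> = s * (\<Sum>a<r. \<bar>x a\<bar>)" by (simp add: sum_distrib_left)
  also have "\<dots> \<le> s * (sqrt r * vnorm r x)"
    using s by (intro mult_left_mono sum_abs_le_vnorm) auto
  also have "\<dots> \<le> s * (sqrt r * 1)" using s x by (intro mult_left_mono) auto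
  also have "\<dots> = 10 * real r" by (simp add: s_def)
  finally have "real_of_int (\<Sum>a<r. \<bar>z a\<bar>) \<le> real_of_int (10 * int r)" by simp
  then have 2: "(\<Sum>a<r. \<bar>z a\<bar>) \<le> 10 * int r" by (simp only: of_int_le_iff)
  have "\<bar>z a\<bar> \<le> 10 * int r" if "a < r" for a
    using member_le_sum[of a "{..<r}" "\<lambda>a. \<bar>z a\<bar>"] that 2 by simp
  then have "z a \<in> {- 10 * int r..10 * int r}" if "a < r" for a
    using that by (auto simp: abs_le_iff minus_le_iff)
  then have "z \<in> {..<r} \<rightarrow>\<^sub>E {- 10 * int r..10 * int r}"
    by (intro PiE_I) (auto simp: z_def)
  then have mem: "z \<in> net r" using 1 2 by (simp add: net_def)
  have "(vnorm r (\<lambda>a. x a - net_vec r z a))\<^sup>2 \<le> (\<Sum>a<r. (1 / s)\<^sup>2)"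
    unfolding vnorm_power2
  proof (rule sum_mono)
    fix a assume "a \<in> {..<r}"
    then have "x a - net_vec r z a = (s * x a - real_of_int (tr (s * x a))) / s"
      using s by (simp add: net_vec_def z_def s_def[symmetric] diff_divide_distrib)
    then have "\<bar>x a - net_vec r z a\<bar> \<le> 1 / s"
      using tr2[of "s * x a"] s by (simp add: divide_right_mono)
    then have "\<bar>x a - net_vec r z a\<bar>\<^sup>2 \<le> (1 / s)\<^sup>2" by (intro power_mono) auto
    then show "(x a - net_vec r z a)\<^sup>2 \<le> (1 / s)\<^sup>2" by simp
  qed
  also have "\<dots> = (1/10)\<^sup>2"
    using False by (simp add: s_def power_divide power_mult_distrib)
  finally have "vnorm r (\<lambda>a. x a - net_vec r z a) \<le> 1/10"
    by (rule power2_le_imp_le) simp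
  then show ?thesis using that mem by blast
qed

section \<open>From the net to the whole unit ball\<close>

lemma bil_cmult_left: "bil n Y (\<lambda>a. c * x a) y = c * bil n Y x y"
  by (simp add: bil_def sum_distrib_left mult.assoc)

lemma bil_cmult_right: "bil n Y x (\<lambda>a. c * y a) = c * bil n Y x y"
  by (simp add: bil_def sum_distrib_left mult.left_commute)

lemma bil_diff_left: "bil n Y (\<lambda>a. x a - x' a) y = bil n Y x y - bil n Y x' y"
  by (simp add: bil_def sum_subtractf left_diff_distrib)

lemma bil_diff_right: "bil n Y x (\<lambda>a. y a - y' a) = bil n Y x y - bil n Y x y'"
  by (simp add: bil_def sum_subtractf right_diff_distrib)

lemma vnorm_cmult: "0 \<le> c \<Longrightarrow> vnorm n (\<lambda>a. c * x a) = c * vnorm n x"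
  by (simp add: L2_set_right_distrib)

text \<open>With T the supremum of the form over unit balls, moving each of the two vectors to a net
  point costs T/10, so T <= t + T/5. The a priori bound \<open>T0\<close> makes T finite, which this
  absorption requires. One-sided bounds suffice because the form is odd in \<open>x\<close>.\<close>

lemma op_bound_of_net:
  assumes net: "\<And>z w. z \<in> net r \<Longrightarrow> w \<in> net r \<Longrightarrow> bil r Y (net_vec r z) (net_vec r w) \<le> t"
    and T0: "op_bound r Y T0" "0 \<le> T0"
  shows "op_bound r Y (5/4 * t)"
proof -
  define S where "S = {bil r Y x y |x y. vnorm r x \<le> 1 \<and> vnorm r y \<le> 1}"
  define T where "T = Sup S"
  have bdd: "bdd_above S"
  proof (rule bdd_aboveI)
    fix s assume "s \<in> S"
    then obtain x y where s: "s = bil r Y x y" "vnorm r x \<le> 1" "vnorm r y \<le> 1" by (auto simp: S_def)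
    have "bil r Y x y \<le> T0 * vnorm r x * vnorm r y" using op_boundD[OF T0(1), where x = x and y = y] by simp
    also have "\<dots> \<le> T0 * 1 * 1" using s T0(2) by (intro mult_mono) auto
    finally show "s \<le> T0" using s by simp
  qed
  have upper: "bil r Y x y \<le> T" if "vnorm r x \<le> 1" "vnorm r y \<le> 1" for x y
    unfolding T_def using that bdd by (intro cSup_upper) (auto simp: S_def)
  have upper_l: "bil r Y u y \<le> T / 10" if "vnorm r u \<le> 1/10" "vnorm r y \<le> 1" for u y
    using upper[of "\<lambda>a. 10 * u a" y] that by (simp add: bil_cmult_left vnorm_cmult)
  have upper_r: "bil r Y x u \<le> T / 10" if "vnorm r u \<le> 1/10" "vnorm r x \<le> 1" for u x
    using upper[of x "\<lambda>a. 10 * u a"] that by (simp add: bil_cmult_right vnorm_cmult)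
  have "T \<le> t + T / 5"
    unfolding T_def
  proof (rule cSup_least)
    have "vnorm r (\<lambda>_. 0) \<le> 1" by (simp add: L2_set_def)
    then show "S \<noteq> {}" unfolding S_def by blast
  next
    fix s assume "s \<in> S"
    then obtain x y where s: "s = bil r Y x y" "vnorm r x \<le> 1" "vnorm r y \<le> 1" by (auto simp: S_def)
    obtain z where z: "z \<in> net r" "vnorm r (\<lambda>a. x a - net_vec r z a) \<le> 1/10"
      using net_approx[OF s(2)] .
    obtain w where w: "w \<in> net r" "vnorm r (\<lambda>a. y a - net_vec r w a) \<le> 1/10"
      using net_approx[OF s(3)] .
    have "bil r Y x y - bil r Y (net_vec r z) y \<le> T / 10"
      using upper_l[OF z(2) s(3)] by (simp add: bil_diff_left)
    moreover have "bil r Y (net_vec r z) y - bil r Y (net_vec r z) (net_vec r w) \<le> T / 10"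
      using upper_r[OF w(2) vnorm_net_vec[OF z(1)]] by (simp add: bil_diff_right)
    ultimately show "s \<le> t + Sup S / 5"
      using net[OF z(1) w(1)] s(1) unfolding T_def by linarith
  qed
  then have T: "T \<le> 5/4 * t" by simp
  have one_side: "bil r Y x y \<le> T * vnorm r x * vnorm r y" for x y
  proof (cases "vnorm r x = 0 \<or> vnorm r y = 0")
    case True
    then have "bil r Y x y = 0"
      by (auto simp: L2_set_eq_0_iff bil_def)
    then show ?thesis using True by auto
  next
    case False
    then have pos: "0 < vnorm r x" "0 < vnorm r y" by (auto simp: less_le L2_set_nonneg)
    have "bil r Y (\<lambda>a. (1 / vnorm r x) * x a) (\<lambda>a. (1 / vnorm r y) * y a) \<le> T"
      using pos by (intro upper) (simp_all only: vnorm_cmult zero_le_divide_1_iff less_imp_le, simp_all)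
    then show ?thesis
      using pos unfolding bil_cmult_left bil_cmult_right by (simp add: field_simps)
  qed
  show ?thesis
    unfolding op_bound_def
  proof (intro allI)
    fix x y
    have "bil r Y (\<lambda>a. -1 * x a) y \<le> T * vnorm r (\<lambda>a. -1 * x a) * vnorm r y" by (rule one_side)
    then have "- bil r Y x y \<le> T * vnorm r x * vnorm r y"
      unfolding bil_cmult_left by (simp add: L2_set_def)
    then have "\<bar>bil r Y x y\<bar> \<le> T * (vnorm r x * vnorm r y)"
      using one_side[of x y] by (simp add: mult.assoc abs_le_iff)
    also have "\<dots> \<le> 5/4 * t * (vnorm r x * vnorm r y)"
      using T by (intro mult_right_mono mult_nonneg_nonneg L2_set_nonneg)
    finally show "\<bar>bil r Y x y\<bar> \<le> 5/4 * t * vnorm r x * vnorm r y" by (simp add: mult.assoc)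
  qed
qed

section \<open>Exponential moments of the comparison matrix\<close>

lemma exp_minus_upper:
  fixes s :: real
  assumes "0 \<le> s"
  shows "exp (- s) \<le> 1 - s + s\<^sup>2 / 2"
proof -
  have pos: "0 < 1 + s + s\<^sup>2 / 2" using assms by (simp add: add_pos_nonneg)
  have "1 \<le> (1 + s + s\<^sup>2 / 2) * (1 - s + s\<^sup>2 / 2)"
  proof -
    have "(1 + s + s\<^sup>2 / 2) * (1 - s + s\<^sup>2 / 2) = 1 + (s\<^sup>2)\<^sup>2 / 4"
      by (simp add: algebra_simps power2_eq_square)
    then show ?thesis by simp
  qed
  then have "1 / (1 + s + s\<^sup>2 / 2) \<le> 1 - s + s\<^sup>2 / 2"
    using pos by (simp add: divide_le_eq mult.commute)
  moreover have "exp (- s) \<le> 1 / (1 + s + s\<^sup>2 / 2)"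
    unfolding exp_minus inverse_eq_divide
    using exp_lower_Taylor_quadratic[OF assms] pos by (intro divide_left_mono mult_pos_pos) auto
  ultimately show ?thesis by linarith
qed

text \<open>For |s| > 1 both exponents are at most 2 s^2. For small |s| the linear terms cancel, the
  entry being centred, and polynomial bounds are compared with the quadratic Taylor bound of the
  right side.\<close>

lemma mgf_biased:
  fixes s :: real
  shows "1/3 * exp (2 * s) + (1 - 1/3) * exp (- s) \<le> exp (2 * s\<^sup>2)"
proof -
  have lower: "1 + 2 * s\<^sup>2 + 2 * s ^ 4 \<le> exp (2 * s\<^sup>2)"
    using exp_lower_Taylor_quadratic[of "2 * s\<^sup>2"] by (simp add: power_mult_distrib power2_eq_square power4_eq_xxxx mult_ac)
  consider "1 < s" | "0 \<le> s" "s \<le> 1" | "- 1 \<le> s" "s \<le> 0" | "s < - 1" by linarith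
  then show ?thesis
  proof cases
    case 1
    then have "s * 1 \<le> s * s" by (intro mult_left_mono) auto
    then have "exp (2 * s) \<le> exp (2 * s\<^sup>2)" by (simp add: power2_eq_square)
    moreover have "exp (- s) \<le> exp (2 * s\<^sup>2)" using 1 by (intro iffD2[OF exp_le_cancel_iff]) (smt (verit) zero_le_power2)
    ultimately show ?thesis by argo
  next
    case 2
    have "exp s \<le> 1 + s + s\<^sup>2" using 2 by (intro exp_bound) auto
    then have "exp s ^ 2 \<le> (1 + s + s\<^sup>2)\<^sup>2" by (intro power_mono) auto
    then have a: "exp (2 * s) \<le> (1 + s + s\<^sup>2)\<^sup>2" by (simp add: exp_double)
    have b: "exp (- s) \<le> 1 - s + s\<^sup>2 / 2" using 2 exp_minus_upper by simp
    \<comment> \<open>A third of this quantity is the difference of the two sides of the next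
      inequality.\<close>
    have "0 \<le> s\<^sup>2 * (1 + (1 - s)\<^sup>2 + 4 * s\<^sup>2)" by simp
    then have "1/3 * (1 + s + s\<^sup>2)\<^sup>2 + (1 - 1/3) * (1 - s + s\<^sup>2 / 2) \<le> 1 + 2 * s\<^sup>2 + 2 * s ^ 4"
      by (simp add: power2_eq_square power4_eq_xxxx algebra_simps)
    then show ?thesis using a b lower by argo
  next
    case 3
    have a: "exp (2 * s) \<le> 1 + 2 * s + 2 * s\<^sup>2"
      using exp_minus_upper[of "- 2 * s"] 3 by (simp add: power_mult_distrib)
    have b: "exp (- s) \<le> 1 - s + s\<^sup>2" using 3 exp_bound[of "- s"] by simp
    have "0 \<le> s\<^sup>2" "0 \<le> s ^ 4" by simp_all
    then show ?thesis using a b lower by argo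
  next
    case 4
    then have "- s * 1 \<le> - s * - s" by (intro mult_left_mono) auto
    then have "exp (- s) \<le> exp (2 * s\<^sup>2)" using 4 by (intro iffD2[OF exp_le_cancel_iff]) (simp add: power2_eq_square)
    moreover have "exp (2 * s) \<le> exp (2 * s\<^sup>2)" using 4 by (intro iffD2[OF exp_le_cancel_iff]) (smt (verit) zero_le_power2)
    ultimately show ?thesis by argo
  qed
qed

text \<open>Independence gives a product over the entries, and the squared coefficients of the form
  add up to |x|^2 |y|^2 <= 1.\<close>

lemma bexp_exp_bil:
  fixes x y :: "nat \<Rightarrow> real"
  assumes "vnorm r x \<le> 1" "vnorm r y \<le> 1"
  shows "bexp ({..<r} \<times> {..<r}) (1/3) (\<lambda>R. exp (s * bil r (\<lambda>a b. if (a, b) \<in> R then 2 else - 1) x y))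
    \<le> exp (2 * s\<^sup>2)"
proof -
  let ?V = "{..<r} \<times> {..<r}"
  let ?c = "\<lambda>(a, b). s * (x a * y b)"
  have "bexp ?V (1/3) (\<lambda>R. exp (s * bil r (\<lambda>a b. if (a, b) \<in> R then 2 else - 1) x y))
      = bexp ?V (1/3) (\<lambda>R. \<Prod>e\<in>?V. if e \<in> R then exp (2 * ?c e) else exp (- ?c e))"
  proof (intro bexp_cong)
    fix R assume "R \<subseteq> ?V"
    have "s * bil r (\<lambda>a b. if (a, b) \<in> R then 2 else - 1) x y
        = (\<Sum>e\<in>?V. if e \<in> R then 2 * ?c e else - ?c e)"
      unfolding bil_def sum.cartesian_product sum_distrib_left
      by (intro sum.cong refl) auto
    then show "exp (s * bil r (\<lambda>a b. if (a, b) \<in> R then 2 else - 1) x y)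
        = (\<Prod>e\<in>?V. if e \<in> R then exp (2 * ?c e) else exp (- ?c e))"
      by (simp add: exp_sum if_distrib[where f = exp])
  qed
  also have "\<dots> = (\<Prod>e\<in>?V. 1/3 * exp (2 * ?c e) + (1 - 1/3) * exp (- ?c e))"
    by (rule bexp_prod_if) simp
  also have "\<dots> \<le> (\<Prod>e\<in>?V. exp (2 * (?c e)\<^sup>2))"
    by (intro prod_mono conjI mgf_biased) (simp add: add_nonneg_nonneg)
  also have "\<dots> = exp (\<Sum>e\<in>?V. 2 * (?c e)\<^sup>2)"
    by (simp add: exp_sum)
  also have "(\<Sum>e\<in>?V. 2 * (?c e)\<^sup>2) = 2 * s\<^sup>2 * ((\<Sum>a<r. (x a)\<^sup>2) * (\<Sum>b<r. (y b)\<^sup>2))"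
    unfolding sum_product unfolding sum.cartesian_product sum_distrib_left
    by (intro sum.cong refl) (auto simp: power_mult_distrib)
  also have "\<dots> \<le> 2 * s\<^sup>2 * (1 * 1)"
    using power_mono[OF assms(1), of 2] power_mono[OF assms(2), of 2]
    by (intro mult_left_mono mult_mono) (auto simp: vnorm_power2 sum_nonneg)
  finally show ?thesis by simp
qed

lemma prob_net_large:
  "bexp ({..<r} \<times> {..<r}) (1/3) (\<lambda>R. of_bool (\<exists>z\<in>net r. \<exists>w\<in>net r.
      9 * sqrt r < bil r (\<lambda>a b. if (a, b) \<in> R then 2 else - 1) (net_vec r z) (net_vec r w)))
    \<le> exp (- real r)"
proof -
  let ?V = "{..<r} \<times> {..<r}"
  let ?B = "\<lambda>R z w. bil r (\<lambda>a b. if (a, b) \<in> R then 2 else - 1) (net_vec r z) (net_vec r w)"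
  \<comment> \<open>This \<open>s\<close> minimises \<open>2 * s\<^sup>2 - s * ?t\<close>, with
    value -81/8 r. The two nets contribute 17/4 r each, which leaves the exponent -13/8 r.\<close>
  define s where "s = 9/4 * sqrt r"
  let ?t = "9 * sqrt r"
  have "bexp ?V (1/3) (\<lambda>R. of_bool (\<exists>z\<in>net r. \<exists>w\<in>net r. ?t < ?B R z w))
      \<le> bexp ?V (1/3) (\<lambda>R. \<Sum>z\<in>net r. \<Sum>w\<in>net r. exp (- s * ?t) * exp (s * ?B R z w))"
  proof (rule bexp_mono)
    fix R :: "(nat \<times> nat) set"
    let ?f = "\<lambda>z w. exp (- s * ?t) * exp (s * ?B R z w)"
    show "of_bool (\<exists>z\<in>net r. \<exists>w\<in>net r. ?t < ?B R z w) \<le> (\<Sum>z\<in>net r. \<Sum>w\<in>net r. ?f z w)"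
    proof (cases "\<exists>z\<in>net r. \<exists>w\<in>net r. ?t < ?B R z w")
      case True
      then obtain z w where zw: "z \<in> net r" "w \<in> net r" "?t < ?B R z w" by blast
      have "s * ?t \<le> s * ?B R z w" using zw(3) by (intro mult_left_mono) (auto simp: s_def)
      then have "1 \<le> ?f z w" by (simp add: exp_add[symmetric])
      also have "\<dots> \<le> (\<Sum>w\<in>net r. ?f z w)"
        using zw finite_net by (intro member_le_sum) auto
      also have "\<dots> \<le> (\<Sum>z\<in>net r. \<Sum>w\<in>net r. ?f z w)"
        using zw finite_net by (intro member_le_sum[where f = "\<lambda>z. \<Sum>w\<in>net r. ?f z w"] sum_nonneg) auto
      finally show ?thesis using True by simp
    next
      case False
      then show ?thesis by (simp add: sum_nonneg)
    qed
  qed auto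
  also have "\<dots> = (\<Sum>z\<in>net r. \<Sum>w\<in>net r. exp (- s * ?t) * bexp ?V (1/3) (\<lambda>R. exp (s * ?B R z w)))"
    unfolding bexp_sum bexp_cmult ..
  also have "\<dots> \<le> (\<Sum>z\<in>net r. \<Sum>w\<in>net r. exp (- s * ?t) * exp (2 * s\<^sup>2))"
    by (intro sum_mono mult_left_mono bexp_exp_bil vnorm_net_vec) auto
  also have "\<dots> = real (card (net r)) * real (card (net r)) * exp (- (81/8) * real r)"
    by (simp add: s_def exp_add[symmetric] power_mult_distrib power_divide)
  also have "\<dots> \<le> exp (17/4 * real r) * exp (17/4 * real r) * exp (- (81/8) * real r)"
    by (intro mult_right_mono mult_mono card_net) auto
  also have "\<dots> \<le> exp (- real r)"
    by (simp add: exp_add[symmetric])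
  finally show ?thesis .
qed

text \<open>Off an event of probability at most e^(-r) the norm is at most 5/4 times 9 sqrt r; on
  that event the trivial norm bound 2 r is used. The exceptional term stays small as long as
  \<open>k\<close> is small compared with r / ln r.\<close>

lemma expected_walk_sum_biased:
  assumes "0 < k"
  shows "bexp ({..<r} \<times> {..<r}) (1/3) (\<lambda>R. walk_sum (\<lambda>a b. if (a, b) \<in> R then 2 else - 1) r k)
    \<le> real r * ((45/4 * sqrt r) ^ (2 * k) + (2 * real r) ^ (2 * k) * exp (- real r))"
proof -
  let ?V = "{..<r} \<times> {..<r}"
  let ?G = "\<lambda>R a b. if (a, b) \<in> R then 2 else - 1 :: real"
  let ?bad = "\<lambda>R. \<exists>z\<in>net r. \<exists>w\<in>net r. 9 * sqrt r < bil r (?G R) (net_vec r z) (net_vec r w)"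
  have "bexp ?V (1/3) (\<lambda>R. walk_sum (?G R) r k)
      \<le> bexp ?V (1/3) (\<lambda>R. real r * (45/4 * sqrt r) ^ (2 * k)
          + real r * (2 * real r) ^ (2 * k) * of_bool (?bad R))"
  proof (rule bexp_mono)
    fix R :: "(nat \<times> nat) set"
    have triv: "op_bound r (?G R) (2 * real r)"
      by (intro op_bound_entries) auto
    show "walk_sum (?G R) r k \<le> real r * (45/4 * sqrt r) ^ (2 * k)
          + real r * (2 * real r) ^ (2 * k) * of_bool (?bad R)"
    proof (cases "?bad R")
      case True
      have "walk_sum (?G R) r k \<le> real r * (2 * real r) ^ (2 * k)"
        using triv assms by (intro walk_sum_le_if_op_bound) auto
      moreover have "0 \<le> real r * (45/4 * sqrt r) ^ (2 * k)" by simp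
      moreover have "of_bool (?bad R) = (1 :: real)" using True by simp
      ultimately show ?thesis by (simp only: mult_1_right)
    next
      case False
      have "op_bound r (?G R) (5/4 * (9 * sqrt r))"
        using False triv by (intro op_bound_of_net[OF _ triv]) (auto simp: not_less)
      then have "walk_sum (?G R) r k \<le> real r * (5/4 * (9 * sqrt r)) ^ (2 * k)"
        using assms by (intro walk_sum_le_if_op_bound) auto
      moreover have "of_bool (?bad R) = (0 :: real)" using False by simp
      ultimately show ?thesis by simp
    qed
  qed auto
  also have "\<dots> = real r * (45/4 * sqrt r) ^ (2 * k)
      + real r * (2 * real r) ^ (2 * k) * bexp ?V (1/3) (\<lambda>R. of_bool (?bad R))"
    by (simp only: bexp_add bexp_cmult) (simp add: bexp_const)
  also have "\<dots> \<le> real r * (45/4 * sqrt r) ^ (2 * k) + real r * (2 * real r) ^ (2 * k) * exp (- real r)"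
    by (intro add_left_mono mult_left_mono prob_net_large) auto
  finally show ?thesis by (simp add: algebra_simps)
qed

section \<open>Eigenvalues of the link graph\<close>

text \<open>\<open>f\<close> and \<open>g\<close> are the restrictions of an eigenfunction to the
  two sides. The form \<open>bil n B f g\<close> is at least x d (1 - \<delta>) (|f|^2 + |g|^2) / 2
  by the degrees, and is bounded above through \<open>T\<close> and the mean part \<open>c\<close>.
  The mean part sees only the plain sums of \<open>f\<close> and \<open>g\<close>; these are small
  because the degree-weighted sums vanish and the degrees are close to \<open>d\<close>, once for
  each side, hence \<delta>^2.\<close>

lemma bipartite_eigenvalue_bound:
  fixes B :: "nat \<Rightarrow> nat \<Rightarrow> real" and f g :: "nat \<Rightarrow> real"
  assumes dS_eq: "\<And>a. dS a = (\<Sum>b<n. B a b)" and dT_eq: "\<And>b. dT b = (\<Sum>a<n. B a b)"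
    and dS: "\<And>a. a < n \<Longrightarrow> \<bar>dS a - d\<bar> \<le> \<delta> * d"
    and dT: "\<And>b. b < n \<Longrightarrow> \<bar>dT b - d\<bar> \<le> \<delta> * d"
    and d: "0 < d" and \<delta>: "0 \<le> \<delta>" "\<delta> < 1" and c: "0 \<le> c" and T: "0 \<le> T"
    and X: "op_bound n (\<lambda>a b. B a b - c) T"
    and eigS: "\<And>a. a < n \<Longrightarrow> (\<Sum>b<n. B a b * g b) = x * dS a * f a"
    and eigT: "\<And>b. b < n \<Longrightarrow> (\<Sum>a<n. B a b * f a) = x * dT b * g b"
    and orth: "(\<Sum>a<n. dS a * f a) + (\<Sum>b<n. dT b * g b) = 0"
    and nz: "\<exists>a<n. f a \<noteq> 0 \<or> g a \<noteq> 0"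
    and x: "0 < x"
  shows "x \<le> (T + c * real n * \<delta>\<^sup>2) / (d * (1 - \<delta>))"
proof -
  define N where "N = (vnorm n f)\<^sup>2 + (vnorm n g)\<^sup>2"
  let ?K = "T + c * real n * \<delta>\<^sup>2"
  \<comment> \<open>The weighted sum of \<open>g\<close> is \<open>x\<close> times that of
    \<open>f\<close>, and their total vanishes, so each vanishes separately. Positivity of
    \<open>x\<close> excludes the sign function of the bipartition, the eigenfunction for
    -1.\<close>
  have "(\<Sum>b<n. dT b * g b) = (\<Sum>a<n. \<Sum>b<n. B a b * g b)"
    unfolding dT_eq sum_distrib_right by (rule sum.swap)
  also have "\<dots> = x * (\<Sum>a<n. dS a * f a)"
    using eigS by (simp add: sum_distrib_left mult.assoc)
  finally have "(1 + x) * (\<Sum>a<n. dS a * f a) = 0"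
    using orth by (simp add: algebra_simps)
  then have f0: "(\<Sum>a<n. dS a * f a) = 0" using x by auto
  then have g0: "(\<Sum>b<n. dT b * g b) = 0" using orth by simp
  have small: "\<bar>\<Sum>a<n. h a\<bar> \<le> \<delta> * (sqrt n * vnorm n h)"
    if e: "\<And>a. a < n \<Longrightarrow> \<bar>e a - d\<bar> \<le> \<delta> * d" and h: "(\<Sum>a<n. e a * h a) = 0" for e h
  proof -
    have "d * \<bar>\<Sum>a<n. h a\<bar> = \<bar>\<Sum>a<n. d * h a - e a * h a\<bar>"
      using d h by (simp add: sum_subtractf sum_distrib_left[symmetric] abs_mult)
    also have "\<dots> \<le> (\<Sum>a<n. \<bar>d * h a - e a * h a\<bar>)" by (rule sum_abs)
    also have "\<dots> \<le> (\<Sum>a<n. \<delta> * d * \<bar>h a\<bar>)"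
    proof (rule sum_mono)
      fix a assume "a \<in> {..<n}"
      then have "\<bar>d - e a\<bar> * \<bar>h a\<bar> \<le> \<delta> * d * \<bar>h a\<bar>"
        using e[of a] by (intro mult_right_mono) (auto simp: abs_minus_commute)
      then show "\<bar>d * h a - e a * h a\<bar> \<le> \<delta> * d * \<bar>h a\<bar>"
        by (simp add: abs_mult[symmetric] left_diff_distrib)
    qed
    also have "\<dots> = \<delta> * d * (\<Sum>a<n. \<bar>h a\<bar>)" by (simp add: sum_distrib_left)
    also have "\<dots> \<le> \<delta> * d * (sqrt n * vnorm n h)"
      using \<delta> d by (intro mult_left_mono sum_abs_le_vnorm) auto
    finally have "d * \<bar>\<Sum>a<n. h a\<bar> \<le> d * (\<delta> * (sqrt n * vnorm n h))" by (simp add: mult_ac)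
    then show ?thesis using d by simp
  qed
  have "bil n B f g = bil n (\<lambda>a b. B a b - c) f g + c * ((\<Sum>a<n. f a) * (\<Sum>b<n. g b))"
    unfolding bil_def sum_product unfolding sum_distrib_left sum.distrib[symmetric]
    by (intro sum.cong refl) (simp add: algebra_simps)
  also have "\<dots> \<le> T * vnorm n f * vnorm n g
      + c * ((\<delta> * (sqrt n * vnorm n f)) * (\<delta> * (sqrt n * vnorm n g)))"
  proof (rule add_mono)
    show "bil n (\<lambda>a b. B a b - c) f g \<le> T * vnorm n f * vnorm n g"
      using op_boundD[OF X, where x = f and y = g] by simp
    have "(\<Sum>a<n. f a) * (\<Sum>b<n. g b) \<le> \<bar>\<Sum>a<n. f a\<bar> * \<bar>\<Sum>b<n. g b\<bar>"
      by (simp add: abs_mult[symmetric])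
    also have "\<dots> \<le> (\<delta> * (sqrt n * vnorm n f)) * (\<delta> * (sqrt n * vnorm n g))"
      using \<delta> by (intro mult_mono small[OF dS f0] small[OF dT g0]) auto
    finally show "c * ((\<Sum>a<n. f a) * (\<Sum>b<n. g b))
        \<le> c * ((\<delta> * (sqrt n * vnorm n f)) * (\<delta> * (sqrt n * vnorm n g)))"
      using c by (rule mult_left_mono)
  qed
  also have "\<dots> = ?K * (vnorm n f * vnorm n g)"
    by (simp add: algebra_simps power2_eq_square)
  also have "\<dots> \<le> ?K * (N / 2)"
  proof (rule mult_left_mono)
    have "0 \<le> (vnorm n f - vnorm n g)\<^sup>2" by simp
    then show "vnorm n f * vnorm n g \<le> N / 2"
      unfolding N_def power2_diff by simp
  qed (use T c in simp)
  finally have upper: "2 * bil n B f g \<le> ?K * N" by simp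
  have "bil n B f g = x * (\<Sum>a<n. dS a * (f a)\<^sup>2)"
  proof -
    have "bil n B f g = (\<Sum>a<n. f a * (\<Sum>b<n. B a b * g b))"
      by (simp add: bil_def sum_distrib_left mult.assoc)
    also have "\<dots> = (\<Sum>a<n. f a * (x * dS a * f a))"
      using eigS by simp
    also have "\<dots> = x * (\<Sum>a<n. dS a * (f a)\<^sup>2)"
      unfolding sum_distrib_left by (intro sum.cong refl) (simp add: power2_eq_square)
    finally show ?thesis .
  qed
  moreover have "bil n B f g = x * (\<Sum>b<n. dT b * (g b)\<^sup>2)"
  proof -
    have "bil n B f g = (\<Sum>b<n. g b * (\<Sum>a<n. B a b * f a))"
      unfolding bil_eq_inner by (intro sum.cong refl) (simp add: sum_distrib_left sum_distrib_right mult_ac)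
    also have "\<dots> = (\<Sum>b<n. g b * (x * dT b * g b))"
      using eigT by simp
    also have "\<dots> = x * (\<Sum>b<n. dT b * (g b)\<^sup>2)"
      unfolding sum_distrib_left by (intro sum.cong refl) (simp add: power2_eq_square)
    finally show ?thesis .
  qed
  ultimately have eq: "2 * bil n B f g = x * ((\<Sum>a<n. dS a * (f a)\<^sup>2) + (\<Sum>b<n. dT b * (g b)\<^sup>2))"
    by (simp add: distrib_left)
  have weight: "d * (1 - \<delta>) * (vnorm n h)\<^sup>2 \<le> (\<Sum>a<n. e a * (h a)\<^sup>2)"
    if e: "\<And>a. a < n \<Longrightarrow> \<bar>e a - d\<bar> \<le> \<delta> * d" for e h
    unfolding vnorm_power2 sum_distrib_left
  proof (intro sum_mono mult_right_mono)
    fix a assume "a \<in> {..<n}"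
    then show "d * (1 - \<delta>) \<le> e a" using e[of a] by (simp add: abs_le_iff algebra_simps)
  qed simp
  have "x * (d * (1 - \<delta>) * N) \<le> 2 * bil n B f g"
    unfolding eq N_def using weight[where e = dS and h = f, OF dS] weight[where e = dT and h = g, OF dT] x
    by (intro mult_left_mono) (simp_all add: distrib_left)
  then have main: "x * (d * (1 - \<delta>)) * N \<le> ?K * N" using upper by (simp add: mult.assoc)
  have "0 < N"
  proof -
    from nz obtain a where a: "a < n" "f a \<noteq> 0 \<or> g a \<noteq> 0" by blast
    then have "vnorm n f \<noteq> 0 \<or> vnorm n g \<noteq> 0" by (auto simp: L2_set_eq_0_iff)
    then show ?thesis unfolding N_def by (auto simp: add_pos_nonneg add_nonneg_pos)
  qed
  then have "x * (d * (1 - \<delta>)) \<le> ?K" using main by simp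
  then show ?thesis using d \<delta> by (simp add: pos_le_divide_eq)
qed

text \<open>\<open>S\<close> is the base change whose first column is the all-ones vector, an
  eigenvector for 1 because the rows sum to 1. Conjugation makes the matrix block triangular, with 1
  and the reduced matrix on the diagonal, so algebraic multiplicities can be read off.\<close>

lemma char_poly_stochastic:
  fixes P :: "real mat"
  assumes P: "P \<in> carrier_mat (Suc n) (Suc n)"
    and rows: "\<And>i. i < Suc n \<Longrightarrow> (\<Sum>j<Suc n. P $$ (i, j)) = 1"
  shows "char_poly P = [:-1, 1:] * char_poly (mat n n (\<lambda>(i, j). P $$ (Suc i, Suc j) - P $$ (0, Suc j)))"
proof -
  let ?N = "Suc n"
  define S :: "real mat" where "S = mat ?N ?N (\<lambda>(i, j). if j = 0 \<or> i = j then 1 else 0)"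
  define S' :: "real mat" where "S' = mat ?N ?N (\<lambda>(i, j). if i = j then 1 else if j = 0 then - 1 else 0)"
  define A3 where "A3 = mat n n (\<lambda>(i, j). P $$ (Suc i, Suc j) - P $$ (0, Suc j))"
  define A2 where "A2 = mat 1 n (\<lambda>(i, j). P $$ (0, Suc j))"
  have S: "S \<in> carrier_mat ?N ?N" and S': "S' \<in> carrier_mat ?N ?N"
    by (simp_all add: S_def S'_def)
  have mulS': "(S' * X) $$ (i, j) = (if i = 0 then X $$ (0, j) else X $$ (i, j) - X $$ (0, j))"
    if X: "X \<in> carrier_mat ?N ?N" and ij: "i < ?N" "j < ?N" for X i j
  proof -
    have "(S' * X) $$ (i, j) = (\<Sum>k\<in>{0..<?N}. (if i = k then 1 else if k = 0 then - 1 else 0) * X $$ (k, j))"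
      using X ij by (simp add: S'_def scalar_prod_def)
    also have "\<dots> = (\<Sum>k\<in>{0..<?N}. (if k = i then X $$ (i, j) else 0) + (if k = 0 then (if i = 0 then 0 else - X $$ (0, j)) else 0))"
      by (intro sum.cong refl) auto
    also have "\<dots> = (if i = 0 then X $$ (0, j) else X $$ (i, j) - X $$ (0, j))"
      using ij by (simp add: sum.distrib)
    finally show ?thesis .
  qed
  have mulS: "(X * S) $$ (i, j) = (if j = 0 then \<Sum>k<?N. X $$ (i, k) else X $$ (i, j))"
    if X: "X \<in> carrier_mat ?N ?N" and ij: "i < ?N" "j < ?N" for X i j
  proof -
    have "(X * S) $$ (i, j) = (\<Sum>k\<in>{0..<?N}. X $$ (i, k) * (if j = 0 \<or> k = j then 1 else 0))"
      using X ij by (simp add: S_def scalar_prod_def)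
    then show ?thesis using ij
      by (cases "j = 0") (simp_all add: atLeast0LessThan if_distrib[where f = "\<lambda>x. _ * x"] cong: if_cong)
  qed
  have S'S: "S' * S = 1\<^sub>m ?N"
  proof (rule eq_matI)
    fix i j assume "i < dim_row (1\<^sub>m ?N)" "j < dim_col (1\<^sub>m ?N)"
    then have ij: "i < ?N" "j < ?N" by simp_all
    have "(S' * S) $$ (i, j) = (if i = 0 then S $$ (0, j) else S $$ (i, j) - S $$ (0, j))"
      by (rule mulS'[OF S ij])
    then show "(S' * S) $$ (i, j) = 1\<^sub>m ?N $$ (i, j)"
      using ij by (auto simp: S_def)
  qed (use S S' in simp_all)
  have SS': "S * S' = 1\<^sub>m ?N"
    using mat_mult_left_right_inverse[OF S' S S'S] .
  have PS: "P * S \<in> carrier_mat ?N ?N" using P S by simp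
  have four: "S' * (P * S) = four_block_mat (1\<^sub>m 1) A2 (0\<^sub>m n 1) A3"
  proof (rule eq_matI)
    fix i j assume "i < dim_row (four_block_mat (1\<^sub>m 1) A2 (0\<^sub>m n 1) A3)"
      "j < dim_col (four_block_mat (1\<^sub>m 1) A2 (0\<^sub>m n 1) A3)"
    then have ij: "i < ?N" "j < ?N" by (simp_all add: A3_def)
    show "(S' * (P * S)) $$ (i, j) = four_block_mat (1\<^sub>m 1) A2 (0\<^sub>m n 1) A3 $$ (i, j)"
      using ij by (cases i; cases j) (simp_all add: mulS'[OF PS] mulS[OF P] rows A2_def A3_def del: sum.lessThan_Suc)
  qed (use S' S P in \<open>simp_all add: A3_def\<close>)
  have "similar_mat P (S' * (P * S))"
  proof -
    have "P = S * (S' * (P * S)) * S'"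
    proof -
      have "S * (S' * (P * S)) * S' = (S * S') * (P * (S * S'))"
        using S S' P by (simp add: assoc_mult_mat[of _ ?N ?N _ ?N _ ?N])
      then show ?thesis using P by (simp add: SS')
    qed
    then show ?thesis
      using P S S' SS' S'S unfolding similar_mat_def similar_mat_wit_def
      by (intro exI[of _ S] exI[of _ S']) (auto simp: Let_def)
  qed
  then have "char_poly P = char_poly (S' * (P * S))" by (rule char_poly_similar)
  also have "\<dots> = char_poly (1\<^sub>m 1 :: real mat) * char_poly A3"
    unfolding four by (rule char_poly_four_block_zeros_col) (simp_all add: A2_def A3_def)
  also have "char_poly (1\<^sub>m 1 :: real mat) = [:-1, 1:]"
    by (subst char_poly_upper_triangular[of _ 1]) (auto simp: diag_mat_def)
  finally show ?thesis by (simp add: A3_def)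
qed

lemma count_eigenvalue_mset:
  assumes "char_poly A \<noteq> 0"
  shows "count (eigenvalue_mset A) x = (if poly (char_poly A) x = 0 then order x (char_poly A) else 0)"
  using poly_roots_finite[OF assms]
  by (simp add: eigenvalue_mset_def count_sum)

text \<open>All roots of \<open>q\<close> lie below \<mu> <= 1, so 1 is a simple root of the
  characteristic polynomial and the only eigenvalue not below \<mu>. The root -1 ensures that the
  sorted list has a second entry, since \<open>! 1\<close> is unspecified on shorter lists.\<close>

lemma second_largest_eigenvalue_less:
  assumes p: "char_poly A = [:-1, 1:] * q" "char_poly A \<noteq> 0"
    and q: "\<And>x. poly q x = 0 \<Longrightarrow> x < \<mu>"
    and m1: "poly q (- 1) = 0" and \<mu>: "\<mu> \<le> 1"
  shows "second_largest_eigenvalue A < \<mu>"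
proof -
  let ?M = "eigenvalue_mset A"
  define L where "L = rev (sorted_list_of_multiset ?M)"
  have msetL: "mset L = ?M" by (simp add: L_def)
  have "sorted (rev L)" by (simp add: L_def)
  have q1: "poly q 1 \<noteq> 0" using q[of 1] \<mu> by auto
  have mem: "x \<in># ?M \<longleftrightarrow> poly (char_poly A) x = 0" for x
    using p(2) by (auto simp: count_eigenvalue_mset order_root simp flip: count_greater_zero_iff)
  have big: "x = 1" if "x \<in># ?M" "\<mu> \<le> x" for x
    using that mem[of x] q[of x] by (auto simp: p(1))
  have "order 1 (char_poly A) = order 1 [:-1, 1 :: real:] + order 1 q"
    using p(2) unfolding p(1) by (rule order_mult)
  also have "\<dots> = 1" using q1 order_power_n_n[of "1 :: real" 1] by (simp add: order_0I)
  finally have count1: "count ?M 1 = 1" using p by (simp add: count_eigenvalue_mset)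
  have "{1, -1} \<subseteq> set L"
    using mem m1 msetL by (auto simp: p(1) simp flip: set_mset_mset)
  then have "card {1, -1 :: real} \<le> card (set L)" by (intro card_mono) auto
  then have len: "2 \<le> length L" using card_length[of L] by simp
  then obtain x y ys where L: "L = x # y # ys"
    by (metis One_nat_def Suc_1 Suc_le_length_iff)
  show ?thesis
  proof (rule ccontr)
    assume "\<not> ?thesis"
    then have y: "\<mu> \<le> y" by (simp add: second_largest_eigenvalue_def L_def[symmetric] L)
    have "y \<le> x" using \<open>sorted (rev L)\<close> by (simp add: L sorted_append)
    then have "x = 1" "y = 1" using big[of x] big[of y] y msetL[symmetric] by (auto simp: L)
    then have "2 \<le> count (mset L) 1" by (simp add: L)
    then show False using count1 by (simp add: msetL)
  qed
qed

text \<open>A root of the complementary factor gives a left eigenvector of the reduced matrix;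
  prepending the coordinate that makes the sum zero lifts it to a left eigenvector of
  \<open>P\<close>. For a random walk, division by the degrees turns this into an eigenfunction, and
  sum zero into orthogonality to the constants.\<close>

lemma second_largest_eigenvalue_stochastic:
  fixes P :: "real mat"
  assumes P: "P \<in> carrier_mat (Suc n) (Suc n)"
    and rows: "\<And>i. i < Suc n \<Longrightarrow> (\<Sum>j<Suc n. P $$ (i, j)) = 1"
    and neg: "v \<in> carrier_vec (Suc n)" "v \<noteq> 0\<^sub>v (Suc n)" "P *\<^sub>v v = - v"
    and left: "\<And>x u. \<exists>i<Suc n. u i \<noteq> 0 \<Longrightarrow> (\<Sum>i<Suc n. u i) = 0 \<Longrightarrow>
      (\<And>j. j < Suc n \<Longrightarrow> (\<Sum>i<Suc n. u i * P $$ (i, j)) = x * u j) \<Longrightarrow> x < \<mu>"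
    and \<mu>: "\<mu> \<le> 1"
  shows "second_largest_eigenvalue P < \<mu>"
proof -
  define A3 where "A3 = mat n n (\<lambda>(i, j). P $$ (Suc i, Suc j) - P $$ (0, Suc j))"
  have A3: "A3 \<in> carrier_mat n n" by (simp add: A3_def)
  have p: "char_poly P = [:-1, 1:] * char_poly A3"
    unfolding A3_def by (rule char_poly_stochastic[OF P rows])
  have p0: "char_poly P \<noteq> 0"
    using degree_monic_char_poly[OF P] by auto
  have "eigenvalue P (- 1)"
    unfolding eigenvalue_def eigenvector_def using P neg by (intro exI[of _ v]) auto
  then have "poly (char_poly P) (- 1) = 0"
    using eigenvalue_root_char_poly[OF P] by simp
  then have m1: "poly (char_poly A3) (- 1) = 0" by (simp add: p)
  have q: "x < \<mu>" if root: "poly (char_poly A3) x = 0" for x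
  proof -
    have "poly (char_poly (transpose_mat A3)) x = 0"
      using root A3 by (simp add: char_poly_transpose_mat)
    then have "eigenvalue (transpose_mat A3) x"
      using eigenvalue_root_char_poly[of "transpose_mat A3" n x] A3 by simp
    then obtain w where w: "w \<in> carrier_vec n" "w \<noteq> 0\<^sub>v n" "transpose_mat A3 *\<^sub>v w = x \<cdot>\<^sub>v w"
      unfolding eigenvalue_def eigenvector_def using A3 by auto
    have wj: "(\<Sum>i<n. (P $$ (Suc i, Suc j) - P $$ (0, Suc j)) * w $ i) = x * w $ j" if j: "j < n" for j
    proof -
      have "(transpose_mat A3 *\<^sub>v w) $ j = x * w $ j" using w j by simp
      moreover have "(transpose_mat A3 *\<^sub>v w) $ j = (\<Sum>i<n. (P $$ (Suc i, Suc j) - P $$ (0, Suc j)) * w $ i)"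
        using w(1) j by (simp add: A3_def scalar_prod_def atLeast0LessThan)
      ultimately show ?thesis by simp
    qed
    define u where "u i = (case i of 0 \<Rightarrow> - (\<Sum>i<n. w $ i) | Suc i \<Rightarrow> w $ i)" for i
    have sum_u: "(\<Sum>i<Suc n. u i) = 0"
      by (simp add: sum.lessThan_Suc_shift u_def del: sum.lessThan_Suc)
    \<comment> \<open>The subtracted multiples of row 0 add up to the term of index 0, as
      \<open>u 0\<close> is minus the sum of \<open>w\<close>.\<close>
    have uS: "(\<Sum>i<Suc n. u i * P $$ (i, Suc j)) = x * u (Suc j)" if "j < n" for j
      using wj[OF that]
      by (simp add: sum.lessThan_Suc_shift u_def left_diff_distrib sum_subtractf right_diff_distrib sum_distrib_right mult.commute del: sum.lessThan_Suc)
    \<comment> \<open>Column 0 is absent from the reduced matrix; its equation follows by summing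
      over all columns, because the rows of \<open>P\<close> sum to 1 and \<open>u\<close> to
      0.\<close>
    have u0: "(\<Sum>i<Suc n. u i * P $$ (i, 0)) = x * u 0"
    proof -
      have "(\<Sum>j<Suc n. \<Sum>i<Suc n. u i * P $$ (i, j)) = (\<Sum>i<Suc n. \<Sum>j<Suc n. u i * P $$ (i, j))"
        by (rule sum.swap)
      also have "\<dots> = 0" using rows sum_u by (simp add: sum_distrib_left[symmetric] del: sum.lessThan_Suc)
      finally have "(\<Sum>i<Suc n. u i * P $$ (i, 0)) + (\<Sum>j<n. x * u (Suc j)) = 0"
        using uS by (simp add: sum.lessThan_Suc_shift[of _ n] del: sum.lessThan_Suc)
      moreover have "u 0 = - (\<Sum>j<n. u (Suc j))" by (simp add: u_def)
      ultimately show ?thesis by (simp add: sum_distrib_left)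
    qed
    have "\<exists>i<n. w $ i \<noteq> 0"
    proof (rule ccontr)
      assume "\<not> ?thesis"
      then have "w = 0\<^sub>v n" using w(1) by (intro eq_vecI) auto
      then show False using w(2) by simp
    qed
    then obtain i where "i < n" "w $ i \<noteq> 0" by blast
    then have "\<exists>i<Suc n. u i \<noteq> 0" by (intro exI[of _ "Suc i"]) (simp add: u_def)
    moreover have "(\<Sum>i<Suc n. u i * P $$ (i, j)) = x * u j" if "j < Suc n" for j
      using that u0 uS[of "j - 1"] by (cases j) auto
    ultimately show ?thesis using sum_u by (intro left)
  qed
  show ?thesis by (rule second_largest_eigenvalue_less[OF p p0 q m1 \<mu>])
qed

section \<open>The link graph and its random walk\<close>

lemma link_edges_sym: "link_edges m R u v = link_edges m R v u"
  by (auto simp: link_edges_def)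

lemma sum_lessThan_double: "(\<Sum>u<2 * m. F u) = (\<Sum>a<m. F a) + (\<Sum>b<m. F (m + b))" for m :: nat
proof -
  have "(\<Sum>u<m + k. F u) = (\<Sum>a<m. F a) + (\<Sum>b<k. F (m + b))" for k
    by (induction k) (simp_all add: add.assoc)
  from this[of m] show ?thesis by (simp add: mult_2)
qed

lemma link_edges_simps:
  assumes "a < m" "b < m"
  shows "link_edges m R a (m + b) = link_mult_pm R a b" "link_edges m R (m + b) a = link_mult_pm R a b"
    "link_edges m R a b = 0" "link_edges m R (m + a) (m + b) = 0"
  using assms by (simp_all add: link_edges_def)

lemma link_degree_left: "a < m \<Longrightarrow> link_degree m R a = (\<Sum>b<m. link_mult_pm R a b)"
  by (simp add: link_degree_def sum_lessThan_double link_edges_simps)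

lemma link_degree_right: "b < m \<Longrightarrow> link_degree m R (m + b) = (\<Sum>a<m. link_mult_pm R a b)"
  by (simp add: link_degree_def sum_lessThan_double link_edges_simps)

text \<open>If some \<open>v0\<close> is not reachable from \<open>u0\<close>, the indicator of the
  component of \<open>u0\<close> minus its degree-weighted mean is a nonzero eigenfunction for 1
  orthogonal to the constants, against \<open>key\<close>.\<close>

lemma link_connected_if_eigenvalue_bound:
  assumes pos: "\<And>v. v < 2 * m \<Longrightarrow> 0 < link_degree m R v"
    and key: "\<And>x f. \<exists>v<2 * m. f v \<noteq> 0 \<Longrightarrow> (\<Sum>v<2 * m. real (link_degree m R v) * f v) = 0 \<Longrightarrow>
      (\<And>v. v < 2 * m \<Longrightarrow> (\<Sum>u<2 * m. real (link_edges m R u v) * f u) = x * real (link_degree m R v) * f v) \<Longrightarrow> x < 1"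
  shows "link_connected m R"
  unfolding link_connected_def
proof (intro allI impI)
  let ?r = "{(x, y). x < 2 * m \<and> y < 2 * m \<and> link_edges m R x y > 0}"
  let ?d = "\<lambda>v. real (link_degree m R v)"
  fix u0 v0 assume uv: "u0 < 2 * m" "v0 < 2 * m"
  show "(u0, v0) \<in> ?r\<^sup>*"
  proof (rule ccontr)
    assume nc: "(u0, v0) \<notin> ?r\<^sup>*"
    define k where "k v = (of_bool ((u0, v) \<in> ?r\<^sup>*) :: real)" for v
    define W where "W = (\<Sum>v<2 * m. ?d v)"
    define c where "c = (\<Sum>v<2 * m. ?d v * k v) / W"
    define f where "f v = k v - c" for v
    have "0 < W" unfolding W_def using pos uv by (intro sum_pos) auto
    have "(\<Sum>v<2 * m. ?d v * f v) = (\<Sum>v<2 * m. ?d v * k v) - W * c"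
      by (simp add: f_def right_diff_distrib sum_subtractf sum_distrib_right W_def)
    then have orth: "(\<Sum>v<2 * m. ?d v * f v) = 0"
      using \<open>0 < W\<close> by (simp add: c_def)
    have nz: "\<exists>v<2 * m. f v \<noteq> 0"
    proof -
      have "f u0 - f v0 = 1" using nc by (simp add: f_def k_def)
      then have "f u0 \<noteq> 0 \<or> f v0 \<noteq> 0" by auto
      then show ?thesis using uv by blast
    qed
    have eig: "(\<Sum>u<2 * m. real (link_edges m R u v) * f u) = 1 * ?d v * f v" if v: "v < 2 * m" for v
    proof -
      have "real (link_edges m R u v) * k u = real (link_edges m R u v) * k v" if u: "u < 2 * m" for u
      proof (cases "link_edges m R u v = 0")
        case False
        then have "(u, v) \<in> ?r" "(v, u) \<in> ?r" using u v link_edges_sym[of m R u v] by auto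
        then have "(u0, u) \<in> ?r\<^sup>* \<longleftrightarrow> (u0, v) \<in> ?r\<^sup>*" by (meson rtrancl.rtrancl_into_rtrancl)
        then show ?thesis by (simp add: k_def)
      qed simp
      then have "(\<Sum>u<2 * m. real (link_edges m R u v) * f u) = (\<Sum>u<2 * m. real (link_edges m R u v) * f v)"
        by (intro sum.cong refl) (simp add: f_def right_diff_distrib)
      then show ?thesis by (simp add: sum_distrib_right[symmetric] link_degree_def)
    qed
    have "(1 :: real) < 1" by (rule key[OF nz orth eig])
    then show False by simp
  qed
qed

text \<open>One estimate, \<open>key\<close>, for eigenfunctions orthogonal to the constants yields
  both conclusions. The sign function of the bipartition supplies the eigenvalue -1.\<close>

lemma link_graph_eigenvalue_bound:
  fixes d \<delta> c T \<mu> :: real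
  defines "B \<equiv> \<lambda>R a b. real (link_mult_pm R a b)"
  assumes m: "0 < m" and d: "0 < d" and \<delta>: "0 \<le> \<delta>" "\<delta> < 1" and c: "0 \<le> c" and T: "0 \<le> T"
    and dS: "\<And>a. a < m \<Longrightarrow> \<bar>(\<Sum>b<m. B R a b) - d\<bar> \<le> \<delta> * d"
    and dT: "\<And>b. b < m \<Longrightarrow> \<bar>(\<Sum>a<m. B R a b) - d\<bar> \<le> \<delta> * d"
    and X: "op_bound m (\<lambda>a b. B R a b - c) T"
    and \<mu>: "(T + c * real m * \<delta>\<^sup>2) / (d * (1 - \<delta>)) < \<mu>" "\<mu> \<le> 1" "0 < \<mu>"
  shows "link_connected m R \<and> second_largest_eigenvalue (random_walk_mat m R) < \<mu>"
proof -
  let ?E = "\<lambda>u v. real (link_edges m R u v)"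
  let ?d = "\<lambda>v. real (link_degree m R v)"
  have degS: "?d a = (\<Sum>b<m. B R a b)" if "a < m" for a
    using that by (simp add: link_degree_left B_def)
  have degT: "?d (m + b) = (\<Sum>a<m. B R a b)" if "b < m" for b
    using that by (simp add: link_degree_right B_def)
  have pos: "0 < link_degree m R v" if v: "v < 2 * m" for v
  proof -
    have "0 < d - \<delta> * d" using d \<delta> by simp
    moreover have "d - \<delta> * d \<le> ?d v"
    proof (cases "v < m")
      case True
      then show ?thesis using dS[of v] degS[of v] by linarith
    next
      case False
      then obtain b where b: "v = m + b" using le_Suc_ex[of m v] by auto
      then show ?thesis using v dT[of b] degT[of b] unfolding b by simp
    qed
    ultimately show ?thesis by linarith
  qed
  have key: "x < \<mu>"
    if nz: "\<exists>v<2 * m. f v \<noteq> 0" and orth: "(\<Sum>v<2 * m. ?d v * f v) = 0"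
      and eig: "\<And>v. v < 2 * m \<Longrightarrow> (\<Sum>u<2 * m. ?E u v * f u) = x * ?d v * f v" for x f
  proof (cases "0 < x")
    case False
    then show ?thesis using \<mu> by linarith
  next
    case True
    have "x \<le> (T + c * real m * \<delta>\<^sup>2) / (d * (1 - \<delta>))"
    proof (rule bipartite_eigenvalue_bound[where B = "B R" and f = f and g = "\<lambda>b. f (m + b)", OF refl refl dS dT d \<delta> c T X])
      fix a assume a: "a < m"
      show "(\<Sum>b<m. B R a b * f (m + b)) = x * (\<Sum>b<m. B R a b) * f a"
        using eig[of a] a by (simp add: sum_lessThan_double link_edges_simps B_def link_degree_left)
      show "(\<Sum>a'<m. B R a' a * f a') = x * (\<Sum>a'<m. B R a' a) * f (m + a)"
        using eig[of "m + a"] a by (simp add: sum_lessThan_double link_edges_simps B_def link_degree_right)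
    next
      show "(\<Sum>a<m. (\<Sum>b<m. B R a b) * f a) + (\<Sum>b<m. (\<Sum>a<m. B R a b) * f (m + b)) = 0"
        using orth by (simp add: sum_lessThan_double link_degree_left link_degree_right B_def)
      obtain v where v: "v < 2 * m" "f v \<noteq> 0" using nz by blast
      show "\<exists>a<m. f a \<noteq> 0 \<or> f (m + a) \<noteq> 0"
      proof (cases "v < m")
        case False
        then obtain b where b: "v = m + b" using le_Suc_ex[of m v] by auto
        then show ?thesis using v by (intro exI[of _ b]) simp
      qed (use v in blast)
    qed (use True in auto)
    then show ?thesis using \<mu> by linarith
  qed
  have "link_connected m R"
  proof (rule link_connected_if_eigenvalue_bound[OF pos])
    fix x :: real and f
    assume "\<exists>v<2 * m. f v \<noteq> 0" "(\<Sum>v<2 * m. ?d v * f v) = 0"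
      "\<And>v. v < 2 * m \<Longrightarrow> (\<Sum>u<2 * m. ?E u v * f u) = x * ?d v * f v"
    then have "x < \<mu>" by (rule key)
    then show "x < 1" using \<mu> by simp
  qed
  moreover have "second_largest_eigenvalue (random_walk_mat m R) < \<mu>"
  proof -
    define n where "n = 2 * m - 1"
    have n: "2 * m = Suc n" using m by (simp add: n_def)
    let ?P = "random_walk_mat m R"
    have P: "?P \<in> carrier_mat (Suc n) (Suc n)" by (simp add: random_walk_mat_def n[symmetric])
    have Pij: "?P $$ (i, j) = ?E i j / ?d i" if "i < 2 * m" "j < 2 * m" for i j
      using that by (simp add: random_walk_mat_def link_edges_sym[of m R j i])
    let ?v = "vec (2 * m) (\<lambda>i. if i < m then 1 else - 1 :: real)"
    have deg': "?d i = (\<Sum>j<2 * m. ?E i j)" for i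
      unfolding link_degree_def by (simp add: link_edges_sym[of m R i])
    show ?thesis
    proof (rule second_largest_eigenvalue_stochastic[OF P, where v = ?v])
      fix i assume i: "i < Suc n"
      show "(\<Sum>j<Suc n. ?P $$ (i, j)) = 1"
        using i pos[of i] unfolding n[symmetric]
        by (simp add: Pij sum_divide_distrib[symmetric] deg'[symmetric])
    next
      show "?v \<in> carrier_vec (Suc n)" by (simp add: n)
      have "?v $ 0 \<noteq> 0\<^sub>v (2 * m) $ 0" using m by simp
      then show "?v \<noteq> 0\<^sub>v (Suc n)" unfolding n by metis
      show "?P *\<^sub>v ?v = - ?v"
      proof (rule eq_vecI)
        fix i assume "i < dim_vec (- ?v)"
        then have i: "i < 2 * m" by simp
        have "(?P *\<^sub>v ?v) $ i = (\<Sum>j<2 * m. ?E i j / ?d i * (if j < m then 1 else - 1))"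
          using i P by (simp add: scalar_prod_def atLeast0LessThan Pij n[symmetric])
        also have "\<dots> = (\<Sum>j<2 * m. (- (if i < m then 1 else - 1) / ?d i) * ?E i j)"
          by (intro sum.cong refl) (auto simp: link_edges_def)
        also have "\<dots> = (- (if i < m then 1 else - 1) / ?d i) * ?d i"
          unfolding sum_distrib_left[symmetric] deg' ..
        also have "\<dots> = - (if i < m then 1 else - 1)"
          using pos[OF i] by simp
        finally show "(?P *\<^sub>v ?v) $ i = (- ?v) $ i" using i by simp
      qed (use P n in simp)
    next
      fix x :: real and u :: "nat \<Rightarrow> real"
      assume nz: "\<exists>i<Suc n. u i \<noteq> 0" and sum: "(\<Sum>i<Suc n. u i) = 0"
        and eig: "\<And>j. j < Suc n \<Longrightarrow> (\<Sum>i<Suc n. u i * ?P $$ (i, j)) = x * u j"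
      \<comment> \<open>The walk is reversible with respect to the degrees, so a left eigenvector
        divided by the degrees satisfies the equation in \<open>key\<close>.\<close>
      define f where "f v = u v / ?d v" for v
      have df: "?d v * f v = u v" if "v < 2 * m" for v
        using pos[OF that] by (simp add: f_def)
      show "x < \<mu>"
      proof (rule key)
        show "\<exists>v<2 * m. f v \<noteq> 0" using nz df unfolding n[symmetric] by (metis mult_zero_right)
        show "(\<Sum>v<2 * m. ?d v * f v) = 0" using sum df by (simp add: n[symmetric])
        fix v assume v: "v < 2 * m"
        have "(\<Sum>i<2 * m. ?E i v * f i) = (\<Sum>i<2 * m. u i * ?P $$ (i, v))"
          using v by (intro sum.cong refl) (simp add: Pij f_def)
        also have "\<dots> = x * u v" using eig[of v] v by (simp add: n[symmetric])
        finally show "(\<Sum>i<2 * m. ?E i v * f i) = x * ?d v * f v" using df[OF v] by (simp add: mult.assoc)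
      qed
    qed (rule \<mu>)
  qed
  ultimately show ?thesis ..
qed

section \<open>Probability estimates\<close>

lemma op_bound_add:
  assumes "op_bound n Y T" "op_bound n Z U"
  shows "op_bound n (\<lambda>a b. Y a b + Z a b) (T + U)"
  unfolding op_bound_def
proof (intro allI)
  fix x y
  have "bil n (\<lambda>a b. Y a b + Z a b) x y = bil n Y x y + bil n Z x y"
    by (simp add: bil_def sum.distrib[symmetric] algebra_simps)
  then have "\<bar>bil n (\<lambda>a b. Y a b + Z a b) x y\<bar> \<le> \<bar>bil n Y x y\<bar> + \<bar>bil n Z x y\<bar>" by simp
  also have "\<dots> \<le> T * vnorm n x * vnorm n y + U * vnorm n x * vnorm n y"
    by (intro add_mono op_boundD assms)
  finally show "\<bar>bil n (\<lambda>a b. Y a b + Z a b) x y\<bar> \<le> (T + U) * vnorm n x * vnorm n y"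
    by (simp add: algebra_simps)
qed

lemma op_bound_zero: "op_bound n (\<lambda>a b. 0) 0"
  by (simp add: op_bound_def bil_def)

lemma op_bound_sum:
  assumes "finite I" "\<And>i. i \<in> I \<Longrightarrow> op_bound n (Y i) T"
  shows "op_bound n (\<lambda>a b. \<Sum>i\<in>I. Y i a b) (real (card I) * T)"
  using assms
proof (induction I rule: finite_induct)
  case empty
  then show ?case by (simp add: op_bound_zero)
next
  case (insert i I)
  then have "op_bound n (\<lambda>a b. Y i a b + (\<Sum>i\<in>I. Y i a b)) (T + real (card I) * T)"
    by (intro op_bound_add) auto
  then show ?case using insert.hyps by (simp add: algebra_simps)
qed

text \<open>Schur's test: each entry is split as sqrt W times sqrt W, and Cauchy-Schwarz over all
  positions leaves the row sums with one vector and the column sums with the other. It serves the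
  excess matrix.\<close>

lemma op_bound_schur:
  assumes nonneg: "\<And>a b. 0 \<le> W a b" and K: "0 \<le> K"
    and rows: "\<And>a. a < n \<Longrightarrow> (\<Sum>b<n. W a b) \<le> K"
    and cols: "\<And>b. b < n \<Longrightarrow> (\<Sum>a<n. W a b) \<le> K"
  shows "op_bound n W K"
  unfolding op_bound_def
proof (intro allI)
  fix x y
  let ?V = "{..<n} \<times> {..<n}"
  let ?f = "\<lambda>(a, b). sqrt (W a b) * \<bar>x a\<bar>" and ?g = "\<lambda>(a, b). sqrt (W a b) * \<bar>y b\<bar>"
  have "\<bar>bil n W x y\<bar> \<le> (\<Sum>e\<in>?V. \<bar>case e of (a, b) \<Rightarrow> x a * W a b * y b\<bar>)"
    unfolding bil_def sum.cartesian_product by (rule sum_abs)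
  also have "\<dots> = (\<Sum>e\<in>?V. \<bar>?f e\<bar> * \<bar>?g e\<bar>)"
  proof (intro sum.cong refl)
    fix e assume "e \<in> ?V"
    obtain a b where e: "e = (a, b)" by (cases e)
    have "sqrt (W a b) * sqrt (W a b) = W a b" using nonneg by simp
    then have "\<bar>?f e\<bar> * \<bar>?g e\<bar> = W a b * (\<bar>x a\<bar> * \<bar>y b\<bar>)"
      using nonneg by (simp add: e abs_mult)
    then show "\<bar>case e of (a, b) \<Rightarrow> x a * W a b * y b\<bar> = \<bar>?f e\<bar> * \<bar>?g e\<bar>"
      using nonneg by (simp add: e abs_mult)
  qed
  also have "\<dots> \<le> L2_set ?f ?V * L2_set ?g ?V" by (rule L2_set_mult_ineq)
  also have "\<dots> \<le> (sqrt K * vnorm n x) * (sqrt K * vnorm n y)"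
  proof (intro mult_mono)
    have "(\<Sum>e\<in>?V. (?f e)\<^sup>2) = (\<Sum>a<n. \<Sum>b<n. W a b * (x a)\<^sup>2)"
      using nonneg unfolding sum.cartesian_product
      by (intro sum.cong refl) (auto simp: power_mult_distrib)
    also have "\<dots> = (\<Sum>a<n. (\<Sum>b<n. W a b) * (x a)\<^sup>2)"
      by (simp add: sum_distrib_right)
    also have "\<dots> \<le> (\<Sum>a<n. K * (x a)\<^sup>2)"
      using rows by (intro sum_mono mult_right_mono) auto
    finally have "(\<Sum>e\<in>?V. (?f e)\<^sup>2) \<le> K * (\<Sum>a<n. (x a)\<^sup>2)" by (simp add: sum_distrib_left)
    then show "L2_set ?f ?V \<le> sqrt K * vnorm n x"
      unfolding L2_set_def real_sqrt_mult[symmetric] by (rule real_sqrt_le_mono)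
    have "(\<Sum>e\<in>?V. (?g e)\<^sup>2) = (\<Sum>a<n. \<Sum>b<n. W a b * (y b)\<^sup>2)"
      using nonneg unfolding sum.cartesian_product
      by (intro sum.cong refl) (auto simp: power_mult_distrib)
    also have "\<dots> = (\<Sum>b<n. \<Sum>a<n. W a b * (y b)\<^sup>2)" by (rule sum.swap)
    also have "\<dots> = (\<Sum>b<n. (\<Sum>a<n. W a b) * (y b)\<^sup>2)"
      by (simp add: sum_distrib_right)
    also have "\<dots> \<le> (\<Sum>b<n. K * (y b)\<^sup>2)"
      using cols by (intro sum_mono mult_right_mono) auto
    finally have "(\<Sum>e\<in>?V. (?g e)\<^sup>2) \<le> K * (\<Sum>b<n. (y b)\<^sup>2)" by (simp add: sum_distrib_left)
    then show "L2_set ?g ?V \<le> sqrt K * vnorm n y"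
      unfolding L2_set_def real_sqrt_mult[symmetric] by (rule real_sqrt_le_mono)
  qed (use K in \<open>simp_all add: L2_set_nonneg\<close>)
  also have "\<dots> = K * vnorm n x * vnorm n y"
  proof -
    have "sqrt K * sqrt K = K" using K by simp
    then show ?thesis by (metis mult.assoc mult.left_commute)
  qed
  finally show "\<bar>bil n W x y\<bar> \<le> K * vnorm n x * vnorm n y" .
qed

section \<open>Chernoff bounds and the excess over the support\<close>

lemma exp_le_quadratic:
  fixes s :: real
  assumes "\<bar>s\<bar> \<le> 1"
  shows "exp s \<le> 1 + s + s\<^sup>2"
proof (cases "0 \<le> s")
  case True
  then show ?thesis using assms by (intro exp_bound) auto
next
  case False
  then have "exp (- (- s)) \<le> 1 - (- s) + (- s)\<^sup>2 / 2" by (intro exp_minus_upper) auto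
  then have "exp s \<le> 1 + s + s\<^sup>2 / 2" by simp
  moreover have "0 \<le> s\<^sup>2" by simp
  ultimately show ?thesis by linarith
qed

lemma bexp_exp_card:
  assumes "finite U" "F \<subseteq> U"
  shows "bexp U p (\<lambda>R. exp (s * real (card (R \<inter> F)))) = (p * exp s + (1 - p)) ^ card F"
proof -
  have fin: "finite F" using assms finite_subset by blast
  have "bexp U p (\<lambda>R. exp (s * real (card (R \<inter> F)))) = bexp F p (\<lambda>R. exp (s * real (card R)))"
    using assms by (rule bexp_restrict)
  also have "\<dots> = bexp F p (\<lambda>R. \<Prod>u\<in>F. if u \<in> R then exp s else 1)"
  proof (intro bexp_cong)
    fix R assume "R \<subseteq> F"
    then have "(\<Prod>u\<in>F. if u \<in> R then exp s else 1) = exp s ^ card R"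
      using fin by (simp add: prod.If_cases Int_absorb1)
    then show "exp (s * real (card R)) = (\<Prod>u\<in>F. if u \<in> R then exp s else 1)"
      by (simp add: exp_of_nat_mult[symmetric] mult.commute)
  qed
  also have "\<dots> = (p * exp s + (1 - p)) ^ card F"
    using fin by (subst bexp_prod_if) auto
  finally show ?thesis .
qed

text \<open>Exponential Markov inequality for both tails. The parameters \<delta>/2 and -\<delta>/2
  minimise the exponent once e^s is replaced by 1 + s + s^2.\<close>

lemma bexp_chernoff:
  assumes U: "finite U" "F \<subseteq> U" and p: "0 \<le> p" "p \<le> 1" and \<delta>: "0 < \<delta>" "\<delta> \<le> 1"
    and \<mu>: "\<mu> = real (card F) * p"
  shows "bexp U p (\<lambda>R. of_bool (\<delta> * \<mu> < \<bar>real (card (R \<inter> F)) - \<mu>\<bar>)) \<le> 2 * exp (- \<delta>\<^sup>2 * \<mu> / 4)"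
proof -
  have mgf: "bexp U p (\<lambda>R. exp (s * real (card (R \<inter> F)))) \<le> exp (\<mu> * (s + s\<^sup>2))" if "\<bar>s\<bar> \<le> 1" for s
  proof -
    have "p * exp s \<le> p * (1 + s + s\<^sup>2)"
      using exp_le_quadratic[OF that] p by (intro mult_left_mono)
    then have "p * exp s + (1 - p) \<le> 1 + p * (s + s\<^sup>2)"
      by (simp add: algebra_simps)
    also have "\<dots> \<le> exp (p * (s + s\<^sup>2))" by (rule exp_ge_add_one_self)
    finally have "(p * exp s + (1 - p)) ^ card F \<le> exp (p * (s + s\<^sup>2)) ^ card F"
      using p by (intro power_mono) auto
    then show ?thesis
      by (simp add: bexp_exp_card[OF U] \<mu> exp_of_nat_mult[symmetric] mult.assoc)
  qed
  have "bexp U p (\<lambda>R. of_bool (\<delta> * \<mu> < \<bar>real (card (R \<inter> F)) - \<mu>\<bar>))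
    \<le> bexp U p (\<lambda>R. exp (- (\<delta> / 2) * (\<mu> + \<delta> * \<mu>)) * exp (\<delta> / 2 * real (card (R \<inter> F)))
        + exp (\<delta> / 2 * (\<mu> - \<delta> * \<mu>)) * exp (- (\<delta> / 2) * real (card (R \<inter> F))))"
  proof (rule bexp_mono[OF p])
    fix R
    let ?x = "real (card (R \<inter> F))"
    let ?l = "exp (- (\<delta> / 2) * (\<mu> + \<delta> * \<mu>)) * exp (\<delta> / 2 * ?x)"
    let ?r = "exp (\<delta> / 2 * (\<mu> - \<delta> * \<mu>)) * exp (- (\<delta> / 2) * ?x)"
    have l: "?l = exp (\<delta> / 2 * (?x - (\<mu> + \<delta> * \<mu>)))"
      unfolding exp_add[symmetric] by (simp add: algebra_simps)
    have r: "?r = exp (\<delta> / 2 * ((\<mu> - \<delta> * \<mu>) - ?x))"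
      unfolding exp_add[symmetric] right_diff_distrib[of "\<delta> / 2"] by simp
    show "of_bool (\<delta> * \<mu> < \<bar>?x - \<mu>\<bar>) \<le> ?l + ?r"
    proof (cases "\<delta> * \<mu> < \<bar>?x - \<mu>\<bar>")
      case True
      then consider "0 \<le> ?x - (\<mu> + \<delta> * \<mu>)" | "0 \<le> (\<mu> - \<delta> * \<mu>) - ?x" by linarith
      then have "1 \<le> ?l \<or> 1 \<le> ?r"
        unfolding l r using \<delta> by cases auto
      moreover have "0 \<le> ?l" "0 \<le> ?r" by simp_all
      ultimately have "1 \<le> ?l + ?r" by linarith
      then show ?thesis using True by simp
    qed (simp add: add_nonneg_nonneg)
  qed
  also have "\<dots> = exp (- (\<delta> / 2) * (\<mu> + \<delta> * \<mu>)) * bexp U p (\<lambda>R. exp (\<delta> / 2 * real (card (R \<inter> F))))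
      + exp (\<delta> / 2 * (\<mu> - \<delta> * \<mu>)) * bexp U p (\<lambda>R. exp (- (\<delta> / 2) * real (card (R \<inter> F))))"
    unfolding bexp_add bexp_cmult ..
  also have "\<dots> \<le> exp (- (\<delta> / 2) * (\<mu> + \<delta> * \<mu>)) * exp (\<mu> * (\<delta> / 2 + (\<delta> / 2)\<^sup>2))
      + exp (\<delta> / 2 * (\<mu> - \<delta> * \<mu>)) * exp (\<mu> * (- (\<delta> / 2) + (- (\<delta> / 2))\<^sup>2))"
    using \<delta> by (intro add_mono mult_left_mono mgf) auto
  also have "\<dots> = 2 * exp (- \<delta>\<^sup>2 * \<mu> / 4)"
  proof -
    have 1: "- (\<delta> / 2) * (\<mu> + \<delta> * \<mu>) + \<mu> * (\<delta> / 2 + (\<delta> / 2)\<^sup>2) = - \<delta>\<^sup>2 * \<mu> / 4"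
      by (simp add: algebra_simps power2_eq_square)
    have 2: "\<delta> / 2 * (\<mu> - \<delta> * \<mu>) + \<mu> * (- (\<delta> / 2) + (- (\<delta> / 2))\<^sup>2) = - \<delta>\<^sup>2 * \<mu> / 4"
      by (simp add: field_simps power2_eq_square)
    show ?thesis unfolding exp_add[symmetric] 1 2 by simp
  qed
  finally show ?thesis .
qed

text \<open>\<open>card S - 1\<close> is truncated subtraction: it counts the elements beyond one
  and is 0 for the empty set. Doubling the power thus gives 2^(card S), plus 1 if \<open>S\<close>
  is empty, and both parts have explicit expectations.\<close>

lemma bexp_excess_mgf:
  assumes "finite A"
  shows "bexp A p (\<lambda>S. 2 ^ (card S - 1)) = ((1 + p) ^ card A + (1 - p) ^ card A) / 2"
proof -
  have "bexp A p (\<lambda>S. 2 ^ (card S - 1))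
      = bexp A p (\<lambda>S. 1/2 * ((\<Prod>u\<in>A. if u \<in> S then 2 else 1) + (if S = {} then 1 else 0)))"
  proof (intro bexp_cong)
    fix S assume S: "S \<subseteq> A"
    then have "finite S" using assms finite_subset by blast
    have "(\<Prod>u\<in>A. if u \<in> S then 2 else 1 :: real) = 2 ^ card S"
      using assms S by (simp add: prod.If_cases Int_absorb1)
    moreover have "S \<noteq> {} \<Longrightarrow> (2 :: real) ^ card S = 2 * 2 ^ (card S - 1)"
      using \<open>finite S\<close> by (simp add: power_eq_if)
    ultimately show "2 ^ (card S - 1)
        = 1/2 * ((\<Prod>u\<in>A. if u \<in> S then 2 else 1) + (if S = {} then 1 else 0 :: real))"
      by auto
  qed
  also have "\<dots> = 1/2 * ((1 + p) ^ card A + (1 - p) ^ card A)"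
    unfolding bexp_cmult bexp_add bexp_is_empty[OF assms] bexp_prod_if[OF assms]
    by (simp add: algebra_simps)
  finally show ?thesis by simp
qed

text \<open>The excesses of disjoint blocks are independent, and Markov's inequality is applied to 2
  to the total excess. The mean of (1 + p)^m and (1 - p)^m has no linear term, so a block
  contributes only e^(x^2) with x = m p: an excess needs two relators at one position.\<close>

lemma prob_excess_sum:
  assumes U: "finite U" and V: "finite V" "\<And>v. v \<in> V \<Longrightarrow> A v \<subseteq> U \<and> card (A v) = m"
    and disj: "disjoint_family_on A V" and p: "0 \<le> p" "p \<le> 1" "real m * p \<le> 1"
  shows "bexp U p (\<lambda>R. of_bool (K \<le> (\<Sum>v\<in>V. card (R \<inter> A v) - 1)))
    \<le> exp (real (card V) * (real m * p)\<^sup>2) / 2 ^ K"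
proof -
  let ?x = "real m * p"
  have fin: "finite (A v)" if "v \<in> V" for v using V(2)[OF that] U finite_subset by blast
  have "bexp U p (\<lambda>R. of_bool (K \<le> (\<Sum>v\<in>V. card (R \<inter> A v) - 1)))
      \<le> bexp U p (\<lambda>R. \<Prod>v\<in>V. 2 ^ (card (R \<inter> A v) - 1)) / 2 ^ K"
    using p by (intro bexp_markov prod_nonneg) (auto simp: power_sum[symmetric])
  also have "bexp U p (\<lambda>R. \<Prod>v\<in>V. 2 ^ (card (R \<inter> A v) - 1))
      = bexp U p (\<lambda>R. \<Prod>v\<in>V. 2 ^ (card ((R \<inter> (\<Union>v\<in>V. A v)) \<inter> A v) - 1))"
    by (intro bexp_cong prod.cong refl) (simp add: Int_assoc Int_absorb1 UN_upper)
  also have "\<dots> = bexp (\<Union>v\<in>V. A v) p (\<lambda>R. \<Prod>v\<in>V. 2 ^ (card (R \<inter> A v) - 1))"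
    using V U by (intro bexp_restrict[where F = "\<lambda>R. \<Prod>v\<in>V. 2 ^ (card (R \<inter> A v) - 1)"]) auto
  also have "\<dots> = (\<Prod>v\<in>V. bexp (A v) p (\<lambda>S. 2 ^ (card S - 1)))"
    using V fin disj by (intro bexp_indep) auto
  also have "\<dots> = (\<Prod>v\<in>V. ((1 + p) ^ m + (1 - p) ^ m) / 2)"
    using V fin by (intro prod.cong refl) (subst bexp_excess_mgf, auto)
  also have "\<dots> = (((1 + p) ^ m + (1 - p) ^ m) / 2) ^ card V" by simp
  also have "\<dots> \<le> exp (?x\<^sup>2) ^ card V"
  proof (rule power_mono)
    have "(1 + p) ^ m \<le> exp p ^ m"
      using p by (intro power_mono) (auto simp: exp_ge_add_one_self)
    moreover have "(1 - p) ^ m \<le> exp (- p) ^ m"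
      using p exp_ge_add_one_self[of "- p"] by (intro power_mono) auto
    moreover have "exp p ^ m = exp ?x" "exp (- p) ^ m = exp (- ?x)"
      by (simp_all add: exp_of_nat_mult[symmetric])
    moreover have "exp ?x \<le> 1 + ?x + ?x\<^sup>2" "exp (- ?x) \<le> 1 + (- ?x) + (- ?x)\<^sup>2"
      using p by (intro exp_le_quadratic; simp)+
    ultimately have "((1 + p) ^ m + (1 - p) ^ m) / 2 \<le> 1 + ?x\<^sup>2" by simp
    also have "\<dots> \<le> exp (?x\<^sup>2)" by (rule exp_ge_add_one_self)
    finally show "((1 + p) ^ m + (1 - p) ^ m) / 2 \<le> exp (?x\<^sup>2)" .
    show "0 \<le> ((1 + p) ^ m + (1 - p) ^ m) / 2" using p by simp
  qed
  also have "\<dots> = exp (real (card V) * ?x\<^sup>2)" by (simp add: exp_of_nat_mult[symmetric])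
  finally show ?thesis by (simp add: divide_right_mono)
qed

text \<open>Matrix position of the t-th edge of a relator, row for the generator and column for the
  inverse, in the order of \<open>link_mult_pm\<close>; the last case stands for t = 2. For fixed
  \<open>t\<close> distinct positions come from disjoint sets of relators, hence independent
  entries, while different \<open>t\<close> share relators.\<close>

definition proj :: "nat \<Rightarrow> nat \<times> nat \<times> nat \<Rightarrow> nat \<times> nat" where
  "proj t = (\<lambda>(i, j, k). if t = 0 then (j, i) else if t = 1 then (k, j) else (i, k))"

definition fibre :: "nat \<Rightarrow> nat \<Rightarrow> nat \<times> nat \<Rightarrow> (nat \<times> nat \<times> nat) set" where
  "fibre m t v = {w \<in> tri_words m. proj t w = v}"

lemma finite_tri_words [simp]: "finite (tri_words m)"
  by (simp add: tri_words_def)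

lemma fibre_subset: "fibre m t v \<subseteq> tri_words m"
  by (auto simp: fibre_def)

lemma finite_fibre [simp]: "finite (fibre m t v)"
  by (rule finite_subset[OF fibre_subset finite_tri_words])

lemma disjoint_fibre: "disjoint_family_on (fibre m t) V"
  by (auto simp: disjoint_family_on_def fibre_def)

lemma card_fibre:
  assumes "v \<in> {..<m} \<times> {..<m}"
  shows "card (fibre m t v) = m"
proof -
  obtain a b where v: "v = (a, b)" "a < m" "b < m" using assms by auto
  let ?f = "\<lambda>x. if t = 0 then (b, a, x) else if t = 1 then (x, b, a) else (a, x, b)"
  have "fibre m t v = ?f ` {..<m}"
    using v by (auto simp: fibre_def tri_words_def proj_def split: if_splits)
  moreover have "inj_on ?f {..<m}" by (auto simp: inj_on_def)
  ultimately have "card (fibre m t v) = card {..<m}" by (simp only: card_image)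
  then show ?thesis by simp
qed

lemma UN_fibre: "(\<Union>v\<in>{..<m} \<times> {..<m}. fibre m t v) = tri_words m"
proof -
  have "proj t w \<in> {..<m} \<times> {..<m}" if "w \<in> tri_words m" for w
    using that by (cases w) (auto simp: proj_def tri_words_def)
  then show ?thesis unfolding fibre_def by blast
qed

lemma link_mult_pm_eq:
  assumes "R \<subseteq> tri_words m"
  shows "link_mult_pm R a b = (\<Sum>t<3. card (R \<inter> fibre m t (a, b)))"
proof -
  have "R \<inter> fibre m 0 (a, b) = {(i, j, k) \<in> R. j = a \<and> i = b}"
    "R \<inter> fibre m 1 (a, b) = {(i, j, k) \<in> R. k = a \<and> j = b}"
    "R \<inter> fibre m 2 (a, b) = {(i, j, k) \<in> R. i = a \<and> k = b}"
    using assms by (auto simp: fibre_def proj_def)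
  moreover have "(\<Sum>t<3. F t) = F 0 + F 1 + F 2" for F :: "nat \<Rightarrow> nat"
    by (simp add: numeral_3_eq_3 numeral_2_eq_2)
  ultimately show ?thesis by (simp add: link_mult_pm_def)
qed

text \<open>The positions met by \<open>R\<close> form a random subset of density \<open>q\<close>.
  Markov's inequality for the trace reduces the claim to its expectation, which the comparison
  transfers to the \<open>r \<times> r\<close> matrix.\<close>

lemma prob_not_op_bound:
  assumes \<rho>: "0 \<le> \<rho>" "\<rho> \<le> 1" and q: "q = 1 - (1 - \<rho>) ^ m" "0 < q" and j: "0 < j" "k = 2 ^ j"
    and r: "q / 2 * real m + real k \<le> real r" and T: "0 < T"
  shows "bexp (tri_words m) \<rho> (\<lambda>R. of_bool (\<not> op_bound m (\<lambda>a b. of_bool ((a, b) \<in> proj t ` R) - q) T))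
    \<le> 2 / q * (real r * ((45/4 * sqrt r) ^ (2 * k) + (2 * real r) ^ (2 * k) * exp (- real r))) / T ^ (2 * k)"
proof -
  let ?V = "{..<m} \<times> {..<m}"
  let ?Y = "\<lambda>R a b. if (a, b) \<in> R then 1 - q else - q"
  have q1: "q \<le> 1" using \<rho> q by simp
  have Y: "(\<lambda>a b. of_bool ((a, b) \<in> R) - q) = ?Y R" for R :: "(nat \<times> nat) set"
    by (intro ext) simp
  have "bexp (tri_words m) \<rho> (\<lambda>R. of_bool (\<not> op_bound m (\<lambda>a b. of_bool ((a, b) \<in> proj t ` R) - q) T))
      = bexp (\<Union>v\<in>?V. fibre m t v) \<rho> (\<lambda>R. of_bool (\<not> op_bound m (?Y (proj t ` R)) T))"
    unfolding UN_fibre Y ..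
  also have "\<dots> = bexp ?V (1 - (1 - \<rho>) ^ m) (\<lambda>R. of_bool (\<not> op_bound m (?Y R) T))"
    by (rule bexp_image[where F = "\<lambda>R. of_bool (\<not> op_bound m (?Y R) T)"])
      (use card_fibre in \<open>auto simp: fibre_def\<close>)
  also have "\<dots> \<le> bexp ?V q (\<lambda>R. walk_sum (?Y R) m k) / T ^ (2 * k)"
    unfolding q(1)[symmetric] j(2)
    using q(2) q1 T j(1) by (intro bexp_markov walk_sum_nonneg walk_sum_ge_if_not_op_bound) auto
  also have "bexp ?V q (\<lambda>R. walk_sum (?Y R) m k)
      \<le> 2 / q * bexp ({..<r} \<times> {..<r}) (1/3) (\<lambda>R. walk_sum (\<lambda>a b. if (a, b) \<in> R then 2 else - 1) r k)"
    using q(2) q1 r j by (intro walk_sum_comparison) auto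
  also have "\<dots> \<le> 2 / q * (real r * ((45/4 * sqrt r) ^ (2 * k) + (2 * real r) ^ (2 * k) * exp (- real r)))"
    using q(2) j by (intro mult_left_mono expected_walk_sum_biased) auto
  finally show ?thesis using T by (simp add: divide_right_mono)
qed

text \<open>Rows and columns as sets of positions, so that the degree and excess estimates serve
  both sides of the bipartition at once.\<close>

definition matrix_lines :: "nat \<Rightarrow> (nat \<times> nat) set set" where
  "matrix_lines m = (\<lambda>a. {a} \<times> {..<m}) ` {..<m} \<union> (\<lambda>b. {..<m} \<times> {b}) ` {..<m}"

lemma finite_matrix_lines [simp]: "finite (matrix_lines m)"
  by (simp add: matrix_lines_def)

lemma card_matrix_lines: "card (matrix_lines m) \<le> 2 * m"
proof -
  have "card (matrix_lines m) \<le> card ((\<lambda>a. {a} \<times> {..<m}) ` {..<m}) + card ((\<lambda>b. {..<m} \<times> {b}) ` {..<m})"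
    unfolding matrix_lines_def by (rule card_Un_le)
  also have "\<dots> \<le> card {..<m} + card {..<m}"
    by (intro add_mono card_image_le) auto
  finally show ?thesis by simp
qed

lemma matrix_linesD:
  assumes "L \<in> matrix_lines m"
  shows "L \<subseteq> {..<m} \<times> {..<m}" "card L = m" "finite L"
proof -
  from assms consider a where "a < m" "L = {a} \<times> {..<m}" | b where "b < m" "L = {..<m} \<times> {b}"
    by (auto simp: matrix_lines_def)
  then show "L \<subseteq> {..<m} \<times> {..<m}" "card L = m" "finite L"
    by (cases; auto)+
qed

lemma card_Int_UN_fibre:
  assumes "finite L" "finite R"
  shows "card (R \<inter> (\<Union>v\<in>L. fibre m t v)) = (\<Sum>v\<in>L. card (R \<inter> fibre m t v))"
proof -
  have "R \<inter> (\<Union>v\<in>L. fibre m t v) = (\<Union>v\<in>L. R \<inter> fibre m t v)" by auto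
  then show ?thesis
    using assms by (simp only:) (intro card_UN_disjoint, auto simp: fibre_def)
qed

text \<open>The deterministic half. An entry minus \<open>q\<close> splits into the centred support,
  of norm at most \<open>T\<close>, and the excess, of norm at most \<open>K\<close> by Schur's
  test. The three matrices are added by the triangle inequality, which explains the factors
  3.\<close>

lemma link_good_if:
  assumes R: "R \<subseteq> tri_words m" and m: "0 < m" and D: "0 < D" and \<delta>: "0 \<le> \<delta>" "\<delta> < 1" and q: "0 \<le> q" and T: "0 \<le> T"
    and op: "\<And>t. t < 3 \<Longrightarrow> op_bound m (\<lambda>a b. of_bool ((a, b) \<in> proj t ` R) - q) T"
    and deg: "\<And>t L. t < 3 \<Longrightarrow> L \<in> matrix_lines m \<Longrightarrow>
      \<bar>real (card (R \<inter> (\<Union>v\<in>L. fibre m t v))) - D\<bar> \<le> \<delta> * D"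
    and exc: "\<And>t L. t < 3 \<Longrightarrow> L \<in> matrix_lines m \<Longrightarrow> (\<Sum>v\<in>L. card (R \<inter> fibre m t v) - 1) < K"
    and \<mu>: "(3 * (T + real K) + 3 * q * real m * \<delta>\<^sup>2) / (3 * D * (1 - \<delta>)) < \<mu>" "\<mu> \<le> 1" "0 < \<mu>"
  shows "link_connected m R \<and> second_largest_eigenvalue (random_walk_mat m R) < \<mu>"
proof -
  let ?N = "\<lambda>t a b. card (R \<inter> fibre m t (a, b))"
  have finR: "finite R" using R finite_tri_words finite_subset by blast
  have row: "{a} \<times> {..<m} \<in> matrix_lines m" and col: "{..<m} \<times> {a} \<in> matrix_lines m" if "a < m" for a
    using that by (auto simp: matrix_lines_def)
  have sum_row: "(\<Sum>v\<in>{a} \<times> {..<m}. f v) = (\<Sum>b<m. f (a, b))" for f :: "nat \<times> nat \<Rightarrow> nat" and a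
    by (rule sum.reindex_bij_witness[of _ "\<lambda>b. (a, b)" snd]) auto
  have sum_col: "(\<Sum>v\<in>{..<m} \<times> {a}. f v) = (\<Sum>b<m. f (b, a))" for f :: "nat \<times> nat \<Rightarrow> nat" and a
    by (rule sum.reindex_bij_witness[of _ "\<lambda>b. (b, a)" fst]) auto
  have op_exc: "op_bound m (\<lambda>a b. real (?N t a b) - q) (T + real K)" if t: "t < 3" for t
  proof -
    have "op_bound m (\<lambda>a b. real (?N t a b - 1)) (real K)"
    proof (rule op_bound_schur)
      fix a assume a: "a < m"
      have "(\<Sum>b<m. ?N t a b - 1) \<le> K" using exc[OF t row[OF a]] by (simp add: sum_row)
      then show "(\<Sum>b<m. real (?N t a b - 1)) \<le> real K"
        unfolding of_nat_sum[symmetric] of_nat_le_iff .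
      have "(\<Sum>b<m. ?N t b a - 1) \<le> K" using exc[OF t col[OF a]] by (simp add: sum_col)
      then show "(\<Sum>b<m. real (?N t b a - 1)) \<le> real K"
        unfolding of_nat_sum[symmetric] of_nat_le_iff .
    qed auto
    then have "op_bound m (\<lambda>a b. (of_bool ((a, b) \<in> proj t ` R) - q) + real (?N t a b - 1)) (T + real K)"
      by (intro op_bound_add op t)
    moreover have "(of_bool ((a, b) \<in> proj t ` R) - q) + real (?N t a b - 1) = real (?N t a b) - q" for a b
    proof (cases "R \<inter> fibre m t (a, b) = {}")
      case True
      then have "(a, b) \<notin> proj t ` R" using R by (auto simp: fibre_def)
      then show ?thesis using True by simp
    next
      case False
      then have "(a, b) \<in> proj t ` R" by (force simp: fibre_def)
      moreover have "0 < ?N t a b" using False finR by (simp add: card_gt_0_iff)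
      ultimately show ?thesis by (simp add: of_nat_diff Suc_le_eq)
    qed
    ultimately show ?thesis by (simp only:)
  qed
  have mult: "real (link_mult_pm R a b) = (\<Sum>t<3. real (?N t a b))" for a b
    by (simp add: link_mult_pm_eq[OF R])
  have degree: "\<bar>(\<Sum>t<3. real (\<Sum>v\<in>L. card (R \<inter> fibre m t v))) - 3 * D\<bar> \<le> \<delta> * (3 * D)"
    if L: "L \<in> matrix_lines m" for L
  proof -
    have "\<bar>(\<Sum>t<3. real (\<Sum>v\<in>L. card (R \<inter> fibre m t v))) - 3 * D\<bar>
        = \<bar>\<Sum>t<(3::nat). real (card (R \<inter> (\<Union>v\<in>L. fibre m t v))) - D\<bar>"
      by (simp add: card_Int_UN_fibre matrix_linesD(3)[OF L] finR sum_subtractf)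
    also have "\<dots> \<le> (\<Sum>t<(3::nat). \<bar>real (card (R \<inter> (\<Union>v\<in>L. fibre m t v))) - D\<bar>)" by (rule sum_abs)
    also have "\<dots> \<le> (\<Sum>t<(3::nat). \<delta> * D)" using deg L by (intro sum_mono) auto
    finally show ?thesis by simp
  qed
  show ?thesis
  proof (rule link_graph_eigenvalue_bound[where d = "3 * D" and \<delta> = \<delta> and c = "3 * q" and T = "3 * (T + real K)"])
    fix a assume a: "a < m"
    have "(\<Sum>b<m. real (link_mult_pm R a b)) = (\<Sum>t<3. real (\<Sum>v\<in>{a} \<times> {..<m}. card (R \<inter> fibre m t v)))"
      unfolding mult sum_row of_nat_sum by (rule sum.swap)
    then show "\<bar>(\<Sum>b<m. real (link_mult_pm R a b)) - 3 * D\<bar> \<le> \<delta> * (3 * D)"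
      using degree[OF row[OF a]] by simp
    have "(\<Sum>b<m. real (link_mult_pm R b a)) = (\<Sum>t<3. real (\<Sum>v\<in>{..<m} \<times> {a}. card (R \<inter> fibre m t v)))"
      unfolding mult sum_col of_nat_sum by (rule sum.swap)
    then show "\<bar>(\<Sum>b<m. real (link_mult_pm R b a)) - 3 * D\<bar> \<le> \<delta> * (3 * D)"
      using degree[OF col[OF a]] by simp
  next
    have "op_bound m (\<lambda>a b. \<Sum>t<(3::nat). real (?N t a b) - q) (real (card {..<3::nat}) * (T + real K))"
      using op_exc by (intro op_bound_sum) auto
    then show "op_bound m (\<lambda>a b. real (link_mult_pm R a b) - 3 * q) (3 * (T + real K))"
      by (simp add: mult sum_subtractf)
  qed (use m D \<delta> q T \<mu> in auto)
qed

lemma bexp_of_bool_ge: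
  assumes p: "0 \<le> p" "p \<le> 1" and U: "finite U"
    and E: "\<And>R. R \<subseteq> U \<Longrightarrow> \<not> E R \<Longrightarrow> 1 \<le> F R" and F: "\<And>R. R \<subseteq> U \<Longrightarrow> 0 \<le> F R"
  shows "1 - bexp U p F \<le> bexp U p (\<lambda>R. of_bool (E R))"
proof -
  have "1 - bexp U p F = bexp U p (\<lambda>R. 1 - F R)"
    using U by (simp add: bexp_diff bexp_const)
  also have "\<dots> \<le> bexp U p (\<lambda>R. of_bool (E R))"
  proof (rule bexp_mono[OF p])
    fix R assume "R \<subseteq> U"
    then show "1 - F R \<le> of_bool (E R)" using E[of R] F[of R] by (cases "E R") auto
  qed
  finally show ?thesis .
qed

lemma pos_tri_prob_eq_bexp: "pos_tri_prob m \<rho> E = bexp (tri_words m) \<rho> (\<lambda>R. of_bool (E R))"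
proof -
  have "bexp (tri_words m) \<rho> (\<lambda>R. of_bool (E R))
      = (\<Sum>R\<in>{R. R \<subseteq> tri_words m \<and> E R}. \<rho> ^ card R * (1 - \<rho>) ^ card (tri_words m - R))"
    unfolding bexp_def by (rule sum.mono_neutral_cong_right) auto
  also have "\<dots> = pos_tri_prob m \<rho> E"
    unfolding pos_tri_prob_def
    by (intro sum.cong refl) (auto simp: card_Diff_subset finite_subset[OF _ finite_tri_words])
  finally show ?thesis by simp
qed

text \<open>Union bound over 3 norm events and over the degree and excess events of at most 2 m
  lines for each of 3 values of \<open>t\<close>; hence the factors 3 and 6 m.\<close>

lemma link_good_prob_ge:
  fixes \<rho> q D \<delta> T \<mu> :: real
  assumes m: "0 < m" and \<rho>: "0 \<le> \<rho>" "\<rho> \<le> 1" "real m * \<rho> \<le> 1" and q: "q = 1 - (1 - \<rho>) ^ m" "0 < q"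
    and D: "D = real m * real m * \<rho>" "0 < D" and \<delta>: "0 < \<delta>" "\<delta> < 1"
    and j: "0 < j" "k = 2 ^ j" and r: "q / 2 * real m + real k \<le> real r" and T: "0 < T"
    and \<mu>: "(3 * (T + real K) + 3 * q * real m * \<delta>\<^sup>2) / (3 * D * (1 - \<delta>)) < \<mu>" "\<mu> \<le> 1" "0 < \<mu>"
  shows "1 - (3 * (2 / q * (real r * ((45/4 * sqrt r) ^ (2 * k) + (2 * real r) ^ (2 * k) * exp (- real r))) / T ^ (2 * k))
        + 6 * real m * (2 * exp (- \<delta>\<^sup>2 * D / 4) + exp (real m * (real m * \<rho>)\<^sup>2) / 2 ^ K))
    \<le> pos_tri_prob m \<rho> (\<lambda>R. link_connected m R \<and> second_largest_eigenvalue (random_walk_mat m R) < \<mu>)"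
proof -
  let ?U = "tri_words m"
  define b1 where "b1 t R = (of_bool (\<not> op_bound m (\<lambda>a b. of_bool ((a, b) \<in> proj t ` R) - q) T) :: real)" for t R
  define b2 where "b2 t L R = (of_bool (\<delta> * D < \<bar>real (card (R \<inter> (\<Union>v\<in>L. fibre m t v))) - D\<bar>) :: real)" for t L R
  define b3 where "b3 t L R = (of_bool (K \<le> (\<Sum>v\<in>L. card (R \<inter> fibre m t v) - 1)) :: real)" for t L R
  \<comment> \<open>The number of failed conditions: being a sum of indicators, it is below 1 only
    if none fails.\<close>
  define F where "F R = (\<Sum>t<(3::nat). b1 t R + (\<Sum>L\<in>matrix_lines m. b2 t L R + b3 t L R))" for R
  let ?B1 = "2 / q * (real r * ((45/4 * sqrt r) ^ (2 * k) + (2 * real r) ^ (2 * k) * exp (- real r))) / T ^ (2 * k)"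
  let ?B2 = "2 * exp (- \<delta>\<^sup>2 * D / 4)"
  let ?B3 = "exp (real m * (real m * \<rho>)\<^sup>2) / 2 ^ K"
  have nonneg: "0 \<le> b1 t R" "0 \<le> b2 t L R" "0 \<le> b3 t L R" for t L R
    by (simp_all add: b1_def b2_def b3_def)
  have inner_nonneg: "0 \<le> (\<Sum>L\<in>matrix_lines m. b2 t L R + b3 t L R)" for t R
    using nonneg by (intro sum_nonneg add_nonneg_nonneg)
  have F1: "b1 t R + (\<Sum>L\<in>matrix_lines m. b2 t L R + b3 t L R) \<le> F R" if "t < 3" for t R
    unfolding F_def using that nonneg inner_nonneg
    by (intro member_le_sum[where f = "\<lambda>t. b1 t R + (\<Sum>L\<in>matrix_lines m. b2 t L R + b3 t L R)"] add_nonneg_nonneg) auto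
  have F2: "b2 t L R + b3 t L R \<le> (\<Sum>L\<in>matrix_lines m. b2 t L R + b3 t L R)" if "L \<in> matrix_lines m" for t L R
    using that nonneg by (intro member_le_sum[where f = "\<lambda>L. b2 t L R + b3 t L R"] add_nonneg_nonneg) auto
  have "1 - bexp ?U \<rho> F
      \<le> bexp ?U \<rho> (\<lambda>R. of_bool (link_connected m R \<and> second_largest_eigenvalue (random_walk_mat m R) < \<mu>))"
  proof (rule bexp_of_bool_ge[OF \<rho>(1,2) finite_tri_words])
    fix R assume R: "R \<subseteq> ?U"
    show "0 \<le> F R" unfolding F_def using nonneg inner_nonneg by (intro sum_nonneg add_nonneg_nonneg)
    assume bad: "\<not> (link_connected m R \<and> second_largest_eigenvalue (random_walk_mat m R) < \<mu>)"
    show "1 \<le> F R"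
    proof (rule ccontr)
      assume less: "\<not> 1 \<le> F R"
      have b1: "b1 t R < 1" if "t < 3" for t
        using F1[OF that, of R] inner_nonneg[of t R] less by linarith
      have b23: "b2 t L R < 1" "b3 t L R < 1" if "t < 3" "L \<in> matrix_lines m" for t L
        using F1[OF that(1), of R] F2[OF that(2), of t R] nonneg(1)[of t R] nonneg(2)[of t L R] nonneg(3)[of t L R] less by linarith+
      have "link_connected m R \<and> second_largest_eigenvalue (random_walk_mat m R) < \<mu>"
      proof (rule link_good_if[OF R m D(2) _ \<delta>(2) _ _ _ _ _ \<mu>])
        fix t :: nat and L assume t: "t < 3"
        show "op_bound m (\<lambda>a b. of_bool ((a, b) \<in> proj t ` R) - q) T"
          using b1[OF t] unfolding b1_def by (rule_tac ccontr) simp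
        assume L: "L \<in> matrix_lines m"
        show "\<bar>real (card (R \<inter> (\<Union>v\<in>L. fibre m t v))) - D\<bar> \<le> \<delta> * D"
          using b23(1)[OF t L] unfolding b2_def by (rule_tac ccontr) simp
        show "(\<Sum>v\<in>L. card (R \<inter> fibre m t v) - 1) < K"
          using b23(2)[OF t L] unfolding b3_def by (rule_tac ccontr) simp
      qed (use \<delta> q T in auto)
      then show False using bad by blast
    qed
  qed
  moreover have "bexp ?U \<rho> F \<le> 3 * ?B1 + 6 * real m * (?B2 + ?B3)"
  proof -
    have B1: "bexp ?U \<rho> (b1 t) \<le> ?B1" for t
      unfolding b1_def by (rule prob_not_op_bound[OF \<rho>(1,2) q j r T])
    have B2: "bexp ?U \<rho> (b2 t L) \<le> ?B2" if L: "L \<in> matrix_lines m" for t L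
    proof -
      have "card (\<Union>v\<in>L. fibre m t v) = (\<Sum>v\<in>L. card (fibre m t v))"
        using matrix_linesD[OF L] disjoint_fibre by (intro card_UN_disjoint) (auto simp: fibre_def)
      also have "\<dots> = (\<Sum>v\<in>L. m)"
        using matrix_linesD[OF L] by (intro sum.cong refl card_fibre) auto
      also have "\<dots> = m * m" using matrix_linesD[OF L] by simp
      finally have "D = real (card (\<Union>v\<in>L. fibre m t v)) * \<rho>" by (simp add: D)
      moreover have "(\<Union>v\<in>L. fibre m t v) \<subseteq> tri_words m" using fibre_subset by blast
      ultimately show ?thesis
        unfolding b2_def using \<rho> \<delta> by (intro bexp_chernoff) auto
    qed
    have B3: "bexp ?U \<rho> (b3 t L) \<le> ?B3" if L: "L \<in> matrix_lines m" for t L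
    proof -
      have "bexp ?U \<rho> (b3 t L) \<le> exp (real (card L) * (real m * \<rho>)\<^sup>2) / 2 ^ K"
        unfolding b3_def using matrix_linesD[OF L] fibre_subset card_fibre \<rho>
        by (intro prob_excess_sum disjoint_fibre) auto
      then show ?thesis using matrix_linesD[OF L] by simp
    qed
    have "bexp ?U \<rho> F = (\<Sum>t<(3::nat). bexp ?U \<rho> (b1 t)
        + (\<Sum>L\<in>matrix_lines m. bexp ?U \<rho> (b2 t L) + bexp ?U \<rho> (b3 t L)))"
      unfolding F_def bexp_sum bexp_add ..
    also have "\<dots> \<le> (\<Sum>t<(3::nat). ?B1 + (\<Sum>L\<in>matrix_lines m. ?B2 + ?B3))"
      by (intro sum_mono add_mono B1 B2 B3)
    also have "\<dots> = 3 * ?B1 + 3 * (real (card (matrix_lines m)) * (?B2 + ?B3))"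
      by simp
    also have "\<dots> \<le> 3 * ?B1 + 3 * (real (2 * m) * (?B2 + ?B3))"
      by (intro add_left_mono mult_left_mono mult_right_mono of_nat_mono card_matrix_lines)
        (auto simp: add_nonneg_nonneg)
    finally show ?thesis by simp
  qed
  ultimately show ?thesis unfolding pos_tri_prob_eq_bexp by linarith
qed

section \<open>The limit\<close>

text \<open>Repeated squaring needs exponents that are powers of two, so a walk length of order ln m
  is rounded up to one.\<close>

lemma ex_power_of_two_between:
  fixes y :: real
  assumes "1 < y"
  obtains j where "0 < j" "y \<le> 2 ^ j" "2 ^ j \<le> 2 * y"
proof -
  obtain n where "y < 2 ^ n" using real_arch_pow[of 2 y] by auto
  then have ex: "\<exists>n. y \<le> 2 ^ n" by (intro exI[of _ n]) simp
  define j where "j = (LEAST n. y \<le> 2 ^ n)"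
  have le: "y \<le> 2 ^ j" unfolding j_def using ex by (rule LeastI_ex)
  then have "j \<noteq> 0" using assms by (intro notI) simp
  then obtain i where i: "j = Suc i" using not0_implies_Suc by blast
  have "\<not> y \<le> 2 ^ i" using not_less_Least[of i "\<lambda>n. y \<le> 2 ^ n"] i unfolding j_def by simp
  then show thesis using that[of j] le i by simp
qed

text \<open>The comparison matrix has norm at most \<open>8 sqrt D\<close>, and the threshold for the norm is \<open>9 sqrt D\<close>, so
  \<open>k \<ge> 20 ln m\<close> makes the trace bound \<open>(64/81)^k\<close> at most \<open>m^(-4)\<close>, which beats the number of rows.\<close>

lemma link_good_prob_quantitative:
  fixes \<rho> D :: real
  assumes m: "1 < m" and \<rho>: "0 < \<rho>" "\<rho> \<le> 1" "real m * \<rho> \<le> 1" "real m * (real m * \<rho>)\<^sup>2 \<le> 1"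
    and D: "D = real m * real m * \<rho>" "100 \<le> D"
    and log1: "40 * ln m + 1 \<le> D / 200" and log2: "40 * ln m * ln D \<le> D / 4"
    and gap: "(91/10 * sqrt D + D powr (1/3)) / (D * (1 - D powr (- 1/3))) < 10 / sqrt D"
  shows "1 - (15 / m + 6 * m * (2 * exp (- (D powr (1/3)) / 4) + 6 * 2 powr (- sqrt D / 10)))
    \<le> pos_tri_prob m \<rho> (\<lambda>R. link_connected m R \<and> second_largest_eigenvalue (random_walk_mat m R) < 10 / sqrt D)"
proof -
  define p where "p = real m * \<rho>"
  define q where "q = 1 - (1 - \<rho>) ^ m"
  \<comment> \<open>Small enough that D \<delta>^2 = D^(1/3) is negligible against sqrt D, large
    enough that the Chernoff exponent, of the same order, dominates ln m.\<close>
  define \<delta> where "\<delta> = D powr (- 1/3)"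
  \<comment> \<open>The excess may use a tenth of sqrt D, while 2^(-K) has to beat the number of
    lines.\<close>
  define K where "K = nat \<lfloor>sqrt D / 10\<rfloor>"
  let ?T = "9 * sqrt D"
  have mpos: "0 < real m" using m by simp
  have p: "0 < p" "p \<le> 1" using \<rho> m by (simp_all add: p_def)
  have Dp: "D = real m * p" by (simp add: D p_def)
  have lnm: "1/2 \<le> ln (real m)"
  proof -
    have "1 - 1 / real m \<le> ln (real m)"
      using mpos ln_le_minus_one[of "1 / real m"] by (simp add: ln_div)
    moreover have "1 / real m \<le> 1/2" using m by (simp add: field_simps)
    ultimately show ?thesis by linarith
  qed
  have q_le: "q \<le> p"
    using Bernoulli_inequality[of "- \<rho>" m] \<rho> by (simp add: q_def p_def)
  have q_ge: "p / 2 \<le> q"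
  proof -
    have "(1 - \<rho>) ^ m \<le> exp (- \<rho>) ^ m"
      using \<rho> exp_ge_add_one_self[of "- \<rho>"] by (intro power_mono) auto
    also have "\<dots> = exp (- p)" by (simp add: exp_of_nat_mult[symmetric] p_def)
    also have "\<dots> \<le> 1 - p + p\<^sup>2 / 2" using p by (intro exp_minus_upper) simp
    also have "p\<^sup>2 \<le> p" using p mult_left_mono[of p 1 p] by (simp add: power2_eq_square)
    finally show ?thesis by (simp add: q_def)
  qed
  have qpos: "0 < q" using q_ge p by linarith
  obtain j where j: "0 < j" "20 * ln (real m) \<le> 2 ^ j" "2 ^ j \<le> 2 * (20 * ln (real m))"
    using ex_power_of_two_between[of "20 * ln (real m)"] lnm by auto
  define k :: nat where "k = 2 ^ j"
  have k: "20 * ln (real m) \<le> real k" "real k \<le> 40 * ln (real m)" using j by (simp_all add: k_def)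
  define r where "r = nat \<lceil>q / 2 * real m\<rceil> + k"
  have qm: "0 \<le> q / 2 * real m" using qpos by simp
  have r_ge: "q / 2 * real m + real k \<le> real r"
    using qm by (simp add: r_def; linarith)
  have "real r \<le> q / 2 * real m + 1 + real k"
    using qm by (simp add: r_def; linarith)
  moreover have "q / 2 * real m \<le> D / 2" using q_le mpos by (simp add: Dp mult.commute)
  \<comment> \<open>By \<open>log1\<close>, rounding and the summand \<open>k\<close> cost at most
    D/200; the factor 101/200 still keeps (45/4)^2 r below 64 D.\<close>
  ultimately have r_le: "real r \<le> 101/200 * D" using k log1 by linarith
  have "D / 4 \<le> q / 2 * real m" using q_ge mpos by (simp add: Dp field_simps)
  then have r_ge': "D / 4 \<le> real r" using r_ge by linarith
  have \<delta>: "0 < \<delta>" "\<delta> < 1"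
    using D(2) powr_less_mono[of "- 1/3" 0 D] by (simp_all add: \<delta>_def)
  have \<delta>D: "\<delta>\<^sup>2 * D = D powr (1/3)"
  proof -
    have "\<delta>\<^sup>2 * D = D powr (- 1/3) * D powr (- 1/3) * D powr 1"
      using D(2) by (simp add: \<delta>_def power2_eq_square)
    also have "\<dots> = D powr (1/3)" unfolding powr_add[symmetric] by simp
    finally show ?thesis .
  qed
  have K_le: "real K \<le> sqrt D / 10" using D(2) of_nat_floor[of "sqrt D / 10"] by (simp add: K_def)
  have \<mu>: "(3 * (?T + real K) + 3 * q * real m * \<delta>\<^sup>2) / (3 * D * (1 - \<delta>)) < 10 / sqrt D"
  proof -
    have "q * real m * \<delta>\<^sup>2 \<le> D * \<delta>\<^sup>2"
      using q_le mpos by (intro mult_right_mono) (simp_all add: Dp mult.commute)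
    then have "?T + real K + q * real m * \<delta>\<^sup>2 \<le> 91/10 * sqrt D + D powr (1/3)"
      using K_le \<delta>D by (simp add: mult.commute)
    then have "(?T + real K + q * real m * \<delta>\<^sup>2) / (D * (1 - \<delta>)) \<le> (91/10 * sqrt D + D powr (1/3)) / (D * (1 - \<delta>))"
      using D(2) \<delta> by (intro divide_right_mono) auto
    also have "\<dots> < 10 / sqrt D" using gap by (simp only: \<delta>_def)
    finally have *: "(?T + real K + q * real m * \<delta>\<^sup>2) / (D * (1 - \<delta>)) < 10 / sqrt D" .
    have "(3 * (?T + real K) + 3 * q * real m * \<delta>\<^sup>2) / (3 * D * (1 - \<delta>))
        = (3 * (?T + real K + q * real m * \<delta>\<^sup>2)) / (3 * (D * (1 - \<delta>)))"
      by (simp add: algebra_simps)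
    also have "\<dots> = (?T + real K + q * real m * \<delta>\<^sup>2) / (D * (1 - \<delta>))" by (rule mult_divide_mult_cancel_left) simp
    finally show ?thesis using * by simp
  qed
  have sqrtD: "10 \<le> sqrt D" using D(2) real_le_rsqrt[of 10 D] by simp
  then have \<mu>': "10 / sqrt D \<le> 1" "0 < 10 / sqrt D"
    using D(2) by (auto simp: pos_divide_le_eq)
  let ?Q = "2 / q * (real r * ((45/4 * sqrt r) ^ (2 * k) + (2 * real r) ^ (2 * k) * exp (- real r))) / ?T ^ (2 * k)"
  let ?e2 = "exp (- \<delta>\<^sup>2 * D / 4)" and ?e3 = "exp (real m * (real m * \<rho>)\<^sup>2) / 2 ^ K"
  have main: "1 - (3 * ?Q + 6 * real m * (2 * ?e2 + ?e3))
    \<le> pos_tri_prob m \<rho> (\<lambda>R. link_connected m R \<and> second_largest_eigenvalue (random_walk_mat m R) < 10 / sqrt D)"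
    using m \<rho> D(2) \<delta> j(1) qpos r_ge \<mu> \<mu>'
    by (intro link_good_prob_ge[OF _ _ _ _ q_def _ D(1) _ _ _ _ k_def]) auto
  have "?Q \<le> 5 / m"
  proof -
    have A: "(45/4 * sqrt r) ^ (2 * k) \<le> (64 * D) ^ k"
    proof -
      have "(45/4 * sqrt r) ^ (2 * k) = (2025/16 * real r) ^ k"
        by (simp add: power_mult power_mult_distrib power_divide)
      also have "\<dots> \<le> (64 * D) ^ k" using r_le D(2) by (intro power_mono) auto
      finally show ?thesis .
    qed
    have B: "(2 * real r) ^ (2 * k) * exp (- real r) \<le> (64 * D) ^ k"
    proof -
      have "real r * real r \<le> D * D" using r_le D(2) by (intro mult_mono) auto
      then have "4 * (real r)\<^sup>2 \<le> 64 * D * D"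
        using zero_le_square[of D] unfolding power2_eq_square by linarith
      then have "(4 * (real r)\<^sup>2) ^ k \<le> (64 * D * D) ^ k" by (intro power_mono) auto
      moreover have "(2 * real r) ^ (2 * k) = (4 * (real r)\<^sup>2) ^ k"
        by (simp add: power_mult power_mult_distrib)
      ultimately have "(2 * real r) ^ (2 * k) * exp (- real r) \<le> (64 * D) ^ k * (D ^ k * exp (- real r))"
        by (simp add: power_mult_distrib mult_ac)
      \<comment> \<open>\<open>log2\<close> bounds k ln D by D/4, which is at most \<open>r\<close>,
        so the small probability absorbs the second factor D^k.\<close>
      also have "D ^ k * exp (- real r) \<le> 1"
      proof -
        have "0 \<le> ln D" using D(2) by simp
        then have "real k * ln D \<le> 40 * ln (real m) * ln D" using k(2) by (rule mult_right_mono[rotated])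
        then have "real k * ln D \<le> real r" using log2 r_ge' by linarith
        moreover have "D ^ k = exp (real k * ln D)" using D(2) by (simp add: exp_of_nat_mult)
        ultimately show ?thesis by (simp add: exp_add[symmetric])
      qed
      finally show ?thesis using D(2) by (simp add: mult_left_mono)
    qed
    have T: "?T ^ (2 * k) = (81 * D) ^ k"
      using D(2) by (simp add: power_mult power_mult_distrib)
    have ratio: "(64 * D) ^ k / (81 * D) ^ k \<le> 1 / real m ^ 4"
    proof -
      have "(64/81 :: real) \<le> exp (- (1/5))"
      proof -
        have "exp (1/5 :: real) \<le> 81/64"
          using exp_bound[of "1/5 :: real"] by (simp add: power2_eq_square)
        then have "inverse (81/64 :: real) \<le> inverse (exp (1/5))" by (intro le_imp_inverse_le) auto
        then show ?thesis by (simp add: exp_minus)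
      qed
      then have "(64/81 :: real) ^ k \<le> exp (- (1/5)) ^ k" by (intro power_mono) auto
      also have "\<dots> = exp (- (real k / 5))" by (simp add: exp_of_nat_mult[symmetric])
      also have "\<dots> \<le> exp (- (4 * ln (real m)))" using k(1) by simp
      also have "\<dots> = 1 / real m ^ 4"
        using mpos exp_of_nat_mult[of 4 "ln (real m)"] by (simp add: exp_minus inverse_eq_divide)
      also have "(64/81 :: real) ^ k = (64 * D) ^ k / (81 * D) ^ k"
        using D(2) by (simp add: power_divide[symmetric])
      finally show ?thesis .
    qed
    \<comment> \<open>Since r <= 101/200 m p and q >= p/2, the factors \<open>r\<close> and 1/q
      together cost only about m.\<close>
    have rq: "real r / q \<le> 101/100 * real m"
    proof -
      have "real r \<le> 101/200 * (real m * p)" using r_le Dp by simp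
      also have "\<dots> \<le> 101/200 * (real m * (2 * q))" using q_ge mpos by (intro mult_left_mono) auto
      finally show ?thesis using qpos by (simp add: divide_le_eq mult_ac)
    qed
    have "?Q \<le> 2 / q * (real r * ((64 * D) ^ k + (64 * D) ^ k)) / ?T ^ (2 * k)"
      using A B qpos D(2) by (intro divide_right_mono mult_left_mono add_mono) auto
    also have "\<dots> = 4 * (real r / q) * ((64 * D) ^ k / (81 * D) ^ k)"
      unfolding T by (simp add: mult_ac)
    also have "\<dots> \<le> 4 * (101/100 * real m) * (1 / real m ^ 4)"
      using D(2) qpos by (intro mult_mono mult_left_mono rq ratio) auto
    also have "\<dots> = 404/100 * (1 / real m ^ 3)"
      using mpos by (simp add: power_eq_if)
    also have "\<dots> \<le> 5 * (1 / real m)"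
    proof (intro mult_mono divide_left_mono)
      show "real m \<le> real m ^ 3" using m by (intro self_le_power) auto
    qed (use mpos in auto)
    finally show ?thesis by simp
  qed
  \<comment> \<open>Here e <= 3, and the floor in \<open>K\<close> loses at most a factor 2, which
    makes 6.\<close>
  moreover have "?e3 \<le> 6 * 2 powr (- sqrt D / 10)"
  proof -
    have "exp (real m * (real m * \<rho>)\<^sup>2) \<le> exp 1" using \<rho> by simp
    also have "\<dots> \<le> 1 + 1 + 1\<^sup>2" by (intro exp_bound) auto
    finally have e: "exp (real m * (real m * \<rho>)\<^sup>2) \<le> 3" by simp
    have "sqrt D / 10 - 1 \<le> real K"
      using D(2) real_of_int_floor_add_one_ge[of "sqrt D / 10"] unfolding K_def by linarith
    then have "2 powr (sqrt D / 10 - 1) \<le> 2 powr real K" by (intro powr_mono) auto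
    also have "\<dots> = 2 ^ K" by (simp add: powr_realpow)
    finally have "2 powr (sqrt D / 10) / 2 \<le> 2 ^ K" by (simp add: powr_diff)
    then have "?e3 \<le> 3 / (2 powr (sqrt D / 10) / 2)"
      using e by (intro frac_le) auto
    then show ?thesis by (simp add: powr_minus_divide)
  qed
  moreover have "?e2 = exp (- (D powr (1/3)) / 4)" using \<delta>D by simp
  ultimately have "3 * ?Q + 6 * real m * (2 * ?e2 + ?e3)
      \<le> 3 * (5 / m) + 6 * real m * (2 * exp (- (D powr (1/3)) / 4) + 6 * 2 powr (- sqrt D / 10))"
    by (intro add_mono mult_left_mono) auto
  then show ?thesis using main by simp
qed

lemma pos_tri_prob_le_1:
  assumes "0 \<le> \<rho>" "\<rho> \<le> 1"
  shows "pos_tri_prob m \<rho> E \<le> 1"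
proof -
  have "bexp (tri_words m) \<rho> (\<lambda>R. of_bool (E R)) \<le> bexp (tri_words m) \<rho> (\<lambda>R. 1)"
    using assms by (intro bexp_mono) auto
  then show ?thesis by (simp add: pos_tri_prob_eq_bexp bexp_const)
qed

theorem theorem4p15:
  fixes \<alpha> C :: real
  assumes "3/2 < \<alpha>" and "\<alpha> < 2" and "C > 0"
  shows "(\<lambda>m::nat. pos_tri_prob m (C / real m powr \<alpha>)
            (\<lambda>R. link_connected m R \<and>
                 second_largest_eigenvalue (random_walk_mat m R)
                   < 10 / (sqrt C * real m powr (1 - \<alpha> / 2))))
         \<longlonglongrightarrow> 1"
proof -
  define \<beta> where "\<beta> = 2 - \<alpha>"
  have \<beta>: "0 < \<beta>" "\<beta> < 1/2" and C: "0 < C" using assms by (simp_all add: \<beta>_def)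
  define D where "D m = C * real m powr \<beta>" for m :: nat
  define err where "err m = 15 / real m
      + 6 * real m * (2 * exp (- (D m powr (1/3)) / 4) + 6 * 2 powr (- sqrt (D m) / 10))" for m
  let ?P = "\<lambda>m::nat. pos_tri_prob m (C / real m powr \<alpha>)
            (\<lambda>R. link_connected m R \<and> second_largest_eigenvalue (random_walk_mat m R)
                   < 10 / (sqrt C * real m powr (1 - \<alpha> / 2)))"
  have D_lim: "filterlim D at_top sequentially"
    unfolding D_def using \<beta> C by real_asymp
  have ev1: "eventually (\<lambda>m. C / real m powr \<alpha> \<le> 1) sequentially"
    using assms by real_asymp
  have ev2: "eventually (\<lambda>m. real m * (C / real m powr \<alpha>) \<le> 1) sequentially"
    using assms by real_asymp
  \<comment> \<open>The left side is C^2 m^(3 - 2 \<alpha>), which tends to 0 because \<alpha> >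
    3/2.\<close>
  have ev3: "eventually (\<lambda>m. real m * (real m * (C / real m powr \<alpha>))\<^sup>2 \<le> 1) sequentially"
    using assms by real_asymp
  have ev4: "eventually (\<lambda>m. 40 * ln (real m) + 1 \<le> D m / 200) sequentially"
    unfolding D_def using \<beta> C by real_asymp
  have ev5: "eventually (\<lambda>m. 40 * ln (real m) * ln (D m) \<le> D m / 4) sequentially"
    unfolding D_def using \<beta> C by real_asymp
  \<comment> \<open>In the variable d alone: the leading constants are 91/10 and 10, and all other
    terms are of lower order. The claim is pulled back along \<open>D\<close> afterwards.\<close>
  have "eventually (\<lambda>d. (91/10 * sqrt d + d powr (1/3)) / (d * (1 - d powr (- 1/3))) < 10 / sqrt d) at_top"
    by real_asymp
  then have ev6: "eventually (\<lambda>m. (91/10 * sqrt (D m) + D m powr (1/3)) / (D m * (1 - D m powr (- 1/3)))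
      < 10 / sqrt (D m)) sequentially"
    using D_lim by (rule eventually_compose_filterlim)
  have ev7: "eventually (\<lambda>m. 100 \<le> D m) sequentially"
    using D_lim unfolding filterlim_at_top by blast
  \<comment> \<open>The exponents are positive powers of m, which beat the factor m in front however
    small \<beta> is.\<close>
  have err_lim: "err \<longlonglongrightarrow> 0"
    unfolding err_def D_def using \<beta> C by real_asymp
  have bound: "eventually (\<lambda>m. 1 - err m \<le> ?P m \<and> ?P m \<le> 1) sequentially"
    using ev1 ev2 ev3 ev4 ev5 ev6 ev7 eventually_gt_at_top[of 1]
  proof eventually_elim
    case (elim m)
    have m: "0 < real m" using elim by simp
    have D_eq: "D m = real m * real m * (C / real m powr \<alpha>)"
      using m by (simp add: D_def \<beta>_def powr_diff power2_eq_square powr_numeral)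
    have "sqrt (D m) = sqrt C * real m powr (1 - \<alpha> / 2)"
      using m by (simp add: D_def real_sqrt_mult powr_half_sqrt[symmetric] powr_powr \<beta>_def diff_divide_distrib)
    then have "1 - err m \<le> ?P m"
      using link_good_prob_quantitative[of m "C / real m powr \<alpha>" "D m"] elim C D_eq m
      by (simp add: err_def)
    moreover have "?P m \<le> 1" using elim C by (intro pos_tri_prob_le_1) auto
    ultimately show ?case ..
  qed
  show ?thesis
  proof (rule tendsto_sandwich)
    show "(\<lambda>m. 1 - err m) \<longlonglongrightarrow> 1" using tendsto_diff[OF tendsto_const err_lim] by simp
    show "eventually (\<lambda>m. 1 - err m \<le> ?P m) sequentially" "eventually (\<lambda>m. ?P m \<le> 1) sequentially"
      using bound by (auto elim: eventually_mono)
  qed simp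
qed

end
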